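(* There exist an absolute constant $c>0$ and, for every $s,R>0$, a constant $N_{s,R}\ge 86$ depending only on $s$ and $R$ such that the following holds. For all $s,R>0$, all $n\ge N_{s,R}$ and all $\Delta\ge 0$, the classifier $\hat\Phi_{d_n}$ with $d_n=\lfloor (R^2 n)^{\frac{1}{2s+1}}\rfloor$ satisfies \[ \sup_{\substack{f,g\in\mathcal H_s(R)\\ \|f-g\|\ge\Delta}}\Big\{\mathcal R_{f,g}(\hat\Phi_{d_n})-\inf_{\Phi}\mathcal R_{f,g}(\Phi)\Big\}\le \begin{cases} c\,R^{\frac{1}{2s+1}}n^{-\frac{s}{2s+1}}\log(n) & \text{if } \Delta< R^{\frac{1}{2s+1}}n^{-\frac{s}{2s+1}}\log(n),\\[0.3em] \dfrac{c}{\Delta}R^{\frac{2}{2s+1}}n^{-\frac{2s}{2s+1}}\log^2(n) & \text{if } \Delta\ge R^{\frac{1}{2s+1}}n^{-\frac{s}{2s+1}}\log(n).\end{cases} \]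
   Context: Model: for $f,g\in\mathbb L^2([0,1])$, a pair $(X,Y)$ is generated by $Y\sim\mathrm{Bernoulli}(1/2)$ independent of a standard Brownian motion $(W(t))_{t\in[0,1]}$, and $dX(t)=Yf(t)\,dt+(1-Y)g(t)\,dt+dW(t)$, $t\in[0,1]$ (with $X(0)=0$). The learner observes $n$ i.i.d. copies $(X_1,Y_1),\dots,(X_n,Y_n)$ of $(X,Y)$. A classifier is a measurable map (possibly depending on the sample) from continuous trajectories to $\{0,1\}$; its risk is $\mathcal R_{f,g}(\Phi)=\mathbb P(\Phi(X)\ne Y)$, where the probability is over both the sample and an independent new pair $(X,Y)$; the infimum is over all classifiers. $\|\cdot\|$ and $\langle\cdot,\cdot\rangle$ are the $\mathbb L^2([0,1])$ norm and inner product, and for $\varphi\in\mathbb L^2$ one writes $\langle\varphi,X\rangle=\int_0^1\varphi(t)\,dX(t)$. Fix an orthonormal basis $(\varphi_j)_{j\ge1}$ of $\mathbb L^2([0,1])$ and set $c_j(h)=\langle\varphi_j,h\rangle$; the Sobolev-type class is $\mathcal H_s(R)=\{h\in\mathbb L^2([0,1]):\sum_{j\ge1}c_j(h)^2j^{2s}\le R^2\}$. Classifier $\hat\Phi_d$ ($d\in\mathbb N^*$): let $N_k=\#\{i:Y_i=k\}$, $k\in\{0,1\}$. For $1\le j\le d$ let $\hat\theta_j=\mathbf 1_{\{N_1>0\}}N_1^{-1}\sum_{i:Y_i=1}\langle\varphi_j,X_i\rangle$ and $\hat\mu_j=\mathbf 1_{\{N_0>0\}}N_0^{-1}\sum_{i:Y_i=0}\langle\varphi_j,X_i\rangle$,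 $\hat\theta=(\hat\theta_j)_{j\le d}$, $\hat\mu=(\hat\mu_j)_{j\le d}$. For a new trajectory $X$ let $\mathbf X_d=(\langle\varphi_1,X\rangle,\dots,\langle\varphi_d,X\rangle)\in\mathbb R^d$ and set $\hat\Phi_d(X)=1$ if $\|\mathbf X_d-\hat\theta\|_d\le\|\mathbf X_d-\hat\mu\|_d$ and $\hat\Phi_d(X)=0$ otherwise, where $\|\cdot\|_d$ is the Euclidean norm of $\mathbb R^d$. *)

theory Defs
  imports "HOL-Probability.Probability"
begin

definition L2_01 :: "(real \<Rightarrow> real) set" where
  "L2_01 = {h. h \<in> borel_measurable lborel \<and> set_integrable lborel {0..1} (\<lambda>t. (h t)^2)}"

definition l2_inner :: "(real \<Rightarrow> real) \<Rightarrow> (real \<Rightarrow> real) \<Rightarrow> real" where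
  "l2_inner f g = (LINT t:{0..1}|lborel. f t * g t)"

definition l2_norm :: "(real \<Rightarrow> real) \<Rightarrow> real" where
  "l2_norm h = sqrt (l2_inner h h)"

text \<open>Orthonormal (Hilbert) basis \<open>(\<phi>_j)_{j\<ge>1}\<close> of L2([0,1]); the value \<open>\<phi> 0\<close> is unused.\<close>
definition orthonormal_basis_L2 :: "(nat \<Rightarrow> real \<Rightarrow> real) \<Rightarrow> bool" where
  "orthonormal_basis_L2 \<phi> \<longleftrightarrow>
     (\<forall>j\<ge>1. \<phi> j \<in> L2_01) \<and>
     (\<forall>i\<ge>1. \<forall>j\<ge>1. l2_inner (\<phi> i) (\<phi> j) = (if i = j then 1 else 0)) \<and>
     (\<forall>h\<in>L2_01. (\<forall>j\<ge>1. l2_inner (\<phi> j) h = 0) \<longrightarrow> l2_norm h = 0)"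

definition sobolev_class :: "(nat \<Rightarrow> real \<Rightarrow> real) \<Rightarrow> real \<Rightarrow> real \<Rightarrow> (real \<Rightarrow> real) set" where
  "sobolev_class \<phi> s R = {h \<in> L2_01.
     (\<lambda>j. (l2_inner (\<phi> j) h)^2 * real j powr (2 * s)) summable_on {1..} \<and>
     (\<Sum>\<^sub>\<infinity>j\<in>{1..}. (l2_inner (\<phi> j) h)^2 * real j powr (2 * s)) \<le> R^2}"

definition traj_space :: "(real \<Rightarrow> real) measure" where
  "traj_space = (\<Pi>\<^sub>M t\<in>{0..1}. borel)"

definition standard_BM :: "'a measure \<Rightarrow> ('a \<Rightarrow> real \<Rightarrow> real) \<Rightarrow> bool" where
  "standard_BM M W \<longleftrightarrow>
     prob_space M \<and>
     (\<forall>t\<in>{0..1}. (\<lambda>\<omega>. W \<omega> t) \<in> borel_measurable M) \<and>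
     (AE \<omega> in M. W \<omega> 0 = 0 \<and> continuous_on {0..1} (W \<omega>)) \<and>
     (\<forall>(k::nat) (t::nat \<Rightarrow> real). 0 \<le> t 0 \<and> t k \<le> 1 \<and> (\<forall>i<k. t i < t (Suc i)) \<longrightarrow>
        prob_space.indep_vars M (\<lambda>_. borel) (\<lambda>i \<omega>. W \<omega> (t (Suc i)) - W \<omega> (t i)) {..<k} \<and>
        (\<forall>i<k. distributed M lborel (\<lambda>\<omega>. W \<omega> (t (Suc i)) - W \<omega> (t i))
                 (normal_density 0 (sqrt (t (Suc i) - t i)))))"

text \<open>The sample \<open>(W_i,Y_i)\<close>, \<open>i = 1..n\<close>, together with the new pair \<open>(W_0,Y_0)\<close>:
  independent copies, \<open>W_i\<close> standard BM, \<open>Y_i ~ Bernoulli(1/2)\<close> (True = label 1),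
  \<open>Y_i\<close> independent of \<open>W_i\<close> (independence of the generated sigma-algebras;
  the library's \<open>indep_var\<close> requires both variables to have the same type).\<close>
definition bm_model :: "'a measure \<Rightarrow> nat \<Rightarrow> (nat \<Rightarrow> 'a \<Rightarrow> real \<Rightarrow> real) \<Rightarrow> (nat \<Rightarrow> 'a \<Rightarrow> bool) \<Rightarrow> bool" where
  "bm_model M n W Y \<longleftrightarrow>
     prob_space M \<and>
     (\<forall>i\<le>n. standard_BM M (W i) \<and>
        Y i \<in> measurable M (count_space UNIV) \<and>
        measure M {\<omega> \<in> space M. Y i \<omega>} = 1/2 \<and>
        prob_space.indep_sets M (case_bool
           {(\<lambda>\<omega>. restrict (W i \<omega>) {0..1}) -` A \<inter> space M | A. A \<in> sets traj_space}
           {Y i -` B \<inter> space M | B. B \<in> sets (count_space (UNIV::bool set))}) UNIV) \<and>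
     prob_space.indep_vars M (\<lambda>_. traj_space \<Otimes>\<^sub>M count_space UNIV)
        (\<lambda>i \<omega>. (restrict (W i \<omega>) {0..1}, Y i \<omega>)) {..n}"

definition drift :: "(real \<Rightarrow> real) \<Rightarrow> real \<Rightarrow> real" where
  "drift h t = (LINT u:{0..t}|lborel. h u)"

text \<open>\<open>X(t) = Y \<int>_0^t f + (1-Y) \<int>_0^t g + W(t)\<close>, i.e. \<open>dX = Yf dt + (1-Y)g dt + dW\<close>, \<open>X(0)=0\<close>.\<close>
definition obs_path :: "(real \<Rightarrow> real) \<Rightarrow> (real \<Rightarrow> real) \<Rightarrow> ('a \<Rightarrow> real \<Rightarrow> real) \<Rightarrow> ('a \<Rightarrow> bool)
    \<Rightarrow> 'a \<Rightarrow> real \<Rightarrow> real" where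
  "obs_path f g W Y \<omega> = restrict (\<lambda>t. (if Y \<omega> then drift f t else drift g t) + W \<omega> t) {0..1}"

definition dyadic_coef :: "(real \<Rightarrow> real) \<Rightarrow> nat \<Rightarrow> nat \<Rightarrow> real" where
  "dyadic_coef \<phi> k m = 2^k * (LINT u:{real m / 2^k .. real (Suc m) / 2^k}|lborel. \<phi> u)"

definition dyadic_sum :: "(real \<Rightarrow> real) \<Rightarrow> (real \<Rightarrow> real) \<Rightarrow> nat \<Rightarrow> real" where
  "dyadic_sum \<phi> x k = (\<Sum>m<2^k. dyadic_coef \<phi> k m * (x (real (Suc m) / 2^k) - x (real m / 2^k)))"

text \<open>The integral is the \<open>L^2(M)\<close>-limit of the step-function integrals (defined up to null sets).\<close>
definition stoch_int :: "'a measure \<Rightarrow> (real \<Rightarrow> real) \<Rightarrow> ('a \<Rightarrow> real \<Rightarrow> real) \<Rightarrow> 'a \<Rightarrow> real" where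
  "stoch_int M \<phi> X = (SOME Z. Z \<in> borel_measurable M \<and>
      (\<lambda>k. \<integral>\<^sup>+\<omega>. ennreal ((Z \<omega> - dyadic_sum \<phi> (X \<omega>) k)^2) \<partial>M) \<longlonglongrightarrow> 0)"

text \<open>\<open>Z i j \<omega> = \<langle>\<phi>_j, X_i\<rangle>\<close>; index 0 is the new observation, 1..n the sample.
  Value True means the classifier outputs 1.\<close>
definition hat_Phi :: "nat \<Rightarrow> nat \<Rightarrow> (nat \<Rightarrow> 'a \<Rightarrow> bool) \<Rightarrow> (nat \<Rightarrow> nat \<Rightarrow> 'a \<Rightarrow> real) \<Rightarrow> 'a \<Rightarrow> bool" where
  "hat_Phi d n Y Z \<omega> =
    (let N1 = card {i\<in>{1..n}. Y i \<omega>};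
         N0 = card {i\<in>{1..n}. \<not> Y i \<omega>};
         \<theta> = (\<lambda>j. if N1 > 0 then (\<Sum>i\<in>{i\<in>{1..n}. Y i \<omega>}. Z i j \<omega>) / real N1 else 0);
         \<mu> = (\<lambda>j. if N0 > 0 then (\<Sum>i\<in>{i\<in>{1..n}. \<not> Y i \<omega>}. Z i j \<omega>) / real N0 else 0)
     in L2_set (\<lambda>j. Z 0 j \<omega> - \<theta> j) {1..d} \<le> L2_set (\<lambda>j. Z 0 j \<omega> - \<mu> j) {1..d})"

definition classifier_space :: "nat \<Rightarrow> ((nat \<Rightarrow> (real \<Rightarrow> real) \<times> bool) \<times> (real \<Rightarrow> real)) measure" where
  "classifier_space n = (\<Pi>\<^sub>M i\<in>{1..n}. traj_space \<Otimes>\<^sub>M count_space UNIV) \<Otimes>\<^sub>M traj_space"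

definition sample_data :: "nat \<Rightarrow> (nat \<Rightarrow> 'a \<Rightarrow> real \<Rightarrow> real) \<Rightarrow> (nat \<Rightarrow> 'a \<Rightarrow> bool) \<Rightarrow> 'a
    \<Rightarrow> (nat \<Rightarrow> (real \<Rightarrow> real) \<times> bool) \<times> (real \<Rightarrow> real)" where
  "sample_data n X Y \<omega> = ((\<lambda>i\<in>{1..n}. (X i \<omega>, Y i \<omega>)), X 0 \<omega>)"

definition opt_risk :: "'a measure \<Rightarrow> nat \<Rightarrow> (nat \<Rightarrow> 'a \<Rightarrow> real \<Rightarrow> real) \<Rightarrow> (nat \<Rightarrow> 'a \<Rightarrow> bool) \<Rightarrow> real" where
  "opt_risk M n X Y = (INF \<Phi> \<in> measurable (classifier_space n) (count_space UNIV).
      measure M {\<omega> \<in> space M. \<Phi> (sample_data n X Y \<omega>) \<noteq> Y 0 \<omega>})"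

end

theory Submission
  imports Defs
begin

text \<open>
  Write \<open>\<delta> = \<parallel>f - g\<parallel>\<close> and let \<open>Q\<close> be the upper tail of the standard normal law.

  Lower bound: any classifier has risk at least \<open>Q (\<delta>/2)\<close>. Given the sample it is a measurable set of paths,
  which is approximated by a cylinder set; on cylinders the two laws of the new path are Gaussian products, the
  Neyman-Pearson test is linear, and the shift has length at most \<open>\<delta>\<close> by Bessel's inequality for interval indicators.

  Upper bound: given the sample, the classifier compares a linear functional of a Gaussian vector with a threshold,
  so its risk is \<open>(Q a + Q a') / 2\<close> for explicit \<open>a\<close>, \<open>a'\<close>. The sum \<open>a + a'\<close> differs from the norm \<open>D\<close> of the first
  \<open>d\<close> coefficients of \<open>f - g\<close> only to second order in the estimation error \<open>E\<close>, and \<open>a - a'\<close> is at most \<open>E\<close>; a second-order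
  expansion of \<open>Q\<close> bounds the conditional excess risk by a constant times \<open>(\<rho>\<^sup>2 + E\<^sup>2) / max \<delta> \<rho>\<close>, where
  \<open>\<rho> = R\<^bsup>1/(2s+1)\<^esup> n\<^bsup>-s/(2s+1)\<^esup>\<close> dominates both the bias and \<open>sqrt (d/n)\<close>. When both labels occur at
  least \<open>n/4\<close> times the mean of \<open>E\<^sup>2\<close> is of order \<open>\<rho>\<^sup>2\<close>; otherwise the risk is bounded by 1, and by Chebyshev's inequality
  this has probability at most \<open>4/n\<close>. Averaging yields the rate even without the logarithms.
\<close>

section \<open>Square-integrable functions\<close>

text \<open>Two obstacles shape the proof. \<open>stoch_int\<close> is chosen for each random path
  separately and is fixed only up to null sets, so neither independence nor normality can be read
  off it; it is replaced, almost surely, by a class coefficient plus \<open>wiener_int\<close>,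
  which is a single measurable functional of trajectories. And \<open>traj_space\<close> carries the
  product sigma-algebra over uncountably many times, in which continuity of a path is not an event;
  the lower bound therefore works with finitely many increments and never with a density on path
  space.

  A first-order bound would only give the rate \<rho>, since E is itself of that order in mean
  square. The gain to \<rho>^2 / \<delta> rests on the equal weights of the two classes, which
  cancel the term linear in a - a', and on the fact that truncation enters through squared
  coefficients. The two bounds use L2 differently: truncation calls for Parseval's identity and thus
  for completeness of the basis, while the lower bound sees only intervals.\<close>

definition sq_integrable :: "'a measure \<Rightarrow> ('a \<Rightarrow> real) \<Rightarrow> bool" where
  "sq_integrable M f \<longleftrightarrow> f \<in> borel_measurable M \<and> integrable M (\<lambda>x. (f x)\<^sup>2)"

lemma sq_integrable_square: "sq_integrable M f \<Longrightarrow> integrable M (\<lambda>x. (f x)\<^sup>2)"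
  by (simp add: sq_integrable_def)

lemma sq_integrable_mult:
  assumes "sq_integrable M f" "sq_integrable M g"
  shows "integrable M (\<lambda>x. f x * g x)"
proof (rule Bochner_Integration.integrable_bound)
  show "integrable M (\<lambda>x. (f x)\<^sup>2 + (g x)\<^sup>2)"
    using assms by (auto simp: sq_integrable_def)
  show "(\<lambda>x. f x * g x) \<in> borel_measurable M"
    using assms by (auto simp: sq_integrable_def)
  show "AE x in M. norm (f x * g x) \<le> norm ((f x)\<^sup>2 + (g x)\<^sup>2)"
  proof (intro AE_I2)
    fix x
    have "2 * (\<bar>f x\<bar> * \<bar>g x\<bar>) \<le> (f x)\<^sup>2 + (g x)\<^sup>2"
      using sum_squares_bound[of "\<bar>f x\<bar>" "\<bar>g x\<bar>"] by simp
    moreover have "0 \<le> \<bar>f x\<bar> * \<bar>g x\<bar>" by simp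
    ultimately have "\<bar>f x\<bar> * \<bar>g x\<bar> \<le> (f x)\<^sup>2 + (g x)\<^sup>2" by linarith
    then show "norm (f x * g x) \<le> norm ((f x)\<^sup>2 + (g x)\<^sup>2)"
      by (simp add: abs_mult)
  qed
qed

lemma sq_integrable_add:
  assumes "sq_integrable M f" "sq_integrable M g"
  shows "sq_integrable M (\<lambda>x. f x + g x)"
proof -
  have "integrable M (\<lambda>x. (f x)\<^sup>2 + (g x)\<^sup>2 + 2 * (f x * g x))"
    using assms sq_integrable_mult[OF assms] by (auto simp: sq_integrable_def)
  moreover have "(\<lambda>x. (f x)\<^sup>2 + (g x)\<^sup>2 + 2 * (f x * g x)) = (\<lambda>x. (f x + g x)\<^sup>2)"
    by (auto simp: power2_sum)
  ultimately show ?thesis using assms by (auto simp: sq_integrable_def)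
qed

lemma sq_integrable_cmult: "sq_integrable M f \<Longrightarrow> sq_integrable M (\<lambda>x. c * f x)"
  by (auto simp: sq_integrable_def power_mult_distrib)

lemma sq_integrable_diff:
  "sq_integrable M f \<Longrightarrow> sq_integrable M g \<Longrightarrow> sq_integrable M (\<lambda>x. f x - g x)"
  using sq_integrable_add[of M f "\<lambda>x. (-1) * g x"] sq_integrable_cmult[of M g "-1"] by simp

lemma sq_integrable_zero: "sq_integrable M (\<lambda>x. 0)"
  by (simp add: sq_integrable_def)

lemma sq_integrable_sum:
  "(\<And>i. i \<in> I \<Longrightarrow> sq_integrable M (f i)) \<Longrightarrow> sq_integrable M (\<lambda>x. \<Sum>i\<in>I. f i x)"
  by (induction I rule: infinite_finite_induct) (auto intro: sq_integrable_add sq_integrable_zero)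

lemma (in finite_measure) sq_integrable_bounded:
  assumes "f \<in> borel_measurable M" "\<And>x. \<bar>f x\<bar> \<le> K"
  shows "sq_integrable M f"
  unfolding sq_integrable_def
proof (intro conjI integrable_const_bound[where B="K\<^sup>2"])
  show "AE x in M. norm ((f x)\<^sup>2) \<le> K\<^sup>2"
    using assms(2) by (auto intro!: AE_I2 power2_le_iff_abs_le[THEN iffD2] order_trans[OF abs_ge_zero])
qed (use assms in auto)

lemma (in finite_measure) sq_integrable_imp_integrable:
  "sq_integrable M f \<Longrightarrow> integrable M f"
  using sq_integrable_mult[of M f "\<lambda>_. 1"] sq_integrable_bounded[of "\<lambda>_. 1" 1] by simp

text \<open>The integral of (s f + t g)^2 is a nonnegative quadratic form in (s, t). At (s, t) =
  (-b, a) it equals a (a c - b^2), and dividing by a > 0 gives the claim.\<close>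

lemma sq_Cauchy_Schwarz:
  assumes f: "sq_integrable M f" and g: "sq_integrable M g"
  shows "(\<integral>x. f x * g x \<partial>M)\<^sup>2 \<le> (\<integral>x. (f x)\<^sup>2 \<partial>M) * (\<integral>x. (g x)\<^sup>2 \<partial>M)"
proof -
  define a where "a = (\<integral>x. (f x)\<^sup>2 \<partial>M)"
  define b where "b = (\<integral>x. f x * g x \<partial>M)"
  define c where "c = (\<integral>x. (g x)\<^sup>2 \<partial>M)"
  have q: "0 \<le> s\<^sup>2 * a + 2 * s * t * b + t\<^sup>2 * c" for s t
  proof -
    have "0 \<le> (\<integral>x. (s * f x + t * g x)\<^sup>2 \<partial>M)" by simp
    also have "(\<lambda>x. (s * f x + t * g x)\<^sup>2) = (\<lambda>x. s\<^sup>2 * (f x)\<^sup>2 + (2 * s * t * (f x * g x) + t\<^sup>2 * (g x)\<^sup>2))"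
      by (auto simp: power2_eq_square algebra_simps)
    also have "(\<integral>x. s\<^sup>2 * (f x)\<^sup>2 + (2 * s * t * (f x * g x) + t\<^sup>2 * (g x)\<^sup>2) \<partial>M) =
        s\<^sup>2 * a + (2 * s * t * b + t\<^sup>2 * c)"
      unfolding a_def b_def c_def using f g sq_integrable_mult[OF f g]
      by (simp add: sq_integrable_def)
    finally show ?thesis by simp
  qed
  have "0 \<le> a" "0 \<le> c" by (auto simp: a_def c_def)
  have "b\<^sup>2 \<le> a * c"
  proof (cases "a = 0")
    case True
    have "b = 0"
    proof (rule ccontr)
      assume "b \<noteq> 0"
      \<comment> \<open>With a = 0 the form at t = 1 is 2 s b + c, and this s makes it equal to
        -1.\<close>
      have "2 * (- (c + 1) / (2 * b)) * b = - (c + 1)" using \<open>b \<noteq> 0\<close> by (simp add: field_simps)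
      then show False using q[of "- (c+1) / (2 * b)" 1] True by simp
    qed
    then show ?thesis using True by simp
  next
    case False
    then have "a > 0" using \<open>0 \<le> a\<close> by simp
    have "0 \<le> a * (a * c - b\<^sup>2)" using q[of "-b" a] by (simp add: power2_eq_square algebra_simps)
    then show ?thesis using \<open>a > 0\<close> by (simp add: zero_le_mult_iff)
  qed
  then show ?thesis by (simp add: a_def b_def c_def)
qed

text \<open>Distances stay squared throughout, so the triangle inequality takes the form (u + v)^2
  \<le> 2 u^2 + 2 v^2. This is why tolerances are split as e / 4 below.\<close>

lemma sq_dist_triangle:
  assumes "sq_integrable M f" "sq_integrable M g" "sq_integrable M h"
  shows "(\<integral>x. (f x - h x)\<^sup>2 \<partial>M) \<le> 2 * (\<integral>x. (f x - g x)\<^sup>2 \<partial>M) + 2 * (\<integral>x. (g x - h x)\<^sup>2 \<partial>M)"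
proof -
  have i: "integrable M (\<lambda>x. (f x - g x)\<^sup>2)" "integrable M (\<lambda>x. (g x - h x)\<^sup>2)" "integrable M (\<lambda>x. (f x - h x)\<^sup>2)"
    using assms by (auto intro!: sq_integrable_square sq_integrable_diff)
  have "(\<integral>x. (f x - h x)\<^sup>2 \<partial>M) \<le> (\<integral>x. 2 * (f x - g x)\<^sup>2 + 2 * (g x - h x)\<^sup>2 \<partial>M)"
  proof (rule integral_mono)
    fix x
    have "0 \<le> ((f x - g x) - (g x - h x))\<^sup>2" by simp
    then show "(f x - h x)\<^sup>2 \<le> 2 * (f x - g x)\<^sup>2 + 2 * (g x - h x)\<^sup>2"
      by (simp add: power2_eq_square algebra_simps)
  qed (use i in auto)
  then show ?thesis using i by simp
qed

lemma sq_tendsto_inner: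
  assumes fk: "\<And>k. sq_integrable M (F k)" and f: "sq_integrable M f" and g: "sq_integrable M g"
    and lim: "(\<lambda>k. \<integral>x. (F k x - f x)\<^sup>2 \<partial>M) \<longlonglongrightarrow> 0"
  shows "(\<lambda>k. \<integral>x. F k x * g x \<partial>M) \<longlonglongrightarrow> (\<integral>x. f x * g x \<partial>M)"
proof -
  define G where "G = (\<integral>x. (g x)\<^sup>2 \<partial>M)"
  have le: "norm ((\<integral>x. F k x * g x \<partial>M) - (\<integral>x. f x * g x \<partial>M)) \<le> sqrt ((\<integral>x. (F k x - f x)\<^sup>2 \<partial>M) * G)" for k
  proof -
    have "(\<integral>x. F k x * g x \<partial>M) - (\<integral>x. f x * g x \<partial>M) = (\<integral>x. (F k x - f x) * g x \<partial>M)"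
      using sq_integrable_mult[OF fk g] sq_integrable_mult[OF f g] by (simp add: left_diff_distrib)
    moreover have "(\<integral>x. (F k x - f x) * g x \<partial>M)\<^sup>2 \<le> (\<integral>x. (F k x - f x)\<^sup>2 \<partial>M) * G"
      unfolding G_def by (intro sq_Cauchy_Schwarz sq_integrable_diff fk f g)
    ultimately show ?thesis by (simp add: real_le_rsqrt)
  qed
  have "(\<lambda>k. sqrt ((\<integral>x. (F k x - f x)\<^sup>2 \<partial>M) * G)) \<longlonglongrightarrow> sqrt (0 * G)"
    by (intro tendsto_intros lim)
  then have lim0: "(\<lambda>k. sqrt ((\<integral>x. (F k x - f x)\<^sup>2 \<partial>M) * G)) \<longlonglongrightarrow> 0"
    by (simp only: mult_zero_left real_sqrt_zero)
  have "(\<lambda>k. (\<integral>x. F k x * g x \<partial>M) - (\<integral>x. f x * g x \<partial>M)) \<longlonglongrightarrow> 0"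
    by (rule Lim_null_comparison[OF always_eventually lim0]) (rule allI, rule le)
  then show ?thesis by (rule LIM_zero_cancel)
qed

lemma sq_tendsto_norm:
  assumes fk: "\<And>k. sq_integrable M (F k)" and f: "sq_integrable M f"
    and lim: "(\<lambda>k. \<integral>x. (F k x - f x)\<^sup>2 \<partial>M) \<longlonglongrightarrow> 0"
  shows "(\<lambda>k. \<integral>x. (F k x)\<^sup>2 \<partial>M) \<longlonglongrightarrow> (\<integral>x. (f x)\<^sup>2 \<partial>M)"
proof -
  have "(\<integral>x. (F k x)\<^sup>2 \<partial>M) = (\<integral>x. (F k x - f x)\<^sup>2 \<partial>M) + 2 * (\<integral>x. F k x * f x \<partial>M) - (\<integral>x. (f x)\<^sup>2 \<partial>M)" for k
  proof -
    have "(\<lambda>x. (F k x - f x)\<^sup>2) = (\<lambda>x. (F k x)\<^sup>2 - 2 * (F k x * f x) + (f x)\<^sup>2)"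
      by (auto simp: power2_eq_square algebra_simps)
    then show ?thesis
      using sq_integrable_square[OF fk[of k]] sq_integrable_square[OF f] sq_integrable_mult[OF fk[of k] f] by simp
  qed
  moreover have "(\<lambda>k. (\<integral>x. (F k x - f x)\<^sup>2 \<partial>M) + 2 * (\<integral>x. F k x * f x \<partial>M) - (\<integral>x. (f x)\<^sup>2 \<partial>M))
     \<longlonglongrightarrow> 0 + 2 * (\<integral>x. f x * f x \<partial>M) - (\<integral>x. (f x)\<^sup>2 \<partial>M)"
    by (intro tendsto_intros lim sq_tendsto_inner fk f)
  ultimately show ?thesis by (simp add: power2_eq_square)
qed

text \<open>Weights \<open>w i\<close> other than 1 let the same identity serve the basis functions,
  the indicators of intervals (weight = length) and centred independent random variables (weight =
  variance). With f = 0 it gives the squared norm of an orthogonal sum.\<close>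

lemma sq_orthogonal_expansion:
  assumes I: "finite I" and f: "sq_integrable M f" and e: "\<And>i. i \<in> I \<Longrightarrow> sq_integrable M (e i)"
    and orth: "\<And>i j. i \<in> I \<Longrightarrow> j \<in> I \<Longrightarrow> (\<integral>x. e i x * e j x \<partial>M) = (if i = j then w i else 0)"
  shows "(\<integral>x. (f x - (\<Sum>i\<in>I. a i * e i x))\<^sup>2 \<partial>M) =
    (\<integral>x. (f x)\<^sup>2 \<partial>M) - 2 * (\<Sum>i\<in>I. a i * (\<integral>x. f x * e i x \<partial>M)) + (\<Sum>i\<in>I. w i * (a i)\<^sup>2)"
proof -
  have eq: "(\<lambda>x. (f x - (\<Sum>i\<in>I. a i * e i x))\<^sup>2) =
    (\<lambda>x. (f x)\<^sup>2 - 2 * (\<Sum>i\<in>I. a i * (f x * e i x)) + (\<Sum>i\<in>I. \<Sum>j\<in>I. a i * a j * (e i x * e j x)))"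
  proof
    fix x
    have "(\<Sum>i\<in>I. \<Sum>j\<in>I. a i * a j * (e i x * e j x)) = (\<Sum>i\<in>I. a i * e i x)\<^sup>2"
      unfolding power2_eq_square sum_product by (intro sum.cong refl) (simp add: ac_simps)
    moreover have "(\<Sum>i\<in>I. a i * (f x * e i x)) = f x * (\<Sum>i\<in>I. a i * e i x)"
      unfolding sum_distrib_left by (intro sum.cong refl) (simp add: ac_simps)
    ultimately show "(f x - (\<Sum>i\<in>I. a i * e i x))\<^sup>2 = (f x)\<^sup>2 - 2 * (\<Sum>i\<in>I. a i * (f x * e i x)) + (\<Sum>i\<in>I. \<Sum>j\<in>I. a i * a j * (e i x * e j x))"
      by (simp add: power2_diff)
  qed
  have i1: "integrable M (\<lambda>x. a i * (f x * e i x))" if "i \<in> I" for i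
    using sq_integrable_mult[OF f e[OF that]] by simp
  have i2: "integrable M (\<lambda>x. a i * a j * (e i x * e j x))" if "i \<in> I" "j \<in> I" for i j
    using sq_integrable_mult[OF e[OF that(1)] e[OF that(2)]] by simp
  have s1: "(\<integral>x. (\<Sum>i\<in>I. a i * (f x * e i x)) \<partial>M) = (\<Sum>i\<in>I. a i * (\<integral>x. f x * e i x \<partial>M))"
    using i1 by simp
  have "(\<integral>x. (\<Sum>i\<in>I. \<Sum>j\<in>I. a i * a j * (e i x * e j x)) \<partial>M) = (\<Sum>i\<in>I. \<Sum>j\<in>I. a i * a j * (\<integral>x. e i x * e j x \<partial>M))"
    using i2 by (simp add: Bochner_Integration.integral_sum Bochner_Integration.integrable_sum)
  also have "\<dots> = (\<Sum>i\<in>I. \<Sum>j\<in>I. if i = j then w i * (a i)\<^sup>2 else 0)"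
    by (intro sum.cong refl) (auto simp: orth power2_eq_square)
  also have "\<dots> = (\<Sum>i\<in>I. w i * (a i)\<^sup>2)" using I by simp
  finally have s2: "(\<integral>x. (\<Sum>i\<in>I. \<Sum>j\<in>I. a i * a j * (e i x * e j x)) \<partial>M) = (\<Sum>i\<in>I. w i * (a i)\<^sup>2)" .
  have I1: "integrable M (\<lambda>x. \<Sum>i\<in>I. a i * (f x * e i x))"
    using i1 by (intro Bochner_Integration.integrable_sum)
  have I2: "integrable M (\<lambda>x. \<Sum>i\<in>I. \<Sum>j\<in>I. a i * a j * (e i x * e j x))"
    using i2 by (intro Bochner_Integration.integrable_sum)
  show ?thesis unfolding eq
    using I1 I2 sq_integrable_square[OF f] by (simp add: s1 s2)
qed

text \<open>At the coefficients <f, e_i> / w_i the expansion is the squared norm of f minus the sum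
  in question, and it is nonnegative.\<close>

lemma sq_Bessel:
  assumes I: "finite I" and f: "sq_integrable M f" and e: "\<And>i. i \<in> I \<Longrightarrow> sq_integrable M (e i)"
    and orth: "\<And>i j. i \<in> I \<Longrightarrow> j \<in> I \<Longrightarrow> (\<integral>x. e i x * e j x \<partial>M) = (if i = j then w i else 0)"
    and w: "\<And>i. i \<in> I \<Longrightarrow> w i > 0"
  shows "(\<Sum>i\<in>I. (\<integral>x. f x * e i x \<partial>M)\<^sup>2 / w i) \<le> (\<integral>x. (f x)\<^sup>2 \<partial>M)"
proof -
  let ?a = "\<lambda>i. (\<integral>x. f x * e i x \<partial>M) / w i"
  have "0 \<le> (\<integral>x. (f x - (\<Sum>i\<in>I. ?a i * e i x))\<^sup>2 \<partial>M)" by simp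
  also have "\<dots> = (\<integral>x. (f x)\<^sup>2 \<partial>M) - 2 * (\<Sum>i\<in>I. ?a i * (\<integral>x. f x * e i x \<partial>M)) + (\<Sum>i\<in>I. w i * (?a i)\<^sup>2)"
    by (rule sq_orthogonal_expansion[OF I f e orth])
  also have "(\<Sum>i\<in>I. ?a i * (\<integral>x. f x * e i x \<partial>M)) = (\<Sum>i\<in>I. (\<integral>x. f x * e i x \<partial>M)\<^sup>2 / w i)"
    by (intro sum.cong refl) (simp add: power2_eq_square)
  also have "(\<Sum>i\<in>I. w i * (?a i)\<^sup>2) = (\<Sum>i\<in>I. (\<integral>x. f x * e i x \<partial>M)\<^sup>2 / w i)"
    using w by (intro sum.cong refl) (auto simp: power2_eq_square field_simps dest: less_imp_neq)
  finally show ?thesis by simp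
qed

text \<open>Subtracting the two expansions and completing squares leaves the sum of w_i (a_i -
  b_i)^2, where b_i are the projection coefficients.\<close>

lemma sq_best_approximation:
  assumes I: "finite I" and f: "sq_integrable M f" and e: "\<And>i. i \<in> I \<Longrightarrow> sq_integrable M (e i)"
    and orth: "\<And>i j. i \<in> I \<Longrightarrow> j \<in> I \<Longrightarrow> (\<integral>x. e i x * e j x \<partial>M) = (if i = j then w i else 0)"
    and w: "\<And>i. i \<in> I \<Longrightarrow> w i > 0"
  shows "(\<integral>x. (f x - (\<Sum>i\<in>I. ((\<integral>x. f x * e i x \<partial>M) / w i) * e i x))\<^sup>2 \<partial>M)
    \<le> (\<integral>x. (f x - (\<Sum>i\<in>I. a i * e i x))\<^sup>2 \<partial>M)"
proof -
  let ?c = "\<lambda>i. (\<integral>x. f x * e i x \<partial>M)"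
  let ?b = "\<lambda>i. ?c i / w i"
  have "(\<integral>x. (f x - (\<Sum>i\<in>I. a i * e i x))\<^sup>2 \<partial>M) - (\<integral>x. (f x - (\<Sum>i\<in>I. ?b i * e i x))\<^sup>2 \<partial>M)
     = (\<Sum>i\<in>I. w i * (a i)\<^sup>2 - 2 * (a i * ?c i) - (w i * (?b i)\<^sup>2 - 2 * (?b i * ?c i)))"
    using sq_orthogonal_expansion[OF I f e orth, of a] sq_orthogonal_expansion[OF I f e orth, of ?b]
    by (simp add: sum_subtractf sum_distrib_left)
  also have "\<dots> = (\<Sum>i\<in>I. w i * (a i - ?b i)\<^sup>2)"
    by (intro sum.cong refl, drule w) (auto simp: power2_eq_square field_simps)
  also have "\<dots> \<ge> 0" using w by (intro sum_nonneg mult_nonneg_nonneg) (auto intro: less_imp_le)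
  finally show ?thesis by simp
qed

section \<open>Completeness of the square-integrable functions along fast subsequences\<close>

lemma (in prob_space) sq_L1_le_L2:
  assumes "sq_integrable M f"
  shows "(\<integral>x. \<bar>f x\<bar> \<partial>M)\<^sup>2 \<le> (\<integral>x. (f x)\<^sup>2 \<partial>M)"
proof -
  have "sq_integrable M (\<lambda>x. \<bar>f x\<bar>)" using assms by (auto simp: sq_integrable_def)
  from sq_Cauchy_Schwarz[OF this sq_integrable_bounded[of "\<lambda>_. 1" 1]]
  show ?thesis by (simp add: prob_space)
qed

text \<open>On a probability space the L1 norm of an increment is at most its L2 norm, here (1/2)^m.
  These bounds are summable, so by monotone convergence the increments are absolutely summable
  almost everywhere.\<close>

lemma (in prob_space) sq_fast_Cauchy_AE_convergent:
  assumes S: "\<And>m. sq_integrable M (S m)"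
    and fast: "\<And>m. (\<integral>x. (S (Suc m) x - S m x)\<^sup>2 \<partial>M) \<le> (1/4)^m"
  shows "AE x in M. convergent (\<lambda>m. S m x)"
proof -
  have [measurable]: "S m \<in> borel_measurable M" for m using S by (simp add: sq_integrable_def)
  have d: "sq_integrable M (\<lambda>x. S (Suc m) x - S m x)" for m by (intro sq_integrable_diff S)
  have l1: "(\<integral>\<^sup>+x. ennreal \<bar>S (Suc m) x - S m x\<bar> \<partial>M) \<le> ennreal ((1/2)^m)" for m
  proof -
    have "(\<integral>x. \<bar>S (Suc m) x - S m x\<bar> \<partial>M)\<^sup>2 \<le> (1/4)^m"
      using sq_L1_le_L2[OF d] fast order_trans by blast
    also have "(1/4::real)^m = ((1/2)^m)\<^sup>2"
      by (simp add: power2_eq_square flip: power_mult_distrib)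
    finally have "(\<integral>x. \<bar>S (Suc m) x - S m x\<bar> \<partial>M) \<le> (1/2)^m"
      by (rule power2_le_imp_le) simp
    then show ?thesis
      using sq_integrable_imp_integrable[OF d, of m] by (subst nn_integral_eq_integral) (auto intro: ennreal_leI)
  qed
  have "(\<integral>\<^sup>+x. (\<Sum>m. ennreal \<bar>S (Suc m) x - S m x\<bar>) \<partial>M) = (\<Sum>m. \<integral>\<^sup>+x. ennreal \<bar>S (Suc m) x - S m x\<bar> \<partial>M)"
    by (intro nn_integral_suminf) auto
  also have "\<dots> \<le> (\<Sum>m. ennreal ((1/2)^m))" by (intro suminf_le l1 summableI)
  also have "\<dots> = ennreal (\<Sum>m. (1/2)^m)"
    by (intro suminf_ennreal2) auto
  also have "\<dots> < \<infinity>" by simp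
  finally have "AE x in M. (\<Sum>m. ennreal \<bar>S (Suc m) x - S m x\<bar>) \<noteq> \<infinity>"
    by (intro nn_integral_PInf_AE) auto
  then show ?thesis
  proof eventually_elim
    fix x assume "(\<Sum>m. ennreal \<bar>S (Suc m) x - S m x\<bar>) \<noteq> \<infinity>"
    then have "summable (\<lambda>m. \<bar>S (Suc m) x - S m x\<bar>)"
      by (intro summable_suminf_not_top) auto
    then have "summable (\<lambda>m. S (Suc m) x - S m x)" by (rule summable_rabs_cancel)
    then have "convergent (\<lambda>n. \<Sum>m<n. S (Suc m) x - S m x)" by (rule summable_iff_convergent[THEN iffD1])
    moreover have "(\<Sum>m<n. S (Suc m) x - S m x) = S n x - S 0 x" for n
      by (rule sum_lessThan_telescope[of "\<lambda>m. S m x"])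
    ultimately have "convergent (\<lambda>n. S n x - S 0 x)" by simp
    then have "convergent (\<lambda>n. (S n x - S 0 x) + S 0 x)"
      by (intro convergent_add convergent_const)
    then show "convergent (\<lambda>m. S m x)" by simp
  qed
qed

text \<open>Fatou's lemma for the squared distances from a fixed \<open>T\<close>. Working with the
  distance instead of the norm yields membership and the rate of convergence from one
  inequality.\<close>

lemma sq_Fatou:
  assumes S: "\<And>m. sq_integrable M (S m)" and Z: "Z \<in> borel_measurable M" and T: "sq_integrable M T"
    and lim: "AE x in M. (\<lambda>m. S m x) \<longlonglongrightarrow> Z x"
    and le: "eventually (\<lambda>m. (\<integral>x. (S m x - T x)\<^sup>2 \<partial>M) \<le> C) sequentially"
  shows "sq_integrable M Z" and "(\<integral>x. (Z x - T x)\<^sup>2 \<partial>M) \<le> C"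
proof -
  have [measurable]: "S m \<in> borel_measurable M" "T \<in> borel_measurable M" "Z \<in> borel_measurable M" for m
    using S T Z by (auto simp: sq_integrable_def)
  have "(\<integral>\<^sup>+x. ennreal ((Z x - T x)\<^sup>2) \<partial>M) = (\<integral>\<^sup>+x. liminf (\<lambda>m. ennreal ((S m x - T x)\<^sup>2)) \<partial>M)"
  proof (rule nn_integral_cong_AE)
    show "AE x in M. ennreal ((Z x - T x)\<^sup>2) = liminf (\<lambda>m. ennreal ((S m x - T x)\<^sup>2))"
      using lim
    proof eventually_elim
      fix x assume "(\<lambda>m. S m x) \<longlonglongrightarrow> Z x"
      then have "(\<lambda>m. ennreal ((S m x - T x)\<^sup>2)) \<longlonglongrightarrow> ennreal ((Z x - T x)\<^sup>2)"
        by (intro tendsto_ennrealI tendsto_intros)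
      then show "ennreal ((Z x - T x)\<^sup>2) = liminf (\<lambda>m. ennreal ((S m x - T x)\<^sup>2))"
        by (metis lim_imp_Liminf sequentially_bot)
    qed
  qed
  also have "\<dots> \<le> liminf (\<lambda>m. \<integral>\<^sup>+x. ennreal ((S m x - T x)\<^sup>2) \<partial>M)"
    by (intro nn_integral_liminf) auto
  also have "\<dots> \<le> ennreal C"
  proof -
    have "eventually (\<lambda>m. (\<integral>\<^sup>+x. ennreal ((S m x - T x)\<^sup>2) \<partial>M) \<le> ennreal C) sequentially"
      using le
    proof eventually_elim
      case (elim m)
      then show ?case
        using sq_integrable_square[OF sq_integrable_diff[OF S T]]
        by (subst nn_integral_eq_integral) (auto intro: ennreal_leI)
    qed
    then show ?thesis
      by (intro Liminf_le) auto
  qed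
  finally have nn: "(\<integral>\<^sup>+x. ennreal ((Z x - T x)\<^sup>2) \<partial>M) \<le> ennreal C" .
  have int: "integrable M (\<lambda>x. (Z x - T x)\<^sup>2)"
    using nn by (intro integrableI_bounded) (auto intro: le_less_trans)
  then have "sq_integrable M (\<lambda>x. Z x - T x)" by (simp add: sq_integrable_def)
  from sq_integrable_add[OF this T] show "sq_integrable M Z" by simp
  \<comment> \<open>Nonnegativity of C is read off a single index; for negative C the value
    \<open>ennreal C\<close> would be 0 and the bound could not be brought back to the
    reals.\<close>
  from le obtain m where "(\<integral>x. (S m x - T x)\<^sup>2 \<partial>M) \<le> C"
    by (auto simp: eventually_sequentially)
  then have "0 \<le> C" by (rule order_trans[rotated]) simp
  then show "(\<integral>x. (Z x - T x)\<^sup>2 \<partial>M) \<le> C"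
    using nn int by (subst (asm) nn_integral_eq_integral) auto
qed

text \<open>The limit is the explicit pointwise \<open>lim\<close> along \<open>r\<close>, which
  keeps it a measurable function of the members of the sequence. The index condition compares
  \<open>r m\<close> with every later k, so the whole sequence converges and not only the
  subsequence.\<close>

lemma (in prob_space) sq_complete_subseq:
  assumes S: "\<And>k. sq_integrable M (S k)" and r: "strict_mono r"
    and Cau: "\<And>m k. k \<ge> r m \<Longrightarrow> (\<integral>x. (S k x - S (r m) x)\<^sup>2 \<partial>M) \<le> (1/4)^m"
  defines "Z \<equiv> \<lambda>x. lim (\<lambda>m. S (r m) x)"
  shows "sq_integrable M Z" and "(\<lambda>k. \<integral>x. (Z x - S k x)\<^sup>2 \<partial>M) \<longlonglongrightarrow> 0"
proof -
  have [measurable]: "S k \<in> borel_measurable M" for k using S by (simp add: sq_integrable_def)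
  have Zm: "Z \<in> borel_measurable M" unfolding Z_def by measurable
  have "AE x in M. convergent (\<lambda>m. S (r m) x)"
    using r by (intro sq_fast_Cauchy_AE_convergent[of "\<lambda>m. S (r m)"] S Cau) (simp add: strict_mono_less_eq)
  then have lim: "AE x in M. (\<lambda>m. S (r m) x) \<longlonglongrightarrow> Z x"
    by eventually_elim (simp add: Z_def convergent_LIMSEQ_iff)
  \<comment> \<open>Both k and r m lie beyond r p, so both squared distances from S (r p) are at
    most (1/4)^p, and the triangle inequality doubles each.\<close>
  have ev: "eventually (\<lambda>m. (\<integral>x. (S (r m) x - S k x)\<^sup>2 \<partial>M) \<le> 4 * (1/4)^p) sequentially" if "k \<ge> r p" for k p
  proof (rule eventually_sequentiallyI)
    fix m assume "p \<le> m"
    then have "r p \<le> r m" using r by (simp add: strict_mono_less_eq)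
    have "(\<integral>x. (S (r m) x - S k x)\<^sup>2 \<partial>M) \<le> 2 * (\<integral>x. (S (r m) x - S (r p) x)\<^sup>2 \<partial>M) + 2 * (\<integral>x. (S (r p) x - S k x)\<^sup>2 \<partial>M)"
      by (intro sq_dist_triangle S)
    also have "(\<integral>x. (S (r p) x - S k x)\<^sup>2 \<partial>M) = (\<integral>x. (S k x - S (r p) x)\<^sup>2 \<partial>M)"
      by (simp add: power2_commute)
    finally show "(\<integral>x. (S (r m) x - S k x)\<^sup>2 \<partial>M) \<le> 4 * (1/4)^p"
      using Cau[OF that] Cau[OF \<open>r p \<le> r m\<close>] by linarith
  qed
  show "sq_integrable M Z"
    by (rule sq_Fatou(1)[OF S Zm S lim ev[OF order_refl]])
  show "(\<lambda>k. \<integral>x. (Z x - S k x)\<^sup>2 \<partial>M) \<longlonglongrightarrow> 0"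
  proof (rule LIMSEQ_I)
    fix e :: real assume "0 < e"
    then obtain p where p: "(1/4::real)^p < e / 4" using real_arch_pow_inv[of "e/4" "1/4"] by auto
    have "norm ((\<integral>x. (Z x - S k x)\<^sup>2 \<partial>M) - 0) < e" if "k \<ge> r p" for k
    proof -
      have "(\<integral>x. (Z x - S k x)\<^sup>2 \<partial>M) \<le> 4 * (1/4)^p" by (rule sq_Fatou(2)[OF S Zm S lim ev[OF that]])
      then show ?thesis using p by simp
    qed
    then show "\<exists>no. \<forall>k\<ge>no. norm ((\<integral>x. (Z x - S k x)\<^sup>2 \<partial>M) - 0) < e" by blast
  qed
qed

text \<open>The sum of the thresholds up to m dominates the m-th one, and adding m makes the index
  strictly increasing.\<close>

lemma fast_Cauchy_index:
  fixes D :: "nat \<Rightarrow> nat \<Rightarrow> real"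
  assumes "\<And>e. e > 0 \<Longrightarrow> \<exists>N. \<forall>l\<ge>N. \<forall>k\<ge>N. D k l \<le> e"
  obtains r where "strict_mono r" "\<And>m k. k \<ge> r m \<Longrightarrow> D k (r m) \<le> (1/4)^m"
proof -
  have "\<forall>m. \<exists>N. \<forall>l\<ge>N. \<forall>k\<ge>N. D k l \<le> (1/4)^m" using assms by simp
  then obtain N where N: "\<And>m l k. l \<ge> N m \<Longrightarrow> k \<ge> N m \<Longrightarrow> D k l \<le> (1/4)^m" by metis
  define r where "r m = (\<Sum>i\<le>m. N i) + m" for m
  have "N m \<le> r m" for m unfolding r_def by (intro trans_le_add1 member_le_sum) auto
  moreover have "strict_mono r" by (intro strict_mono_Suc_iff[THEN iffD2]) (simp add: r_def)
  ultimately show ?thesis using N that by (meson order_trans)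
qed

text \<open>Serves to identify a limit obtained by \<open>SOME\<close> with one that is constructed:
  both are L2 limits of the same sequence.\<close>

lemma sq_limit_unique:
  assumes S: "\<And>k. sq_integrable M (S k)" and "sq_integrable M Z" "sq_integrable M Z'"
    and "(\<lambda>k. \<integral>x. (Z x - S k x)\<^sup>2 \<partial>M) \<longlonglongrightarrow> 0" "(\<lambda>k. \<integral>x. (Z' x - S k x)\<^sup>2 \<partial>M) \<longlonglongrightarrow> 0"
  shows "AE x in M. Z x = Z' x"
proof -
  have "(\<lambda>k. 2 * (\<integral>x. (Z x - S k x)\<^sup>2 \<partial>M) + 2 * (\<integral>x. (Z' x - S k x)\<^sup>2 \<partial>M)) \<longlonglongrightarrow> 2 * 0 + 2 * 0"
    by (intro tendsto_intros assms)
  then have "(\<integral>x. (Z x - Z' x)\<^sup>2 \<partial>M) \<le> 2 * 0 + 2 * 0"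
  proof (rule LIMSEQ_le_const, intro exI allI impI)
    fix k
    show "(\<integral>x. (Z x - Z' x)\<^sup>2 \<partial>M) \<le> 2 * (\<integral>x. (Z x - S k x)\<^sup>2 \<partial>M) + 2 * (\<integral>x. (Z' x - S k x)\<^sup>2 \<partial>M)"
      using sq_dist_triangle[of M Z "S k" Z'] assms by (simp add: power2_commute)
  qed
  then have "(\<integral>x. (Z x - Z' x)\<^sup>2 \<partial>M) = 0" by (simp add: order.eq_iff)
  then have "AE x in M. (Z x - Z' x)\<^sup>2 = 0"
    using assms by (subst (asm) integral_nonneg_eq_0_iff_AE) (auto intro!: sq_integrable_square sq_integrable_diff)
  then show ?thesis by eventually_elim simp
qed

section \<open>Dyadic projections on the unit interval\<close>

text \<open>The measure lives on the whole line with the Borel sets, so functions on the reals can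
  be used as they are, and its total mass 1 makes the probability-space lemmas available.\<close>

definition unit_leb :: "real measure" where
  "unit_leb = density lborel (\<lambda>x. ennreal (indicat_real {0..1} x))"

lemma sets_unit_leb [measurable_cong, simp]: "sets unit_leb = sets borel"
  by (simp add: unit_leb_def)

lemma space_unit_leb [simp]: "space unit_leb = UNIV"
  by (simp add: unit_leb_def)

interpretation unit_leb: prob_space unit_leb
proof
  have "emeasure unit_leb (space unit_leb) = (\<integral>\<^sup>+x. ennreal (indicat_real {0..1::real} x) \<partial>lborel)"
    by (simp add: unit_leb_def emeasure_density)
  also have "\<dots> = emeasure lborel {0..1::real}"
    by (subst nn_integral_indicator[symmetric]) (auto simp: ennreal_indicator)
  finally show "emeasure unit_leb (space unit_leb) = 1" by simp
qed

lemma measurable_unit_leb: "borel_measurable unit_leb = borel_measurable borel"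
  by (rule measurable_cong_sets) auto

lemma integral_unit_leb:
  "f \<in> borel_measurable borel \<Longrightarrow> (\<integral>x. f x \<partial>unit_leb) = (LINT t:{0..1}|lborel. f t)" for f :: "real \<Rightarrow> real"
  unfolding unit_leb_def set_lebesgue_integral_def by (subst integral_density) auto

lemma integrable_unit_leb:
  "f \<in> borel_measurable borel \<Longrightarrow> integrable unit_leb f \<longleftrightarrow> set_integrable lborel {0..1} f" for f :: "real \<Rightarrow> real"
  unfolding unit_leb_def set_integrable_def by (subst integrable_density) auto

lemma L2_01_iff: "h \<in> L2_01 \<longleftrightarrow> sq_integrable unit_leb h"
  by (auto simp: L2_01_def sq_integrable_def measurable_unit_leb integrable_unit_leb)

lemma l2_inner_eq:
  "sq_integrable unit_leb f \<Longrightarrow> sq_integrable unit_leb g \<Longrightarrow> l2_inner f g = (\<integral>x. f x * g x \<partial>unit_leb)"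
  unfolding l2_inner_def by (subst integral_unit_leb) (auto simp: sq_integrable_def measurable_unit_leb)

lemma AE_unit_leb: "(AE x in lborel. P x) \<Longrightarrow> (AE x in unit_leb. P x)"
  unfolding unit_leb_def by (subst AE_density) (auto elim: eventually_mono)

lemma AE_unit_leb_mem: "AE x in unit_leb. 0 \<le> x \<and> x < 1"
proof -
  have "AE x in lborel. x \<noteq> (1::real)" by (rule AE_lborel_singleton)
  then have "AE x in lborel. 0 < ennreal (indicat_real {0..1} x) \<longrightarrow> 0 \<le> x \<and> x < (1::real)"
    by eventually_elim (auto simp: indicator_def split: if_splits)
  then show ?thesis unfolding unit_leb_def by (subst AE_density) auto
qed

text \<open>The half-open form makes neighbouring cells disjoint; it differs from the closed one by
  a null point.\<close>

lemma set_integral_Icc_unit_leb: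
  fixes h :: "real \<Rightarrow> real"
  assumes h: "h \<in> borel_measurable borel" and ab: "0 \<le> a" "b \<le> 1"
  shows "(LINT u:{a..b}|lborel. h u) = (\<integral>x. h x * indicat_real {a..<b} x \<partial>unit_leb)"
proof -
  have "(\<integral>x. h x * indicat_real {a..<b} x \<partial>unit_leb) = (LINT t:{0..1}|lborel. h t * indicat_real {a..<b} t)"
    using h by (intro integral_unit_leb) auto
  also have "\<dots> = (LINT u:{a..b}|lborel. h u)"
    unfolding set_lebesgue_integral_def
  proof (rule integral_cong_AE)
    have "AE x in lborel. x \<noteq> b" by (rule AE_lborel_singleton)
    then show "AE x in lborel. indicat_real {0..1} x *\<^sub>R (h x * indicat_real {a..<b} x) = indicat_real {a..b} x *\<^sub>R h x"
      by eventually_elim (use ab in \<open>auto simp: indicator_def\<close>)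
  qed (use h in auto)
  finally show ?thesis ..
qed

lemma sq_integrable_indicator: "sq_integrable unit_leb (indicat_real {a..<b::real})"
  by (rule unit_leb.sq_integrable_bounded[where K=1]) (auto simp: indicator_def)

text \<open>The same overlap length is the covariance of two Brownian increments
  (\<open>increment_cov\<close>); this coincidence is the source of the isometry.\<close>

lemma integral_indicator_overlap:
  assumes "0 \<le> a" "a \<le> b" "b \<le> 1" "0 \<le> c" "c \<le> d" "d \<le> 1"
  shows "(\<integral>x. indicat_real {a..<b} x * indicat_real {c..<d} x \<partial>unit_leb) = max 0 (min b d - max a c)"
proof -
  have "(\<integral>x. indicat_real {a..<b} x * indicat_real {c..<d} x \<partial>unit_leb) = (\<integral>x. indicat_real {max a c..<min b d} x \<partial>lborel)"
  proof (subst integral_unit_leb)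
    show "(LINT t:{0..1}|lborel. indicat_real {a..<b} t * indicat_real {c..<d} t) = (\<integral>x. indicat_real {max a c..<min b d} x \<partial>lborel)"
      unfolding set_lebesgue_integral_def using assms by (intro Bochner_Integration.integral_cong) (auto simp: indicator_def)
  qed auto
  also have "\<dots> = measure lborel {max a c..<min b d}" by simp
  also have "\<dots> = max 0 (min b d - max a c)"
  proof (cases "max a c \<le> min b d")
    case True then show ?thesis by (subst measure_lborel_Ico) auto
  next
    case False
    then have "{max a c..<min b d} = {}" by auto
    then have "measure lborel {max a c..<min b d} = 0" by (metis measure_empty)
    then show ?thesis using False by linarith
  qed
  finally show ?thesis .
qed

section \<open>Drifts and their increments\<close>

lemma drift_eq:
  assumes "h \<in> borel_measurable borel" "0 \<le> t" "t \<le> 1"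
  shows "drift h t = (\<integral>x. h x * indicat_real {0..<t} x \<partial>unit_leb)"
  unfolding drift_def using assms by (intro set_integral_Icc_unit_leb) auto

lemma drift_diff:
  assumes h: "sq_integrable unit_leb h" and "0 \<le> a" "a \<le> b" "b \<le> 1"
  shows "drift h b - drift h a = (\<integral>x. h x * indicat_real {a..<b} x \<partial>unit_leb)"
proof -
  have "drift h b - drift h a = (\<integral>x. h x * indicat_real {0..<b} x - h x * indicat_real {0..<a} x \<partial>unit_leb)"
    using assms sq_integrable_mult[OF h sq_integrable_indicator]
    by (simp add: drift_eq sq_integrable_def measurable_unit_leb)
  also have "(\<lambda>x. h x * indicat_real {0..<b} x - h x * indicat_real {0..<a} x) = (\<lambda>x. h x * indicat_real {a..<b} x)"
    using assms by (auto simp: indicator_def fun_eq_iff)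
  finally show ?thesis .
qed

lemma drift_minus:
  assumes f: "sq_integrable unit_leb f" and g: "sq_integrable unit_leb g" and "0 \<le> t" "t \<le> 1"
  shows "drift (\<lambda>x. f x - g x) t = drift f t - drift g t"
proof -
  have "drift (\<lambda>x. f x - g x) t = (\<integral>x. f x * indicat_real {0..<t} x - g x * indicat_real {0..<t} x \<partial>unit_leb)"
    using assms by (subst drift_eq) (auto simp: sq_integrable_def measurable_unit_leb left_diff_distrib)
  also have "\<dots> = drift f t - drift g t"
    using assms sq_integrable_mult[OF f sq_integrable_indicator] sq_integrable_mult[OF g sq_integrable_indicator]
    by (simp add: drift_eq sq_integrable_def measurable_unit_leb)
  finally show ?thesis .
qed

lemma sq_interval_orthogonal:
  fixes t :: "nat \<Rightarrow> real"
  assumes t0: "0 \<le> t 0" and t1: "t K \<le> 1" and mono: "\<And>i. i < K \<Longrightarrow> t i < t (Suc i)" and ij: "i < K" "j < K"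
  shows "(\<integral>x. indicat_real {t i..<t (Suc i)} x * indicat_real {t j..<t (Suc j)} x \<partial>unit_leb) = (if i = j then t (Suc i) - t i else 0)"
proof -
  have le: "t a \<le> t b" if "a \<le> b" "b \<le> K" for a b
    using that by (induction b rule: dec_induct) (auto dest!: mono intro: order_trans less_imp_le simp: Suc_le_eq)
  have r: "0 \<le> t a \<and> t a \<le> 1" if "a \<le> K" for a using le[of 0 a] le[of a K] t0 t1 that by auto
  have "(\<integral>x. indicat_real {t i..<t (Suc i)} x * indicat_real {t j..<t (Suc j)} x \<partial>unit_leb) = max 0 (min (t (Suc i)) (t (Suc j)) - max (t i) (t j))"
    using ij mono[of i] mono[of j] r by (intro integral_indicator_overlap) auto
  also have "\<dots> = (if i = j then t (Suc i) - t i else 0)"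
  proof (cases i j rule: linorder_cases)
    case less
    then have "t (Suc i) \<le> t j" using ij by (intro le) auto
    then show ?thesis using less by auto
  next
    case equal then show ?thesis using mono[OF ij(1)] by auto
  next
    case greater
    then have "t (Suc j) \<le> t i" using ij by (intro le) auto
    then show ?thesis using greater by auto
  qed
  finally show ?thesis .
qed

text \<open>Drift increments are inner products of h with interval indicators, whose weights are the
  interval lengths, so this is Bessel's inequality. The left side is the squared shift of the
  increments of a drifted Brownian path, measured in their standard deviations.\<close>

lemma sq_drift_increments_le:
  fixes t :: "nat \<Rightarrow> real"
  assumes h: "sq_integrable unit_leb h"
    and t0: "0 \<le> t 0" and t1: "t K \<le> 1" and mono: "\<And>i. i < K \<Longrightarrow> t i < t (Suc i)"
  shows "(\<Sum>i<K. (drift h (t (Suc i)) - drift h (t i))\<^sup>2 / (t (Suc i) - t i)) \<le> (\<integral>x. (h x)\<^sup>2 \<partial>unit_leb)"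
proof -
  have le: "t a \<le> t b" if "a \<le> b" "b \<le> K" for a b
    using that by (induction b rule: dec_induct) (auto dest!: mono intro: order_trans less_imp_le simp: Suc_le_eq)
  have r: "0 \<le> t a \<and> t a \<le> 1" if "a \<le> K" for a using le[of 0 a] le[of a K] t0 t1 that by auto
  have "(\<Sum>i<K. (drift h (t (Suc i)) - drift h (t i))\<^sup>2 / (t (Suc i) - t i)) =
     (\<Sum>i<K. (\<integral>x. h x * indicat_real {t i..<t (Suc i)} x \<partial>unit_leb)\<^sup>2 / (t (Suc i) - t i))"
    using r by (intro sum.cong refl, subst drift_diff[OF h]) (auto intro: less_imp_le mono)
  also have "\<dots> \<le> (\<integral>x. (h x)\<^sup>2 \<partial>unit_leb)"
  proof (rule sq_Bessel[OF finite_lessThan h])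
    show "(\<integral>x. indicat_real {t i..<t (Suc i)} x * indicat_real {t j..<t (Suc j)} x \<partial>unit_leb) = (if i = j then t (Suc i) - t i else 0)"
      if "i \<in> {..<K}" "j \<in> {..<K}" for i j using that by (intro sq_interval_orthogonal[of t K] t0 t1 mono) auto
  qed (use mono sq_integrable_indicator in auto)
  finally show ?thesis .
qed

text \<open>The L2 projection of \<phi> onto the functions that are constant on the dyadic cells of
  level k; \<open>dyadic_sum \<phi> x k\<close> is the same step function integrated against the
  path x.\<close>

definition dyadic_step :: "(real \<Rightarrow> real) \<Rightarrow> nat \<Rightarrow> real \<Rightarrow> real" where
  "dyadic_step \<phi> k x = (\<Sum>m<2^k. dyadic_coef \<phi> k m * indicat_real {real m / 2^k..<real (Suc m) / 2^k} x)"

lemma sq_integrable_dyadic_step: "sq_integrable unit_leb (dyadic_step \<phi> k)"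
  unfolding dyadic_step_def by (intro sq_integrable_sum sq_integrable_cmult sq_integrable_indicator)

lemma dyadic_le_1: "m < 2^k \<Longrightarrow> real (Suc m) / 2^k \<le> 1"
  using of_nat_mono[of "Suc m" "2^k", where 'a=real] by (simp add: divide_le_eq_1 Suc_le_eq del: of_nat_Suc)

text \<open>Written as a division by the cell length because that length is the weight in
  \<open>sq_best_approximation\<close>.\<close>

lemma dyadic_coef_eq:
  assumes "sq_integrable unit_leb \<phi>" "m < 2^k"
  shows "dyadic_coef \<phi> k m = (\<integral>x. \<phi> x * indicat_real {real m / 2^k..<real (Suc m) / 2^k} x \<partial>unit_leb) / (1 / 2^k)"
  unfolding dyadic_coef_def using assms dyadic_le_1[OF assms(2)]
  by (subst set_integral_Icc_unit_leb) (auto simp: sq_integrable_def measurable_unit_leb)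

lemma dyadic_orthogonal:
  assumes "i < 2^k" "j < 2^k"
  shows "(\<integral>x. indicat_real {real i / 2^k..<real (Suc i) / 2^k} x * indicat_real {real j / 2^k..<real (Suc j) / 2^k} x \<partial>unit_leb) = (if i = j then 1 / 2^k else 0)"
  using assms by (subst sq_interval_orthogonal[of "\<lambda>m. real m / 2^k" "2^k"]) (auto simp: field_simps)

lemma dyadic_step_norm:
  "(\<integral>x. (dyadic_step \<phi> k x)\<^sup>2 \<partial>unit_leb) = (\<Sum>m<2^k. (1 / 2^k) * (dyadic_coef \<phi> k m)\<^sup>2)"
proof -
  have "(\<integral>x. (0 - (\<Sum>m<2^k. dyadic_coef \<phi> k m * indicat_real {real m / 2^k..<real (Suc m) / 2^k} x))\<^sup>2 \<partial>unit_leb) =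
    (\<integral>x. 0\<^sup>2 \<partial>unit_leb) - 2 * (\<Sum>m<2^k. dyadic_coef \<phi> k m * (\<integral>x. 0 * indicat_real {real m / 2^k..<real (Suc m) / 2^k} x \<partial>unit_leb))
      + (\<Sum>m<2^k. (1 / 2^k) * (dyadic_coef \<phi> k m)\<^sup>2)"
    by (intro sq_orthogonal_expansion sq_integrable_zero sq_integrable_indicator dyadic_orthogonal) auto
  then show ?thesis by (simp add: dyadic_step_def)
qed

text \<open>Integrating a step function against the path \<open>drift h\<close> amounts to an inner
  product with h. In the limit this produces the deterministic part of the coefficients of an
  observed path.\<close>

lemma dyadic_sum_drift:
  assumes h: "sq_integrable unit_leb h"
  shows "dyadic_sum \<phi> (drift h) k = (\<integral>x. dyadic_step \<phi> k x * h x \<partial>unit_leb)"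
proof -
  have i: "integrable unit_leb (\<lambda>x. h x * indicat_real {real m / 2^k..<real (Suc m) / 2^k} x)" for m
    by (intro sq_integrable_mult h sq_integrable_indicator)
  have "(\<integral>x. dyadic_step \<phi> k x * h x \<partial>unit_leb) =
     (\<integral>x. (\<Sum>m<2^k. dyadic_coef \<phi> k m * (h x * indicat_real {real m / 2^k..<real (Suc m) / 2^k} x)) \<partial>unit_leb)"
    unfolding dyadic_step_def sum_distrib_right
    by (intro Bochner_Integration.integral_cong refl sum.cong) (simp add: ac_simps)
  also have "\<dots> = (\<Sum>m<2^k. dyadic_coef \<phi> k m * (\<integral>x. h x * indicat_real {real m / 2^k..<real (Suc m) / 2^k} x \<partial>unit_leb))"
    using i by simp
  also have "\<dots> = dyadic_sum \<phi> (drift h) k"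
    unfolding dyadic_sum_def
  proof (intro sum.cong refl)
    fix m assume "m \<in> {..<(2::nat)^k}"
    then show "dyadic_coef \<phi> k m * (\<integral>x. h x * indicat_real {real m / 2^k..<real (Suc m) / 2^k} x \<partial>unit_leb) =
      dyadic_coef \<phi> k m * (drift h (real (Suc m) / 2^k) - drift h (real m / 2^k))"
      using dyadic_le_1[of m k] by (subst drift_diff[OF h]) (auto simp: divide_right_mono)
  qed
  finally show ?thesis ..
qed

section \<open>Density of the dyadic step functions\<close>

lemma sq_dominated_convergence:
  assumes F: "\<And>n. F n \<in> borel_measurable M" and f: "f \<in> borel_measurable M" and b: "sq_integrable M b"
    and lim: "AE x in M. (\<lambda>n. F n x) \<longlonglongrightarrow> f x" and bd: "\<And>n. AE x in M. \<bar>F n x - f x\<bar> \<le> b x"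
  shows "(\<lambda>n. \<integral>x. (F n x - f x)\<^sup>2 \<partial>M) \<longlonglongrightarrow> 0"
proof -
  have "(\<lambda>n. \<integral>x. (F n x - f x)\<^sup>2 \<partial>M) \<longlonglongrightarrow> (\<integral>x. 0 \<partial>M)"
  proof (rule integral_dominated_convergence[where w="\<lambda>x. (b x)\<^sup>2"])
    show "integrable M (\<lambda>x. (b x)\<^sup>2)" using b by (simp add: sq_integrable_def)
    show "AE x in M. (\<lambda>n. (F n x - f x)\<^sup>2) \<longlonglongrightarrow> 0"
      using lim
    proof eventually_elim
      fix x assume "(\<lambda>n. F n x) \<longlonglongrightarrow> f x"
      then have "(\<lambda>n. (F n x - f x)\<^sup>2) \<longlonglongrightarrow> (f x - f x)\<^sup>2" by (intro tendsto_intros)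
      then show "(\<lambda>n. (F n x - f x)\<^sup>2) \<longlonglongrightarrow> 0" by simp
    qed
    show "AE x in M. norm ((F n x - f x)\<^sup>2) \<le> (b x)\<^sup>2" for n
      using bd[of n] by eventually_elim (auto simp: abs_le_square_iff[symmetric])
  qed (use F f in auto)
  then show ?thesis by simp
qed

definition clamp_real :: "real \<Rightarrow> real \<Rightarrow> real" where
  "clamp_real K y = max (- K) (min K y)"

text \<open>There are two truncations at one level n: of \<phi> itself, and of the continuous
  functions that converge to \<phi> almost everywhere. Clamping is continuous and keeps the errors
  below 2 n, so dominated convergence applies although the approximants come without a common
  bound.\<close>

lemma sq_continuous_approx:
  assumes phi: "sq_integrable unit_leb \<phi>" and e: "e > 0"
  obtains g :: "real \<Rightarrow> real" and K where "continuous_on UNIV g" "\<And>x. \<bar>g x\<bar> \<le> K"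
    "(\<integral>x. (\<phi> x - g x)\<^sup>2 \<partial>unit_leb) < e"
proof -
  have [measurable]: "\<phi> \<in> borel_measurable borel" using phi by (simp add: sq_integrable_def measurable_unit_leb)
  have [measurable]: "clamp_real K \<in> borel_measurable borel" for K unfolding clamp_real_def by measurable
  have "(\<lambda>n. \<integral>x. (clamp_real (real n) (\<phi> x) - \<phi> x)\<^sup>2 \<partial>unit_leb) \<longlonglongrightarrow> 0"
  proof (rule sq_dominated_convergence[where b="\<lambda>x. \<bar>\<phi> x\<bar>"])
    show "sq_integrable unit_leb (\<lambda>x. \<bar>\<phi> x\<bar>)" using phi by (auto simp: sq_integrable_def)
    show "AE x in unit_leb. (\<lambda>n. clamp_real (real n) (\<phi> x)) \<longlonglongrightarrow> \<phi> x"
    proof (intro AE_I2 tendsto_eventually)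
      fix x
      obtain N :: nat where N: "\<bar>\<phi> x\<bar> \<le> real N" using real_arch_simple by blast
      show "\<forall>\<^sub>F n in sequentially. clamp_real (real n) (\<phi> x) = \<phi> x"
      proof (rule eventually_sequentiallyI)
        fix n assume "N \<le> n"
        then have "\<bar>\<phi> x\<bar> \<le> real n" using N by simp
        then show "clamp_real (real n) (\<phi> x) = \<phi> x" by (simp add: clamp_real_def)
      qed
    qed
    show "AE x in unit_leb. \<bar>clamp_real (real n) (\<phi> x) - \<phi> x\<bar> \<le> \<bar>\<phi> x\<bar>" for n
      by (rule AE_I2) (auto simp: clamp_real_def)
  qed (auto simp: measurable_unit_leb)
  then have "\<forall>\<^sub>F n in sequentially. (\<integral>x. (clamp_real (real n) (\<phi> x) - \<phi> x)\<^sup>2 \<partial>unit_leb) < e / 4"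
    using e by (auto dest: order_tendstoD(2)[where a="e/4"])
  then obtain n where n: "(\<integral>x. (clamp_real (real n) (\<phi> x) - \<phi> x)\<^sup>2 \<partial>unit_leb) < e / 4"
    by (auto simp: eventually_sequentially)
  have "\<phi> measurable_on UNIV" by (intro lebesgue_measurable_imp_measurable_on measurable_completion) auto
  then obtain N G where N: "negligible N" and G: "\<And>n. continuous_on UNIV (G n)" and
    lim: "\<And>x. x \<notin> N \<Longrightarrow> (\<lambda>n. G n x) \<longlonglongrightarrow> \<phi> x"
    unfolding measurable_on_def by auto
  have "AE x in lebesgue. x \<notin> N" using N by (simp add: negligible_iff_null_sets AE_not_in)
  then have aeN: "AE x in unit_leb. x \<notin> N" by (intro AE_unit_leb) (simp add: AE_completion_iff)
  have cc: "continuous_on UNIV (\<lambda>x. clamp_real (real n) (G m x))" for m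
    unfolding clamp_real_def by (intro continuous_intros G)
  have [measurable]: "(\<lambda>x. clamp_real (real n) (G m x)) \<in> borel_measurable borel" for m
    by (intro borel_measurable_continuous_onI cc)
  have "(\<lambda>m. \<integral>x. (clamp_real (real n) (G m x) - clamp_real (real n) (\<phi> x))\<^sup>2 \<partial>unit_leb) \<longlonglongrightarrow> 0"
  proof (rule sq_dominated_convergence[where b="\<lambda>x. 2 * real n"])
    show "AE x in unit_leb. (\<lambda>m. clamp_real (real n) (G m x)) \<longlonglongrightarrow> clamp_real (real n) (\<phi> x)"
      using aeN unfolding clamp_real_def by eventually_elim (intro tendsto_intros lim)
    show "AE x in unit_leb. \<bar>clamp_real (real n) (G m x) - clamp_real (real n) (\<phi> x)\<bar> \<le> 2 * real n" for m
      by (rule AE_I2) (auto simp: clamp_real_def)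
    show "sq_integrable unit_leb (\<lambda>x. 2 * real n)" by (rule unit_leb.sq_integrable_bounded) auto
  qed (auto simp: measurable_unit_leb)
  then have "\<forall>\<^sub>F m in sequentially. (\<integral>x. (clamp_real (real n) (G m x) - clamp_real (real n) (\<phi> x))\<^sup>2 \<partial>unit_leb) < e / 4"
    using e by (auto dest: order_tendstoD(2)[where a="e/4"])
  then obtain m where m: "(\<integral>x. (clamp_real (real n) (G m x) - clamp_real (real n) (\<phi> x))\<^sup>2 \<partial>unit_leb) < e / 4"
    by (auto simp: eventually_sequentially)
  have bd: "\<bar>clamp_real (real n) y\<bar> \<le> real n" for y by (auto simp: clamp_real_def)
  have s1: "sq_integrable unit_leb (\<lambda>x. clamp_real (real n) (\<phi> x))" "sq_integrable unit_leb (\<lambda>x. clamp_real (real n) (G m x))"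
    by (rule unit_leb.sq_integrable_bounded[OF _ bd], simp add: measurable_unit_leb)+
  show ?thesis
  proof (rule that[OF cc bd])
    have "(\<integral>x. (\<phi> x - clamp_real (real n) (G m x))\<^sup>2 \<partial>unit_leb) \<le> 2 * (\<integral>x. (\<phi> x - clamp_real (real n) (\<phi> x))\<^sup>2 \<partial>unit_leb)
      + 2 * (\<integral>x. (clamp_real (real n) (\<phi> x) - clamp_real (real n) (G m x))\<^sup>2 \<partial>unit_leb)"
      by (intro sq_dist_triangle s1 phi)
    also have "\<dots> < e" using n m by (simp add: power2_commute)
    finally show "(\<integral>x. (\<phi> x - clamp_real (real n) (G m x))\<^sup>2 \<partial>unit_leb) < e" .
  qed
qed

lemma dyadic_floor_sum:
  fixes x :: real
  assumes "0 \<le> x" "x < 1"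
  shows "(\<Sum>m<2^k. a m * indicat_real {real m / 2^k..<real (Suc m) / 2^k} x) = a (nat \<lfloor>2^k * x\<rfloor>)"
proof -
  have "indicat_real {real m / 2^k..<real (Suc m) / 2^k} x = (if m = nat \<lfloor>2^k * x\<rfloor> then 1 else (0::real))" for m
  proof -
    have "x \<in> {real m / 2^k..<real (Suc m) / 2^k} \<longleftrightarrow> real m \<le> 2^k * x \<and> 2^k * x < real m + 1"
      by (auto simp: field_simps)
    also have "\<dots> \<longleftrightarrow> \<lfloor>2^k * x\<rfloor> = int m" by (subst floor_eq_iff) auto
    also have "\<dots> \<longleftrightarrow> m = nat \<lfloor>2^k * x\<rfloor>" using assms by auto
    finally show ?thesis by (simp add: indicator_def)
  qed
  moreover have "nat \<lfloor>2^k * x\<rfloor> < 2^k"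
  proof -
    have "\<lfloor>2^k * x\<rfloor> < 2^k" using assms by (simp add: floor_less_iff)
    then show ?thesis by (simp add: nat_less_iff assms)
  qed
  ultimately show ?thesis by (simp add: if_distrib[of "\<lambda>y. _ * y"] cong: if_cong del: of_nat_Suc)
qed

text \<open>The projection is at least as close as any other dyadic step function, in particular one
  that samples a nearby continuous function; for the latter, convergence follows from
  continuity.\<close>

lemma dyadic_step_tendsto:
  assumes phi: "sq_integrable unit_leb \<phi>"
  shows "(\<lambda>k. \<integral>x. (dyadic_step \<phi> k x - \<phi> x)\<^sup>2 \<partial>unit_leb) \<longlonglongrightarrow> 0"
proof (rule LIMSEQ_I)
  fix e :: real assume "0 < e"
  then obtain g K where g: "continuous_on UNIV g" and K: "\<And>x. \<bar>g x\<bar> \<le> K"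
    and ge: "(\<integral>x. (\<phi> x - g x)\<^sup>2 \<partial>unit_leb) < e / 4"
    using sq_continuous_approx[OF phi, of "e/4"] by auto
  have [measurable]: "g \<in> borel_measurable borel" using g by (rule borel_measurable_continuous_onI)
  \<comment> \<open>The competitor samples g at left endpoints, which is the value selected by
    rounding x down to the grid.\<close>
  define q where "q k x = (\<Sum>m<2^k. g (real m / 2^k) * indicat_real {real m / 2^k..<real (Suc m) / 2^k} x)" for k :: nat and x
  have qs: "sq_integrable unit_leb (q k)" for k
    unfolding q_def by (intro sq_integrable_sum sq_integrable_cmult sq_integrable_indicator)
  have gs: "sq_integrable unit_leb g" by (rule unit_leb.sq_integrable_bounded[OF _ K]) (simp add: measurable_unit_leb)
  have qe: "q k x = g (of_int \<lfloor>2^k * x\<rfloor> / 2^k)" if "0 \<le> x" "x < 1" for k x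
    unfolding q_def using dyadic_floor_sum[OF that, of "\<lambda>m. g (real m / 2^k)" k] that by simp
  have "(\<lambda>k. \<integral>x. (q k x - g x)\<^sup>2 \<partial>unit_leb) \<longlonglongrightarrow> 0"
  proof (rule sq_dominated_convergence[where b="\<lambda>x. 2 * K"])
    show "AE x in unit_leb. (\<lambda>k. q k x) \<longlonglongrightarrow> g x"
      using AE_unit_leb_mem
    proof eventually_elim
      fix x :: real assume x: "0 \<le> x \<and> x < 1"
      have "(\<lambda>k. of_int \<lfloor>2^k * x\<rfloor> / 2^k - x) \<longlonglongrightarrow> 0"
      proof (rule Lim_null_comparison)
        show "(\<lambda>k. (1/2)^k :: real) \<longlonglongrightarrow> 0" by (intro LIMSEQ_power_zero) simp
        show "\<forall>\<^sub>F k in sequentially. norm (of_int \<lfloor>2^k * x\<rfloor> / 2^k - x) \<le> (1/2)^k"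
        proof (intro always_eventually allI)
          fix k :: nat
          have "of_int \<lfloor>2^k * x\<rfloor> / 2^k - x = (of_int \<lfloor>2^k * x\<rfloor> - 2^k * x) / 2^k" by (simp add: field_simps)
          moreover have "\<bar>of_int \<lfloor>2^k * x\<rfloor> - 2^k * x\<bar> \<le> 1" by linarith
          ultimately show "norm (of_int \<lfloor>2^k * x\<rfloor> / 2^k - x) \<le> (1/2)^k"
            by (simp add: abs_divide power_one_over divide_right_mono)
        qed
      qed
      then have "(\<lambda>k. of_int \<lfloor>2^k * x\<rfloor> / 2^k) \<longlonglongrightarrow> x" by (rule LIM_zero_cancel)
      then have "(\<lambda>k. g (of_int \<lfloor>2^k * x\<rfloor> / 2^k)) \<longlonglongrightarrow> g x"
        using g by (intro isCont_tendsto_compose[of x g]) (auto simp: continuous_on_eq_continuous_at)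
      then show "(\<lambda>k. q k x) \<longlonglongrightarrow> g x" using x by (simp add: qe)
    qed
    show "AE x in unit_leb. \<bar>q k x - g x\<bar> \<le> 2 * K" for k
      using AE_unit_leb_mem
    proof eventually_elim
      fix x :: real assume "0 \<le> x \<and> x < 1"
      then show "\<bar>q k x - g x\<bar> \<le> 2 * K"
        using K[of x] K[of "of_int \<lfloor>2^k * x\<rfloor> / 2^k"] by (simp add: qe)
    qed
    show "sq_integrable unit_leb (\<lambda>x. 2 * K)" by (rule unit_leb.sq_integrable_bounded) auto
  qed (use qs gs in \<open>auto simp: sq_integrable_def\<close>)
  then have "\<forall>\<^sub>F k in sequentially. (\<integral>x. (q k x - g x)\<^sup>2 \<partial>unit_leb) < e / 4"
    using \<open>0 < e\<close> by (auto dest: order_tendstoD(2)[where a="e/4"])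
  then obtain N where N: "\<And>k. k \<ge> N \<Longrightarrow> (\<integral>x. (q k x - g x)\<^sup>2 \<partial>unit_leb) < e / 4"
    by (auto simp: eventually_sequentially)
  have "norm ((\<integral>x. (dyadic_step \<phi> k x - \<phi> x)\<^sup>2 \<partial>unit_leb) - 0) < e" if "k \<ge> N" for k
  proof -
    have "dyadic_step \<phi> k x = (\<Sum>m<2^k. ((\<integral>x. \<phi> x * indicat_real {real m / 2^k..<real (Suc m) / 2^k} x \<partial>unit_leb) / (1 / 2^k))
         * indicat_real {real m / 2^k..<real (Suc m) / 2^k} x)" for x
      unfolding dyadic_step_def by (intro sum.cong refl arg_cong2[where f="(*)"] dyadic_coef_eq[OF phi]) auto
    then have "(\<integral>x. (\<phi> x - dyadic_step \<phi> k x)\<^sup>2 \<partial>unit_leb) \<le> (\<integral>x. (\<phi> x - q k x)\<^sup>2 \<partial>unit_leb)"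
      unfolding q_def
      using sq_best_approximation[OF finite_lessThan phi, of "2^k" "\<lambda>m. indicat_real {real m / 2^k..<real (Suc m) / 2^k}" "\<lambda>_. 1/2^k" "\<lambda>m. g (real m / 2^k)"]
      by (simp add: sq_integrable_indicator dyadic_orthogonal del: of_nat_Suc)
    also have "\<dots> \<le> 2 * (\<integral>x. (\<phi> x - g x)\<^sup>2 \<partial>unit_leb) + 2 * (\<integral>x. (g x - q k x)\<^sup>2 \<partial>unit_leb)"
      by (intro sq_dist_triangle phi gs qs)
    also have "\<dots> < e" using ge N[OF that] by (simp add: power2_commute)
    finally show ?thesis by (simp add: power2_commute)
  qed
  then show "\<exists>N. \<forall>k\<ge>N. norm ((\<integral>x. (dyadic_step \<phi> k x - \<phi> x)\<^sup>2 \<partial>unit_leb) - 0) < e" by blast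
qed

section \<open>Wiener integrals\<close>

context prob_space
begin

lemma normal_moments:
  assumes X: "distributed M lborel X (normal_density 0 \<sigma>)" and s: "\<sigma> > 0"
  shows "sq_integrable M X" "expectation X = 0" "expectation (\<lambda>x. (X x)\<^sup>2) = \<sigma>\<^sup>2"
proof -
  have [measurable]: "X \<in> borel_measurable M" using distributed_measurable[OF X] by simp
  have "integrable lborel (\<lambda>x. normal_density 0 \<sigma> x * x\<^sup>2)"
    using integrable_normal_moment[OF s, of 0 2] by simp
  then have "integrable M (\<lambda>x. (X x)\<^sup>2)"
    by (subst distributed_integrable[OF X, symmetric]) auto
  then show "sq_integrable M X" by (simp add: sq_integrable_def)
  show E: "expectation X = 0" by (rule normal_distributed_expectation[OF s X])
  show "expectation (\<lambda>x. (X x)\<^sup>2) = \<sigma>\<^sup>2"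
    using normal_distributed_variance[OF s X] by (simp add: E)
qed

lemma char_scaled_normal:
  assumes X: "distributed M lborel X (normal_density 0 \<sigma>)" and s: "\<sigma> > 0"
  shows "char (distr M borel (\<lambda>\<omega>. c * X \<omega>)) t = complex_of_real (exp (- (t\<^sup>2 * (c\<^sup>2 * \<sigma>\<^sup>2)) / 2))"
proof -
  have [measurable]: "X \<in> borel_measurable M" using distributed_measurable[OF X] by simp
  have d: "distributed M lborel (\<lambda>x. X x / \<sigma>) std_normal_density"
    using X normal_standard_normal_convert[OF s, of X 0] by simp
  have eq: "distr M lborel (\<lambda>x. X x / \<sigma>) = std_normal_distribution"
    using d unfolding distributed_def by simp
  have "char (distr M borel (\<lambda>\<omega>. c * X \<omega>)) t = (CLINT x|M. iexp (t * (c * X x)))"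
    by (simp add: char_def integral_distr)
  also have "\<dots> = (CLINT x|M. iexp ((t * c * \<sigma>) * (X x / \<sigma>)))"
    using s by (intro Bochner_Integration.integral_cong refl) (simp add: field_simps)
  also have "\<dots> = char (distr M lborel (\<lambda>x. X x / \<sigma>)) (t * c * \<sigma>)"
    unfolding char_def by (subst integral_distr) simp_all
  also have "\<dots> = complex_of_real (exp (- ((t * c * \<sigma>)\<^sup>2) / 2))"
    unfolding eq char_std_normal_distribution ..
  finally show ?thesis by (simp add: power_mult_distrib mult.assoc)
qed

text \<open>Gaussian laws are carried by their characteristic functions, since these multiply under
  independence and survive L2 limits (\<open>char_sq_limit\<close>).\<close>

lemma char_sum_indep_normal:
  assumes I: "indep_vars (\<lambda>_. borel) X I"
    and X: "\<And>i. i \<in> I \<Longrightarrow> distributed M lborel (X i) (normal_density 0 (\<sigma> i))" and s: "\<And>i. i \<in> I \<Longrightarrow> \<sigma> i > 0" and f: "finite I"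
  shows "char (distr M borel (\<lambda>\<omega>. \<Sum>i\<in>I. c i * X i \<omega>)) t = complex_of_real (exp (- (t\<^sup>2 * (\<Sum>i\<in>I. (c i)\<^sup>2 * (\<sigma> i)\<^sup>2)) / 2))"
proof -
  have "indep_vars (\<lambda>_. borel) (\<lambda>i \<omega>. c i * X i \<omega>) I"
    by (rule indep_vars_compose2[OF I, of "\<lambda>i x. c i * x"]) auto
  then have "char (distr M borel (\<lambda>\<omega>. \<Sum>i\<in>I. c i * X i \<omega>)) t = (\<Prod>i\<in>I. char (distr M borel (\<lambda>\<omega>. c i * X i \<omega>)) t)"
    by (rule char_distr_sum)
  also have "\<dots> = (\<Prod>i\<in>I. complex_of_real (exp (- (t\<^sup>2 * ((c i)\<^sup>2 * (\<sigma> i)\<^sup>2)) / 2)))"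
    by (intro prod.cong refl char_scaled_normal X s)
  also have "\<dots> = complex_of_real (\<Prod>i\<in>I. exp (- (t\<^sup>2 * ((c i)\<^sup>2 * (\<sigma> i)\<^sup>2)) / 2))" by simp
  also have "(\<Prod>i\<in>I. exp (- (t\<^sup>2 * ((c i)\<^sup>2 * (\<sigma> i)\<^sup>2)) / 2)) = exp (\<Sum>i\<in>I. - (t\<^sup>2 * ((c i)\<^sup>2 * (\<sigma> i)\<^sup>2)) / 2)"
    using f by (simp add: exp_sum)
  also have "(\<Sum>i\<in>I. - (t\<^sup>2 * ((c i)\<^sup>2 * (\<sigma> i)\<^sup>2)) / 2) = - (t\<^sup>2 * (\<Sum>i\<in>I. (c i)\<^sup>2 * (\<sigma> i)\<^sup>2)) / 2"
    by (simp add: sum_distrib_left sum_negf sum_divide_distrib)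
  finally show ?thesis .
qed

end

definition normal_tail :: "real \<Rightarrow> real" where
  "normal_tail x = measure std_normal_distribution {x..}"

text \<open>After division by the standard deviation the characteristic function is the standard
  normal one, and Levy's uniqueness theorem identifies the law.\<close>

lemma (in prob_space) prob_ge_of_normal_char:
  assumes Z[measurable]: "Z \<in> borel_measurable M" and v: "v > 0"
    and ch: "\<And>t. char (distr M borel Z) t = complex_of_real (exp (- (t\<^sup>2 * v) / 2))"
  shows "prob {\<omega> \<in> space M. x \<le> Z \<omega>} = normal_tail (x / sqrt v)"
proof -
  have "distr M borel (\<lambda>\<omega>. Z \<omega> / sqrt v) = std_normal_distribution"
  proof (rule Levy_uniqueness)
    show "real_distribution (distr M borel (\<lambda>\<omega>. Z \<omega> / sqrt v))" by (rule real_distribution_distr) simp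
    show "real_distribution std_normal_distribution" by (rule real_dist_normal_dist)
    show "char (distr M borel (\<lambda>\<omega>. Z \<omega> / sqrt v)) = char std_normal_distribution"
    proof
      fix t
      have "char (distr M borel (\<lambda>\<omega>. Z \<omega> / sqrt v)) t = char (distr M borel Z) (t / sqrt v)"
        by (simp add: char_def integral_distr)
      also have "\<dots> = complex_of_real (exp (- (t\<^sup>2) / 2))" using v by (simp add: ch power_divide)
      finally show "char (distr M borel (\<lambda>\<omega>. Z \<omega> / sqrt v)) t = char std_normal_distribution t"
        by (simp add: char_std_normal_distribution)
    qed
  qed
  then have "normal_tail (x / sqrt v) = measure (distr M borel (\<lambda>\<omega>. Z \<omega> / sqrt v)) {x / sqrt v..}"
    by (simp add: normal_tail_def)
  also have "\<dots> = prob ((\<lambda>\<omega>. Z \<omega> / sqrt v) -` {x / sqrt v..} \<inter> space M)"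
    by (rule measure_distr) auto
  also have "(\<lambda>\<omega>. Z \<omega> / sqrt v) -` {x / sqrt v..} \<inter> space M = {\<omega> \<in> space M. x \<le> Z \<omega>}"
    using v by (auto simp: divide_le_cancel)
  finally show ?thesis ..
qed

text \<open>Since |exp(i x) - exp(i y)| \<le> |x - y|, the characteristic functions at t differ by
  at most |t| times the L1 distance, which the L2 distance dominates.\<close>

lemma (in prob_space) char_sq_limit:
  assumes S: "\<And>k. sq_integrable M (S k)" and Z: "sq_integrable M Z"
    and lim: "(\<lambda>k. \<integral>x. (Z x - S k x)\<^sup>2 \<partial>M) \<longlonglongrightarrow> 0"
  shows "(\<lambda>k. char (distr M borel (S k)) t) \<longlonglongrightarrow> char (distr M borel Z) t"
proof -
  have [measurable]: "S k \<in> borel_measurable M" "Z \<in> borel_measurable M" for k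
    using S Z by (auto simp: sq_integrable_def)
  have le: "norm (char (distr M borel (S k)) t - char (distr M borel Z) t) \<le> sqrt (t\<^sup>2 * (\<integral>x. (Z x - S k x)\<^sup>2 \<partial>M))" for k
  proof -
    have d: "sq_integrable M (\<lambda>x. S k x - Z x)" by (intro sq_integrable_diff S Z)
    have ii: "integrable M (\<lambda>x. iexp (t * S k x))" "integrable M (\<lambda>x. iexp (t * Z x))"
      by (intro integrable_iexp; simp)+
    have "char (distr M borel (S k)) t - char (distr M borel Z) t = (CLINT x|M. iexp (t * S k x)) - (CLINT x|M. iexp (t * Z x))"
      by (simp add: char_def integral_distr)
    also have "\<dots> = (CLINT x|M. iexp (t * S k x) - iexp (t * Z x))"
      using ii by simp
    finally have "norm (char (distr M borel (S k)) t - char (distr M borel Z) t) \<le> (\<integral>x. norm (iexp (t * S k x) - iexp (t * Z x)) \<partial>M)"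
      by simp
    also have "\<dots> \<le> (\<integral>x. \<bar>t\<bar> * \<bar>S k x - Z x\<bar> \<partial>M)"
    proof (rule integral_mono)
      show "integrable M (\<lambda>x. norm (iexp (t * S k x) - iexp (t * Z x)))"
        using ii by (intro integrable_norm Bochner_Integration.integrable_diff)
      show "integrable M (\<lambda>x. \<bar>t\<bar> * \<bar>S k x - Z x\<bar>)" using sq_integrable_imp_integrable[OF d] by simp
      fix x
      have "iexp (t * S k x) - iexp (t * Z x) = iexp (t * Z x) * (iexp (t * (S k x - Z x)) - 1)"
        by (simp add: algebra_simps flip: exp_add)
      then have "norm (iexp (t * S k x) - iexp (t * Z x)) = norm (iexp (t * (S k x - Z x)) - 1)"
        by (simp add: norm_mult)
      also have "\<dots> \<le> \<bar>t * (S k x - Z x)\<bar>" using iexp_approx1[of "t * (S k x - Z x)" 0] by simp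
      finally show "norm (iexp (t * S k x) - iexp (t * Z x)) \<le> \<bar>t\<bar> * \<bar>S k x - Z x\<bar>" by (simp only: abs_mult)
    qed
    also have "\<dots> = \<bar>t\<bar> * (\<integral>x. \<bar>S k x - Z x\<bar> \<partial>M)" by simp
    also have "\<dots> \<le> sqrt (t\<^sup>2 * (\<integral>x. (Z x - S k x)\<^sup>2 \<partial>M))"
    proof (rule real_le_rsqrt)
      show "(\<bar>t\<bar> * (\<integral>x. \<bar>S k x - Z x\<bar> \<partial>M))\<^sup>2 \<le> t\<^sup>2 * (\<integral>x. (Z x - S k x)\<^sup>2 \<partial>M)"
        unfolding power_mult_distrib power2_abs using sq_L1_le_L2[OF d]
        by (intro mult_left_mono) (simp_all add: power2_commute)
    qed
    finally show ?thesis .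
  qed
  have "(\<lambda>k. sqrt (t\<^sup>2 * (\<integral>x. (Z x - S k x)\<^sup>2 \<partial>M))) \<longlonglongrightarrow> sqrt (t\<^sup>2 * 0)"
    by (intro tendsto_intros lim)
  then have lim0: "(\<lambda>k. sqrt (t\<^sup>2 * (\<integral>x. (Z x - S k x)\<^sup>2 \<partial>M))) \<longlonglongrightarrow> 0"
    by (simp only: mult_zero_right real_sqrt_zero)
  have "(\<lambda>k. char (distr M borel (S k)) t - char (distr M borel Z) t) \<longlonglongrightarrow> 0"
    by (rule Lim_null_comparison[OF always_eventually lim0]) (rule allI, rule le)
  then show ?thesis by (rule LIM_zero_cancel)
qed

lemma (in prob_space) indep_vars_pair_integral:
  fixes X :: "'i \<Rightarrow> 'a \<Rightarrow> real"
  assumes "indep_vars (\<lambda>_. borel) X I" "i \<in> I" "j \<in> I" "i \<noteq> j" "integrable M (X i)" "integrable M (X j)"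
  shows "expectation (\<lambda>\<omega>. X i \<omega> * X j \<omega>) = expectation (X i) * expectation (X j)"
proof -
  have "indep_vars (\<lambda>_. borel) X {i, j}" using assms by (intro indep_vars_subset[OF assms(1)]) auto
  then have "expectation (\<lambda>\<omega>. \<Prod>i\<in>{i,j}. X i \<omega>) = (\<Prod>i\<in>{i,j}. expectation (X i))"
    using assms by (intro indep_vars_lebesgue_integral) auto
  then show ?thesis using assms by simp
qed

text \<open>The Wiener integral as a limit along a subsequence that depends on the integrand only: it is one measurable
  functional, applied to every path, and so inherits the independence of the paths. Outside a null set of
  paths the limit exists; elsewhere \<open>lim\<close> is an arbitrary value.\<close>

definition dyadic_subseq :: "(real \<Rightarrow> real) \<Rightarrow> nat \<Rightarrow> nat" where
  "dyadic_subseq \<phi> = (SOME r. strict_mono r \<and>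
     (\<forall>m k. k \<ge> r m \<longrightarrow> (\<integral>x. (dyadic_step \<phi> k x - dyadic_step \<phi> (r m) x)\<^sup>2 \<partial>unit_leb) \<le> (1/4)^m))"

definition wiener_int :: "(real \<Rightarrow> real) \<Rightarrow> (real \<Rightarrow> real) \<Rightarrow> real" where
  "wiener_int \<phi> x = lim (\<lambda>m. dyadic_sum \<phi> x (dyadic_subseq \<phi> m))"

text \<open>A witness for the choice exists because the projections converge and hence form a Cauchy
  sequence.\<close>

lemma dyadic_subseq:
  assumes phi: "sq_integrable unit_leb \<phi>"
  shows "strict_mono (dyadic_subseq \<phi>)"
    "k \<ge> dyadic_subseq \<phi> m \<Longrightarrow> (\<integral>x. (dyadic_step \<phi> k x - dyadic_step \<phi> (dyadic_subseq \<phi> m) x)\<^sup>2 \<partial>unit_leb) \<le> (1/4)^m"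
proof -
  have "\<exists>r. strict_mono r \<and>
     (\<forall>m k. k \<ge> r m \<longrightarrow> (\<integral>x. (dyadic_step \<phi> k x - dyadic_step \<phi> (r m) x)\<^sup>2 \<partial>unit_leb) \<le> (1/4)^m)"
  proof (rule fast_Cauchy_index)
    fix e :: real assume "e > 0"
    then have "\<forall>\<^sub>F k in sequentially. (\<integral>x. (dyadic_step \<phi> k x - \<phi> x)\<^sup>2 \<partial>unit_leb) < e / 4"
      using dyadic_step_tendsto[OF phi] by (auto dest: order_tendstoD(2)[where a="e/4"])
    then obtain N where N: "\<And>k. k \<ge> N \<Longrightarrow> (\<integral>x. (dyadic_step \<phi> k x - \<phi> x)\<^sup>2 \<partial>unit_leb) < e / 4"
      by (auto simp: eventually_sequentially)
    have "(\<integral>x. (dyadic_step \<phi> k x - dyadic_step \<phi> l x)\<^sup>2 \<partial>unit_leb) \<le> e" if "k \<ge> N" "l \<ge> N" for k l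
    proof -
      have "(\<integral>x. (dyadic_step \<phi> k x - dyadic_step \<phi> l x)\<^sup>2 \<partial>unit_leb) \<le>
        2 * (\<integral>x. (dyadic_step \<phi> k x - \<phi> x)\<^sup>2 \<partial>unit_leb) + 2 * (\<integral>x. (\<phi> x - dyadic_step \<phi> l x)\<^sup>2 \<partial>unit_leb)"
        by (intro sq_dist_triangle sq_integrable_dyadic_step phi)
      then show ?thesis using N[OF that(1)] N[OF that(2)] power2_commute[of "\<phi> _"] by simp
    qed
    then show "\<exists>N. \<forall>l\<ge>N. \<forall>k\<ge>N. (\<integral>x. (dyadic_step \<phi> k x - dyadic_step \<phi> l x)\<^sup>2 \<partial>unit_leb) \<le> e" by blast
  qed blast
  from someI_ex[OF this, folded dyadic_subseq_def]
  show "strict_mono (dyadic_subseq \<phi>)"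
    "k \<ge> dyadic_subseq \<phi> m \<Longrightarrow> (\<integral>x. (dyadic_step \<phi> k x - dyadic_step \<phi> (dyadic_subseq \<phi> m) x)\<^sup>2 \<partial>unit_leb) \<le> (1/4)^m"
    by auto
qed

section \<open>Dyadic sums and Wiener integrals as functionals of trajectories\<close>

lemma dyadic_mem: "m < 2^k \<Longrightarrow> real m / 2^k \<in> {0..1}" "m < 2^k \<Longrightarrow> real (Suc m) / 2^k \<in> {0..1}"
  using dyadic_le_1[of m k] by (auto simp: field_simps)

lemma dyadic_sum_cong:
  assumes "\<And>t. t \<in> {0..1} \<Longrightarrow> x t = y t"
  shows "dyadic_sum \<phi> x k = dyadic_sum \<phi> y k"
proof -
  have "x (real (Suc m) / 2^k) = y (real (Suc m) / 2^k)" "x (real m / 2^k) = y (real m / 2^k)" if "m < 2^k" for m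
    using dyadic_mem[OF that] by (auto intro!: assms)
  then show ?thesis unfolding dyadic_sum_def by (intro sum.cong refl) (simp del: of_nat_Suc)
qed

lemma dyadic_sum_add: "dyadic_sum \<phi> (\<lambda>t. x t + y t) k = dyadic_sum \<phi> x k + dyadic_sum \<phi> y k"
  by (simp add: dyadic_sum_def sum.distrib[symmetric] algebra_simps)

text \<open>Both sides read the path only at dyadic times in [0, 1]. This links the restricted paths
  of the model, which are elements of \<open>traj_space\<close>, with the raw paths
  \<open>W \<omega>\<close>.\<close>

lemma wiener_int_restrict: "wiener_int \<phi> (restrict x {0..1}) = wiener_int \<phi> x"
  unfolding wiener_int_def by (intro arg_cong[where f=lim] ext dyadic_sum_cong) auto

lemma dyadic_sum_measurable: "(\<lambda>x. dyadic_sum \<phi> x k) \<in> borel_measurable traj_space"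
proof -
  have "(\<lambda>x. x t) \<in> borel_measurable traj_space" if "t \<in> {0..1}" for t
    unfolding traj_space_def using that by (rule measurable_component_singleton)
  then show ?thesis unfolding dyadic_sum_def
    using dyadic_mem by (intro borel_measurable_sum borel_measurable_times borel_measurable_diff) (auto simp del: of_nat_Suc)
qed

text \<open>Only countably many times are involved, so the product sigma-algebra suffices.\<close>

lemma wiener_int_measurable [measurable]: "wiener_int \<phi> \<in> borel_measurable traj_space"
  unfolding wiener_int_def[abs_def] by (intro borel_measurable_lim_metric dyadic_sum_measurable)

section \<open>Brownian increments, the isometry and the law of Wiener integrals\<close>

locale brownian = prob_space M for M :: "'a measure" +
  fixes W :: "'a \<Rightarrow> real \<Rightarrow> real"
  assumes BM: "standard_BM M W"
begin

lemma W_measurable: "t \<in> {0..1} \<Longrightarrow> (\<lambda>\<omega>. W \<omega> t) \<in> borel_measurable M"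
  using BM by (simp add: standard_BM_def)

lemma W_0: "AE \<omega> in M. W \<omega> 0 = 0"
  using BM by (auto simp: standard_BM_def elim: eventually_mono)

lemma W_increments:
  assumes "0 \<le> t 0" "t k \<le> 1" "\<And>i. i < k \<Longrightarrow> t i < t (Suc i)"
  shows "indep_vars (\<lambda>_. borel) (\<lambda>i \<omega>. W \<omega> (t (Suc i)) - W \<omega> (t i)) {..<k}"
    "i < k \<Longrightarrow> distributed M lborel (\<lambda>\<omega>. W \<omega> (t (Suc i)) - W \<omega> (t i)) (normal_density 0 (sqrt (t (Suc i) - t i)))"
proof -
  have "\<forall>(k::nat) (t::nat \<Rightarrow> real). 0 \<le> t 0 \<and> t k \<le> 1 \<and> (\<forall>i<k. t i < t (Suc i)) \<longrightarrow>
        indep_vars (\<lambda>_. borel) (\<lambda>i \<omega>. W \<omega> (t (Suc i)) - W \<omega> (t i)) {..<k} \<and>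
        (\<forall>i<k. distributed M lborel (\<lambda>\<omega>. W \<omega> (t (Suc i)) - W \<omega> (t i))
                 (normal_density 0 (sqrt (t (Suc i) - t i))))"
    using BM unfolding standard_BM_def by blast
  from this[rule_format, of t k] assms
  show "indep_vars (\<lambda>_. borel) (\<lambda>i \<omega>. W \<omega> (t (Suc i)) - W \<omega> (t i)) {..<k}"
    "i < k \<Longrightarrow> distributed M lborel (\<lambda>\<omega>. W \<omega> (t (Suc i)) - W \<omega> (t i)) (normal_density 0 (sqrt (t (Suc i) - t i)))"
    by blast+
qed

lemma increment_moments:
  assumes "0 \<le> s" "s \<le> t" "t \<le> 1"
  shows "sq_integrable M (\<lambda>\<omega>. W \<omega> t - W \<omega> s)" "expectation (\<lambda>\<omega>. W \<omega> t - W \<omega> s) = 0"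
    "expectation (\<lambda>\<omega>. (W \<omega> t - W \<omega> s)\<^sup>2) = t - s"
proof -
  have "sq_integrable M (\<lambda>\<omega>. W \<omega> t - W \<omega> s) \<and> expectation (\<lambda>\<omega>. W \<omega> t - W \<omega> s) = 0
    \<and> expectation (\<lambda>\<omega>. (W \<omega> t - W \<omega> s)\<^sup>2) = t - s"
  proof (cases "s = t")
    case False
    then have "s < t" using assms by simp
    have "distributed M lborel (\<lambda>\<omega>. W \<omega> t - W \<omega> s) (normal_density 0 (sqrt (t - s)))"
      using W_increments(2)[of "\<lambda>i. if i = 0 then s else t" 1 0] assms \<open>s < t\<close> by simp
    from normal_moments[OF this] \<open>s < t\<close> show ?thesis by simp
  qed (simp add: sq_integrable_zero)
  then show "sq_integrable M (\<lambda>\<omega>. W \<omega> t - W \<omega> s)" "expectation (\<lambda>\<omega>. W \<omega> t - W \<omega> s) = 0"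
    "expectation (\<lambda>\<omega>. (W \<omega> t - W \<omega> s)\<^sup>2) = t - s" by auto
qed

text \<open>The increment up to t splits as (W s - W 0) + (W t - W s) with independent centred
  parts. Everything is measured from \<open>W \<omega> 0\<close>, because that value vanishes only
  almost surely.\<close>

lemma W_cov_le:
  assumes "0 \<le> s" "s \<le> t" "t \<le> 1"
  shows "expectation (\<lambda>\<omega>. (W \<omega> s - W \<omega> 0) * (W \<omega> t - W \<omega> 0)) = s"
proof (cases "s = 0 \<or> s = t")
  case True
  then show ?thesis using increment_moments(3)[of 0 s] assms by (auto simp: power2_eq_square)
next
  case False
  then have st: "0 < s" "s < t" using assms by auto
  let ?t = "\<lambda>i::nat. if i = 0 then 0 else if i = 1 then s else t"
  have ind: "indep_vars (\<lambda>_. borel) (\<lambda>i \<omega>. W \<omega> (?t (Suc i)) - W \<omega> (?t i)) {..<2}"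
    using st assms by (intro W_increments(1)) (auto simp: less_2_cases_iff)
  have "expectation (\<lambda>\<omega>. (W \<omega> (?t (Suc 0)) - W \<omega> (?t 0)) * (W \<omega> (?t (Suc 1)) - W \<omega> (?t 1)))
    = expectation (\<lambda>\<omega>. W \<omega> (?t (Suc 0)) - W \<omega> (?t 0)) * expectation (\<lambda>\<omega>. W \<omega> (?t (Suc 1)) - W \<omega> (?t 1))"
    using increment_moments(1)[of 0 s] increment_moments(1)[of s t] st assms
    by (intro indep_vars_pair_integral[OF ind]) (auto intro!: sq_integrable_imp_integrable)
  then have 1: "expectation (\<lambda>\<omega>. (W \<omega> s - W \<omega> 0) * (W \<omega> t - W \<omega> s)) = 0"
    using increment_moments(2)[of 0 s] st assms by simp
  have "expectation (\<lambda>\<omega>. (W \<omega> s - W \<omega> 0) * (W \<omega> t - W \<omega> 0)) =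
    expectation (\<lambda>\<omega>. (W \<omega> s - W \<omega> 0)\<^sup>2 + (W \<omega> s - W \<omega> 0) * (W \<omega> t - W \<omega> s))"
    by (intro Bochner_Integration.integral_cong refl) (simp add: power2_eq_square algebra_simps)
  also have "\<dots> = s"
    using 1 increment_moments(1,3)[of 0 s] increment_moments(1)[of s t] st assms
    by (simp add: sq_integrable_square sq_integrable_mult)
  finally show ?thesis .
qed

lemma W_cov:
  assumes "s \<in> {0..1}" "t \<in> {0..1}"
  shows "expectation (\<lambda>\<omega>. (W \<omega> s - W \<omega> 0) * (W \<omega> t - W \<omega> 0)) = min s t"
proof (cases "s \<le> t")
  case True then show ?thesis using W_cov_le[of s t] assms by simp
next
  case False
  then show ?thesis using W_cov_le[of t s] assms by (simp add: mult.commute)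
qed

text \<open>Expand over the four pairs of endpoints; the alternating sum of minima is the length of
  the overlap of the two intervals.\<close>

lemma increment_cov:
  assumes "0 \<le> a" "a \<le> b" "b \<le> 1" "0 \<le> c" "c \<le> d" "d \<le> 1"
  shows "expectation (\<lambda>\<omega>. (W \<omega> b - W \<omega> a) * (W \<omega> d - W \<omega> c)) = (\<integral>x. indicat_real {a..<b} x * indicat_real {c..<d} x \<partial>unit_leb)"
proof -
  let ?B = "\<lambda>t \<omega>. W \<omega> t - W \<omega> 0"
  have i: "integrable M (\<lambda>\<omega>. ?B s \<omega> * ?B t \<omega>)" if "s \<in> {0..1}" "t \<in> {0..1}" for s t
    using that by (intro sq_integrable_mult increment_moments(1)) auto
  have "expectation (\<lambda>\<omega>. (W \<omega> b - W \<omega> a) * (W \<omega> d - W \<omega> c)) =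
     expectation (\<lambda>\<omega>. ?B b \<omega> * ?B d \<omega> - ?B b \<omega> * ?B c \<omega> - ?B a \<omega> * ?B d \<omega> + ?B a \<omega> * ?B c \<omega>)"
    by (intro Bochner_Integration.integral_cong refl) (simp add: algebra_simps)
  also have "\<dots> = min b d - min b c - min a d + min a c"
    using assms i[of b d] i[of b c] i[of a d] i[of a c] W_cov[of b d] W_cov[of b c] W_cov[of a d] W_cov[of a c] by simp
  also have "\<dots> = max 0 (min b d - max a c)" using assms by (auto simp: min_def max_def)
  finally show ?thesis using assms by (subst integral_indicator_overlap) auto
qed

text \<open>Both second moments are double sums with the same coefficients and, by
  \<open>increment_cov\<close>, the same cross terms. The intervals may overlap, so that sums of two
  dyadic levels can be treated as one step integral.\<close>

lemma step_isometry:
  assumes f: "finite I" and ab: "\<And>i. i \<in> I \<Longrightarrow> 0 \<le> a i \<and> a i \<le> b i \<and> b i \<le> 1"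
  shows "sq_integrable M (\<lambda>\<omega>. \<Sum>i\<in>I. c i * (W \<omega> (b i) - W \<omega> (a i)))"
    and "expectation (\<lambda>\<omega>. (\<Sum>i\<in>I. c i * (W \<omega> (b i) - W \<omega> (a i)))\<^sup>2) =
      (\<integral>x. (\<Sum>i\<in>I. c i * indicat_real {a i..<b i} x)\<^sup>2 \<partial>unit_leb)"
proof -
  have s: "sq_integrable M (\<lambda>\<omega>. W \<omega> (b i) - W \<omega> (a i))" if "i \<in> I" for i
    using ab[OF that] by (intro increment_moments) auto
  then show "sq_integrable M (\<lambda>\<omega>. \<Sum>i\<in>I. c i * (W \<omega> (b i) - W \<omega> (a i)))"
    by (intro sq_integrable_sum sq_integrable_cmult)
  have i1: "integrable M (\<lambda>\<omega>. (W \<omega> (b i) - W \<omega> (a i)) * (W \<omega> (b j) - W \<omega> (a j)))" if "i \<in> I" "j \<in> I" for i j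
    using that s by (intro sq_integrable_mult) auto
  have i2: "integrable unit_leb (\<lambda>x. indicat_real {a i..<b i} x * indicat_real {a j..<b j} x)" for i j
    by (intro sq_integrable_mult sq_integrable_indicator)
  have "expectation (\<lambda>\<omega>. (\<Sum>i\<in>I. c i * (W \<omega> (b i) - W \<omega> (a i)))\<^sup>2) =
    expectation (\<lambda>\<omega>. \<Sum>i\<in>I. \<Sum>j\<in>I. (c i * c j) * ((W \<omega> (b i) - W \<omega> (a i)) * (W \<omega> (b j) - W \<omega> (a j))))"
    unfolding power2_eq_square sum_product
    by (intro Bochner_Integration.integral_cong refl sum.cong) (simp add: ac_simps)
  also have "\<dots> = (\<Sum>i\<in>I. \<Sum>j\<in>I. (c i * c j) * expectation (\<lambda>\<omega>. (W \<omega> (b i) - W \<omega> (a i)) * (W \<omega> (b j) - W \<omega> (a j))))"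
    using i1 by (simp add: Bochner_Integration.integral_sum Bochner_Integration.integrable_sum)
  also have "\<dots> = (\<Sum>i\<in>I. \<Sum>j\<in>I. (c i * c j) * (\<integral>x. indicat_real {a i..<b i} x * indicat_real {a j..<b j} x \<partial>unit_leb))"
    using ab by (intro sum.cong refl arg_cong2[where f="(*)"] increment_cov) auto
  also have "\<dots> = (\<integral>x. (\<Sum>i\<in>I. \<Sum>j\<in>I. (c i * c j) * (indicat_real {a i..<b i} x * indicat_real {a j..<b j} x)) \<partial>unit_leb)"
    using i2 by (simp add: Bochner_Integration.integral_sum Bochner_Integration.integrable_sum)
  also have "\<dots> = (\<integral>x. (\<Sum>i\<in>I. c i * indicat_real {a i..<b i} x)\<^sup>2 \<partial>unit_leb)"
    unfolding power2_eq_square sum_product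
    by (intro Bochner_Integration.integral_cong refl sum.cong) (simp add: ac_simps)
  finally show "expectation (\<lambda>\<omega>. (\<Sum>i\<in>I. c i * (W \<omega> (b i) - W \<omega> (a i)))\<^sup>2) =
      (\<integral>x. (\<Sum>i\<in>I. c i * indicat_real {a i..<b i} x)\<^sup>2 \<partial>unit_leb)" .
qed

lemma dyadic_sum_sq_integrable: "sq_integrable M (\<lambda>\<omega>. dyadic_sum \<phi> (W \<omega>) k)"
  unfolding dyadic_sum_def
  by (rule step_isometry(1)[OF finite_lessThan, of "2^k" "\<lambda>m. real m / 2^k" "\<lambda>m. real (Suc m) / 2^k"])
     (use dyadic_mem in \<open>auto simp: divide_right_mono simp del: of_nat_Suc\<close>)

lemma dyadic_sum_isometry:
  "expectation (\<lambda>\<omega>. (dyadic_sum \<phi> (W \<omega>) k - dyadic_sum \<phi> (W \<omega>) l)\<^sup>2) =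
    (\<integral>x. (dyadic_step \<phi> k x - dyadic_step \<phi> l x)\<^sup>2 \<partial>unit_leb)"
proof -
  \<comment> \<open>The difference of two levels is one sum over the disjoint union of the index
    sets, with negated coefficients on the second part.\<close>
  let ?I = "{..<2^k::nat} <+> {..<2^l::nat}"
  let ?c = "case_sum (dyadic_coef \<phi> k) (\<lambda>m. - dyadic_coef \<phi> l m)"
  let ?a = "case_sum (\<lambda>m. real m / 2^k) (\<lambda>m. real m / 2^l)"
  let ?b = "case_sum (\<lambda>m. real (Suc m) / 2^k) (\<lambda>m. real (Suc m) / 2^l)"
  have "expectation (\<lambda>\<omega>. (\<Sum>i\<in>?I. ?c i * (W \<omega> (?b i) - W \<omega> (?a i)))\<^sup>2) =
      (\<integral>x. (\<Sum>i\<in>?I. ?c i * indicat_real {?a i..<?b i} x)\<^sup>2 \<partial>unit_leb)"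
    using dyadic_mem by (intro step_isometry(2)) (auto simp: divide_right_mono simp del: of_nat_Suc)
  then show ?thesis
    by (simp add: sum.Plus dyadic_sum_def dyadic_step_def sum_negf del: of_nat_Suc sum_mult_indicator)
qed

text \<open>The isometry turns the choice of \<open>dyadic_subseq\<close>, made for functions on
  [0, 1], into the same fast Cauchy property for the dyadic sums of any Brownian motion.\<close>

lemma wiener_int_sq:
  assumes phi: "sq_integrable unit_leb \<phi>"
  shows "sq_integrable M (\<lambda>\<omega>. wiener_int \<phi> (W \<omega>))"
    "(\<lambda>k. \<integral>\<omega>. (wiener_int \<phi> (W \<omega>) - dyadic_sum \<phi> (W \<omega>) k)\<^sup>2 \<partial>M) \<longlonglongrightarrow> 0"
  unfolding wiener_int_def
  using dyadic_subseq[OF phi]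
  by (intro sq_complete_subseq[of "\<lambda>k \<omega>. dyadic_sum \<phi> (W \<omega>) k"] dyadic_sum_sq_integrable; simp add: dyadic_sum_isometry)+

lemma dyadic_sum_mean: "expectation (\<lambda>\<omega>. dyadic_sum \<phi> (W \<omega>) k) = 0"
proof -
  have i: "sq_integrable M (\<lambda>\<omega>. W \<omega> (real (Suc m) / 2^k) - W \<omega> (real m / 2^k))"
    "expectation (\<lambda>\<omega>. W \<omega> (real (Suc m) / 2^k) - W \<omega> (real m / 2^k)) = 0" if "m < 2^k" for m
    using dyadic_mem[OF that] by (auto intro!: increment_moments simp: divide_right_mono simp del: of_nat_Suc)
  then show ?thesis unfolding dyadic_sum_def
    by (subst Bochner_Integration.integral_sum) (auto simp: sq_integrable_imp_integrable simp del: of_nat_Suc)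
qed

lemma wiener_int_moments:
  assumes phi: "sq_integrable unit_leb \<phi>"
  shows "expectation (\<lambda>\<omega>. wiener_int \<phi> (W \<omega>)) = 0"
    "expectation (\<lambda>\<omega>. (wiener_int \<phi> (W \<omega>))\<^sup>2) = (\<integral>x. (\<phi> x)\<^sup>2 \<partial>unit_leb)"
proof -
  have lim: "(\<lambda>k. \<integral>\<omega>. (dyadic_sum \<phi> (W \<omega>) k - wiener_int \<phi> (W \<omega>))\<^sup>2 \<partial>M) \<longlonglongrightarrow> 0"
    using wiener_int_sq(2)[OF phi] by (simp add: power2_commute)
  \<comment> \<open>The mean is treated as the inner product with the constant 1.\<close>
  have "(\<lambda>k. expectation (\<lambda>\<omega>. dyadic_sum \<phi> (W \<omega>) k * 1)) \<longlonglongrightarrow> expectation (\<lambda>\<omega>. wiener_int \<phi> (W \<omega>) * 1)"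
    by (rule sq_tendsto_inner[OF dyadic_sum_sq_integrable wiener_int_sq(1)[OF phi] sq_integrable_bounded[of "\<lambda>_. 1" 1] lim]) auto
  then show "expectation (\<lambda>\<omega>. wiener_int \<phi> (W \<omega>)) = 0"
    by (simp add: dyadic_sum_mean LIMSEQ_const_iff)
  have e: "expectation (\<lambda>\<omega>. (dyadic_sum \<phi> (W \<omega>) k)\<^sup>2) = (\<integral>x. (dyadic_step \<phi> k x)\<^sup>2 \<partial>unit_leb)" for k
    unfolding dyadic_sum_def dyadic_step_def
    using dyadic_mem by (intro step_isometry(2)) (auto simp: divide_right_mono simp del: of_nat_Suc)
  have "(\<lambda>k. expectation (\<lambda>\<omega>. (dyadic_sum \<phi> (W \<omega>) k)\<^sup>2)) \<longlonglongrightarrow> expectation (\<lambda>\<omega>. (wiener_int \<phi> (W \<omega>))\<^sup>2)"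
    by (rule sq_tendsto_norm[OF dyadic_sum_sq_integrable wiener_int_sq(1)[OF phi] lim])
  moreover have "(\<lambda>k. \<integral>x. (dyadic_step \<phi> k x)\<^sup>2 \<partial>unit_leb) \<longlonglongrightarrow> (\<integral>x. (\<phi> x)\<^sup>2 \<partial>unit_leb)"
    by (rule sq_tendsto_norm[OF sq_integrable_dyadic_step phi dyadic_step_tendsto[OF phi]])
  ultimately show "expectation (\<lambda>\<omega>. (wiener_int \<phi> (W \<omega>))\<^sup>2) = (\<integral>x. (\<phi> x)\<^sup>2 \<partial>unit_leb)"
    unfolding e by (rule LIMSEQ_unique)
qed

lemma dyadic_sum_char:
  "char (distr M borel (\<lambda>\<omega>. dyadic_sum \<phi> (W \<omega>) k)) t =
     complex_of_real (exp (- (t\<^sup>2 * (\<integral>x. (dyadic_step \<phi> k x)\<^sup>2 \<partial>unit_leb)) / 2))"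
proof -
  let ?t = "\<lambda>m::nat. real m / 2^k"
  have "char (distr M borel (\<lambda>\<omega>. \<Sum>m<2^k. dyadic_coef \<phi> k m * (W \<omega> (?t (Suc m)) - W \<omega> (?t m)))) t =
     complex_of_real (exp (- (t\<^sup>2 * (\<Sum>m<2^k. (dyadic_coef \<phi> k m)\<^sup>2 * (sqrt (?t (Suc m) - ?t m))\<^sup>2)) / 2))"
    using W_increments[of ?t "2^k"]
    by (intro char_sum_indep_normal) (auto simp: divide_strict_right_mono)
  moreover have "(sqrt (?t (Suc m) - ?t m))\<^sup>2 = 1 / 2^k" for m
    by (simp add: diff_divide_distrib[symmetric])
  ultimately show ?thesis by (simp add: dyadic_step_norm dyadic_sum_def mult.commute del: of_nat_Suc)
qed

text \<open>Each \<open>wiener_int (e j)\<close> is defined along its own subsequence, so linearity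
  in the integrand is not immediate. It is exact for dyadic sums at every level, and these converge
  in L2 along the full sequence. The combination is therefore an L2 limit of the dyadic sums of
  \<psi>, whose characteristic functions are known.\<close>

lemma prob_wiener_ge:
  assumes J: "finite J" and e: "\<And>j. j \<in> J \<Longrightarrow> sq_integrable unit_leb (e j)"
    and orth: "\<And>i j. i \<in> J \<Longrightarrow> j \<in> J \<Longrightarrow> (\<integral>x. e i x * e j x \<partial>unit_leb) = (if i = j then 1 else 0)"
    and v: "(\<Sum>j\<in>J. (v j)\<^sup>2) > 0"
  shows "prob {\<omega> \<in> space M. x \<le> (\<Sum>j\<in>J. v j * wiener_int (e j) (W \<omega>))} = normal_tail (x / sqrt (\<Sum>j\<in>J. (v j)\<^sup>2))"
proof (rule prob_ge_of_normal_char)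
  let ?Z = "\<lambda>\<omega>. \<Sum>j\<in>J. v j * wiener_int (e j) (W \<omega>)"
  let ?S = "\<lambda>k \<omega>. \<Sum>j\<in>J. v j * dyadic_sum (e j) (W \<omega>) k"
  define \<psi> where "\<psi> x = (\<Sum>j\<in>J. v j * e j x)" for x
  have psi: "sq_integrable unit_leb \<psi>" unfolding \<psi>_def by (intro sq_integrable_sum sq_integrable_cmult e)
  have Z: "sq_integrable M ?Z" by (intro sq_integrable_sum sq_integrable_cmult wiener_int_sq e)
  then show "?Z \<in> borel_measurable M" by (simp add: sq_integrable_def)
  have S: "sq_integrable M (?S k)" for k by (intro sq_integrable_sum sq_integrable_cmult dyadic_sum_sq_integrable)
  have coef: "dyadic_coef \<psi> k m = (\<Sum>j\<in>J. v j * dyadic_coef (e j) k m)" if "m < 2^k" for k m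
  proof -
    let ?i = "indicat_real {real m / 2^k..<real (Suc m) / 2^k}"
    have "(\<integral>x. \<psi> x * ?i x \<partial>unit_leb) = (\<integral>x. (\<Sum>j\<in>J. v j * (e j x * ?i x)) \<partial>unit_leb)"
      unfolding \<psi>_def sum_distrib_right
      by (intro Bochner_Integration.integral_cong refl sum.cong) (simp only: mult.assoc)
    also have "\<dots> = (\<Sum>j\<in>J. v j * (\<integral>x. e j x * ?i x \<partial>unit_leb))"
      using sq_integrable_mult[OF e sq_integrable_indicator] by (subst Bochner_Integration.integral_sum) auto
    finally show ?thesis
      using that e psi by (simp add: dyadic_coef_eq sum_distrib_right mult.assoc del: of_nat_Suc)
  qed
  have S_eq: "?S k = (\<lambda>\<omega>. dyadic_sum \<psi> (W \<omega>) k)" for k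
  proof
    fix \<omega>
    have "dyadic_sum \<psi> (W \<omega>) k = (\<Sum>m<2^k. \<Sum>j\<in>J. v j * (dyadic_coef (e j) k m * (W \<omega> (real (Suc m) / 2^k) - W \<omega> (real m / 2^k))))"
      unfolding dyadic_sum_def by (intro sum.cong refl) (simp add: coef sum_distrib_right mult.assoc)
    also have "\<dots> = ?S k \<omega>" unfolding dyadic_sum_def sum_distrib_left by (rule sum.swap)
    finally show "?S k \<omega> = dyadic_sum \<psi> (W \<omega>) k" ..
  qed
  have "(\<lambda>k. \<integral>\<omega>. (?Z \<omega> - ?S k \<omega>)\<^sup>2 \<partial>M) \<longlonglongrightarrow> 0"
  proof (rule tendsto_sandwich[of "\<lambda>_. 0"])
    \<comment> \<open>Cauchy-Schwarz over J bounds the squared error of the combination by the sum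
      of the squared errors of its terms, times the sum of the squares of v.\<close>
    let ?B = "\<lambda>k. (\<Sum>j\<in>J. (v j)\<^sup>2) * (\<Sum>j\<in>J. \<integral>\<omega>. (wiener_int (e j) (W \<omega>) - dyadic_sum (e j) (W \<omega>) k)\<^sup>2 \<partial>M)"
    have "?B \<longlonglongrightarrow> (\<Sum>j\<in>J. (v j)\<^sup>2) * (\<Sum>j\<in>J. 0)"
      by (intro tendsto_intros wiener_int_sq e)
    then show "?B \<longlonglongrightarrow> 0" by simp
    have d: "sq_integrable M (\<lambda>\<omega>. wiener_int (e j) (W \<omega>) - dyadic_sum (e j) (W \<omega>) k)" if "j \<in> J" for j k
      using that by (intro sq_integrable_diff wiener_int_sq e dyadic_sum_sq_integrable)
    have "(\<integral>\<omega>. (?Z \<omega> - ?S k \<omega>)\<^sup>2 \<partial>M) \<le> ?B k" for k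
    proof -
      have "(\<integral>\<omega>. (?Z \<omega> - ?S k \<omega>)\<^sup>2 \<partial>M) \<le> (\<integral>\<omega>. (\<Sum>j\<in>J. (v j)\<^sup>2) * (\<Sum>j\<in>J. (wiener_int (e j) (W \<omega>) - dyadic_sum (e j) (W \<omega>) k)\<^sup>2) \<partial>M)"
      proof (rule integral_mono)
        show "integrable M (\<lambda>\<omega>. (?Z \<omega> - ?S k \<omega>)\<^sup>2)" by (intro sq_integrable_square sq_integrable_diff Z S)
        show "integrable M (\<lambda>\<omega>. (\<Sum>j\<in>J. (v j)\<^sup>2) * (\<Sum>j\<in>J. (wiener_int (e j) (W \<omega>) - dyadic_sum (e j) (W \<omega>) k)\<^sup>2))"
          using d by (intro integrable_mult_right Bochner_Integration.integrable_sum sq_integrable_square)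
        fix \<omega>
        have "?Z \<omega> - ?S k \<omega> = (\<Sum>j\<in>J. v j * (wiener_int (e j) (W \<omega>) - dyadic_sum (e j) (W \<omega>) k))"
          by (simp add: sum_subtractf right_diff_distrib)
        then show "(?Z \<omega> - ?S k \<omega>)\<^sup>2 \<le> (\<Sum>j\<in>J. (v j)\<^sup>2) * (\<Sum>j\<in>J. (wiener_int (e j) (W \<omega>) - dyadic_sum (e j) (W \<omega>) k)\<^sup>2)"
          using Cauchy_Schwarz_ineq_sum[of v "\<lambda>j. wiener_int (e j) (W \<omega>) - dyadic_sum (e j) (W \<omega>) k" J] by simp
      qed
      also have "\<dots> = ?B k"
        using d by (simp add: sq_integrable_square Bochner_Integration.integral_sum)
      finally show ?thesis .
    qed
    then show "\<forall>\<^sub>F k in sequentially. (\<integral>\<omega>. (?Z \<omega> - ?S k \<omega>)\<^sup>2 \<partial>M) \<le> ?B k" by simp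
  qed auto
  then have ch: "(\<lambda>k. char (distr M borel (?S k)) t) \<longlonglongrightarrow> char (distr M borel ?Z) t" for t
    by (rule char_sq_limit[OF S Z])
  have "(\<integral>x. (\<psi> x)\<^sup>2 \<partial>unit_leb) = (\<integral>x. (0 - \<psi> x)\<^sup>2 \<partial>unit_leb)" by simp
  also have "\<dots> = (\<Sum>j\<in>J. (v j)\<^sup>2)"
    unfolding \<psi>_def by (subst sq_orthogonal_expansion[OF J sq_integrable_zero e orth]) auto
  finally have norm: "(\<integral>x. (\<psi> x)\<^sup>2 \<partial>unit_leb) = (\<Sum>j\<in>J. (v j)\<^sup>2)" .
  have n: "(\<lambda>k. \<integral>x. (dyadic_step \<psi> k x)\<^sup>2 \<partial>unit_leb) \<longlonglongrightarrow> (\<Sum>j\<in>J. (v j)\<^sup>2)"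
    unfolding norm[symmetric] by (rule sq_tendsto_norm[OF sq_integrable_dyadic_step psi dyadic_step_tendsto[OF psi]])
  show "char (distr M borel ?Z) t = complex_of_real (exp (- (t\<^sup>2 * (\<Sum>j\<in>J. (v j)\<^sup>2)) / 2))" for t
  proof (rule LIMSEQ_unique[OF ch])
    show "(\<lambda>k. char (distr M borel (?S k)) t) \<longlonglongrightarrow> complex_of_real (exp (- (t\<^sup>2 * (\<Sum>j\<in>J. (v j)\<^sup>2)) / 2))"
      unfolding S_eq dyadic_sum_char by (intro tendsto_intros n) simp
  qed
qed (rule v)

end

section \<open>The normal tail and the scalar excess-risk bound\<close>

lemma normal_tail_integral: "normal_tail x = (\<integral>y. std_normal_density y * indicat_real {x..} y \<partial>lborel)"
proof -
  interpret N: prob_space std_normal_distribution by (rule prob_space_normal_density) simp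
  have "normal_tail x = (\<integral>y. indicat_real {x..} y \<partial>std_normal_distribution)"
    by (simp add: normal_tail_def)
  also have "\<dots> = (\<integral>y. std_normal_density y *\<^sub>R indicat_real {x..} y \<partial>lborel)"
    by (rule integral_density) auto
  finally show ?thesis by simp
qed

lemma normal_integrable_indicator: "A \<in> sets borel \<Longrightarrow> integrable lborel (\<lambda>y. std_normal_density y * indicat_real A y)"
  using integrable_mult_indicator[of A lborel std_normal_density] by (simp add: mult.commute)

lemma normal_tail_bounds: "0 \<le> normal_tail x" "normal_tail x \<le> 1"
proof -
  interpret N: prob_space std_normal_distribution by (rule prob_space_normal_density) simp
  show "0 \<le> normal_tail x" "normal_tail x \<le> 1" by (auto simp: normal_tail_def)
qed

lemma normal_tail_minus: "normal_tail (- x) = 1 - normal_tail x"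
proof -
  have "normal_tail (- x) = (\<integral>y. std_normal_density y * indicat_real {..x} y \<partial>lborel)"
    unfolding normal_tail_integral
    by (subst lborel_integral_real_affine[where c="-1" and t=0])
       (auto simp: std_normal_density_def indicator_def intro!: Bochner_Integration.integral_cong)
  then have "normal_tail (- x) + normal_tail x =
    (\<integral>y. std_normal_density y * indicat_real {..x} y + std_normal_density y * indicat_real {x..} y \<partial>lborel)"
    by (simp add: normal_tail_integral normal_integrable_indicator)
  also have "\<dots> = (\<integral>y. std_normal_density y \<partial>lborel)"
  proof (rule integral_cong_AE)
    have "AE y in lborel. y \<noteq> x" by (rule AE_lborel_singleton)
    then show "AE y in lborel. std_normal_density y * indicat_real {..x} y + std_normal_density y * indicat_real {x..} y = std_normal_density y"
      by eventually_elim (auto simp: indicator_def)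
  qed auto
  finally show ?thesis by simp
qed

lemma continuous_std_normal_density: "continuous_on A std_normal_density"
  unfolding std_normal_density_def by (intro continuous_intros) auto

text \<open>Replaces the half-line by a compact interval with fixed right end b, where the
  fundamental theorem of calculus gives the derivative in x.\<close>

lemma normal_tail_diff:
  assumes "x \<le> b"
  shows "normal_tail x = normal_tail b + integral {x..b} std_normal_density"
proof -
  have "(\<integral>y. std_normal_density y * indicat_real {x..} y \<partial>lborel) = (\<integral>y. std_normal_density y * indicat_real {b..} y + std_normal_density y * indicat_real {x..b} y \<partial>lborel)"
  proof (rule integral_cong_AE)
    have "AE y in lborel. y \<noteq> b" by (rule AE_lborel_singleton)
    then show "AE y in lborel. std_normal_density y * indicat_real {x..} y = std_normal_density y * indicat_real {b..} y + std_normal_density y * indicat_real {x..b} y"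
      by eventually_elim (use assms in \<open>auto simp: indicator_def\<close>)
  qed auto
  also have "\<dots> = normal_tail b + (\<integral>y. std_normal_density y * indicat_real {x..b} y \<partial>lborel)"
    by (simp add: normal_tail_integral normal_integrable_indicator)
  also have "(\<integral>y. std_normal_density y * indicat_real {x..b} y \<partial>lborel) = (LINT y:{x..b}|lborel. std_normal_density y)"
    by (simp add: set_lebesgue_integral_def mult.commute)
  also have "\<dots> = integral {x..b} std_normal_density"
    by (rule set_borel_integral_eq_integral)
       (use normal_integrable_indicator[of "{x..b}"] in \<open>simp add: set_integrable_def mult.commute\<close>)
  finally show ?thesis by (simp add: normal_tail_integral)
qed

lemma DERIV_normal_tail: "(normal_tail has_real_derivative - std_normal_density x) (at x)"
proof -
  let ?a = "x - 1" and ?b = "x + 1"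
  have "((\<lambda>y. normal_tail ?b + integral {y..?b} std_normal_density) has_real_derivative (0 + - std_normal_density x)) (at x within {?a..?b})"
    by (intro DERIV_add DERIV_const integral_has_real_derivative' continuous_std_normal_density) auto
  then have "((\<lambda>y. normal_tail ?b + integral {y..?b} std_normal_density) has_real_derivative - std_normal_density x) (at x)"
    by (subst (asm) at_within_Icc_at) auto
  then show ?thesis
  proof (rule has_field_derivative_transform_within_open[where S="{?a<..<?b}"])
    show "normal_tail ?b + integral {y..?b} std_normal_density = normal_tail y" if "y \<in> {?a<..<?b}" for y
      using normal_tail_diff[of y ?b] that by auto
  qed auto
qed

lemma std_normal_density_le_1: "std_normal_density x \<le> 1"
proof -
  have "1 \<le> sqrt (2 * pi)" using pi_ge_two by simp
  then have "1 / sqrt (2 * pi) \<le> 1" by simp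
  moreover have "exp (- x\<^sup>2 / 2) \<le> 1" by simp
  ultimately have "1 / sqrt (2 * pi) * exp (- x\<^sup>2 / 2) \<le> 1 * 1" by (intro mult_mono) auto
  then show ?thesis by (simp add: std_normal_density_def)
qed

lemma normal_tail_antimono: "x \<le> y \<Longrightarrow> normal_tail y \<le> normal_tail x"
proof -
  interpret N: prob_space std_normal_distribution by (rule prob_space_normal_density) simp
  assume "x \<le> y" then show ?thesis unfolding normal_tail_def by (intro N.finite_measure_mono) auto
qed

lemma normal_tail_lipschitz: "x \<le> y \<Longrightarrow> normal_tail x \<le> normal_tail y + (y - x)"
proof (cases "x = y")
  case False
  assume "x \<le> y"
  then have "x < y" using False by simp
  then obtain z where "normal_tail y - normal_tail x = (y - x) * (- std_normal_density z)"
    using MVT2[of x y normal_tail "\<lambda>x. - std_normal_density x"] DERIV_normal_tail by auto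
  moreover have "(y - x) * std_normal_density z \<le> (y - x) * 1"
    using \<open>x < y\<close> std_normal_density_le_1 by (intro mult_left_mono) auto
  ultimately show ?thesis by simp
qed simp

lemma normal_tail_le_add: "normal_tail x \<le> normal_tail y + \<bar>y - x\<bar>"
  using normal_tail_lipschitz[of x y] normal_tail_antimono[of y x] by (cases "x \<le> y") auto

text \<open>The product of x and the density is the second derivative of the tail. From exp(u) \<ge>
  1 + u with u = x^2 / 2 one gets x^2 exp(-x^2 / 2) \<le> 2, and 1 / sqrt(2 pi) \<le> 1/2 then makes
  x^2 times the density at most 1.\<close>

lemma std_normal_times_le:
  assumes "0 < b" "b \<le> x"
  shows "x * std_normal_density x \<le> 1 / b"
proof -
  have x: "0 < x" using assms by simp
  have "x\<^sup>2 / 2 \<le> exp (x\<^sup>2 / 2) - 1" using exp_ge_add_one_self[of "x\<^sup>2/2"] by linarith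
  then have 1: "x\<^sup>2 * exp (- x\<^sup>2 / 2) \<le> 2"
    by (simp add: exp_minus field_simps)
  have "2 \<le> sqrt (2 * pi)" using pi_ge_two by (intro real_le_rsqrt) simp
  then have 2: "1 / sqrt (2 * pi) \<le> 1 / 2" by (intro divide_left_mono) auto
  have "x\<^sup>2 * std_normal_density x = (1 / sqrt (2 * pi)) * (x\<^sup>2 * exp (- x\<^sup>2 / 2))"
    by (simp add: std_normal_density_def)
  also have "\<dots> \<le> (1 / 2) * 2" using 1 2 by (intro mult_mono) auto
  finally have "x\<^sup>2 * std_normal_density x \<le> 1" by simp
  then have "x * std_normal_density x \<le> 1 / x" using x by (simp add: field_simps power2_eq_square)
  also have "\<dots> \<le> 1 / b" using assms by (intro divide_left_mono) auto
  finally show ?thesis .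
qed

lemma DERIV_std_normal: "((\<lambda>x. - std_normal_density x) has_real_derivative x * std_normal_density x) (at x)"
proof -
  define c where "c = 1 / sqrt (2 * pi)"
  have "std_normal_density = (\<lambda>x. c * exp (- x\<^sup>2 / 2))" by (auto simp: c_def std_normal_density_def)
  then show ?thesis by (auto intro!: derivative_eq_intros)
qed

text \<open>In the Taylor expansions at m in the directions t and -t the linear terms cancel. The
  remainders are evaluated at points above m / 2, where the second derivative is at most 2 /
  m.\<close>

lemma normal_tail_second_order:
  assumes m: "0 < m" and t: "\<bar>t\<bar> \<le> m / 2"
  shows "(normal_tail (m + t) + normal_tail (m - t)) / 2 \<le> normal_tail m + t\<^sup>2 / m"
proof -
  have pos: "(normal_tail (m + t) + normal_tail (m - t)) / 2 \<le> normal_tail m + t\<^sup>2 / m" if t: "0 < t" "t \<le> m / 2" for t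
  proof -
    define D where "D i = (if i = 0 then normal_tail else if i = 1 then (\<lambda>x. - std_normal_density x) else (\<lambda>x. x * std_normal_density x))" for i :: nat
    have der: "\<forall>i x. i < 2 \<and> m - t \<le> x \<and> x \<le> m + t \<longrightarrow> DERIV (D i) x :> D (Suc i) x"
      by (auto simp: D_def less_2_cases_iff DERIV_normal_tail DERIV_std_normal)
    obtain x where x: "m < x" "x < m + t" "normal_tail (m + t) = (\<Sum>i<2. (D i m / fact i) * (m + t - m)^i) + (D 2 x / fact 2) * (m + t - m)^2"
      using Taylor_up[of 2 D normal_tail "m - t" "m + t" m] der t m by (auto simp: D_def)
    obtain y where y: "m - t < y" "y < m" "normal_tail (m - t) = (\<Sum>i<2. (D i m / fact i) * (m - t - m)^i) + (D 2 y / fact 2) * (m - t - m)^2"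
      using Taylor_down[of 2 D normal_tail "m - t" "m + t" m] der t m by (auto simp: D_def)
    have "x * std_normal_density x \<le> 1 / (m / 2)" "y * std_normal_density y \<le> 1 / (m / 2)"
      using x y t m by (intro std_normal_times_le; simp)+
    then have "D 2 x \<le> 2 / m" "D 2 y \<le> 2 / m" by (auto simp: D_def)
    then have "(D 2 x + D 2 y) / 4 * t\<^sup>2 \<le> (1 / m) * t\<^sup>2" by (intro mult_right_mono) auto
    moreover have "(normal_tail (m + t) + normal_tail (m - t)) / 2 = normal_tail m + (D 2 x + D 2 y) / 4 * t\<^sup>2"
      using x(3) y(3) by (simp add: numeral_2_eq_2 D_def field_simps)
    moreover have "t\<^sup>2 / m = (1 / m) * t\<^sup>2" by simp
    ultimately show ?thesis by linarith
  qed
  consider "t = 0" | "t > 0" | "t < 0" by linarith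
  then show ?thesis
  proof cases
    case 1 then show ?thesis by simp
  next
    case 2 then show ?thesis using pos t by simp
  next
    case 3 then show ?thesis using pos[of "-t"] t by (simp add: add.commute)
  qed
qed

text \<open>Here \<open>D\<close> is the truncated distance, \<open>E\<close> the estimation error and \<open>\<rho>\<close> the bias level. The Lipschitz bound for the tail
  suffices unless \<open>\<rho>\<close> and \<open>E\<close> are small compared with \<open>\<delta>\<close>; in that case \<open>a\<close> and \<open>a'\<close> are of order \<open>\<delta>\<close> and the
  first-order effect of \<open>a - a'\<close> cancels in the average.\<close>

lemma excess_risk_scalar:
  fixes a a' \<delta> D p E \<rho> :: real
  assumes p: "a + a' = p" and E: "\<bar>a - a'\<bar> \<le> E" and pD: "\<bar>p\<bar> \<le> D" and Dd: "D \<le> \<delta>"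
    and bias: "\<delta>\<^sup>2 - D\<^sup>2 \<le> 4 * \<rho>\<^sup>2" and DE: "D * (D - p) \<le> 2 * E\<^sup>2" and \<rho>: "\<rho> > 0"
  shows "(normal_tail a + normal_tail a') / 2 - normal_tail (\<delta> / 2) \<le> 100 * ((\<rho>\<^sup>2 + E\<^sup>2) / max \<delta> \<rho>)"
proof -
  \<comment> \<open>Midpoint and half-difference of a and a', so that the two tails are taken
    symmetrically about m.\<close>
  define m where "m = p / 2"
  define t where "t = (a - a') / 2"
  have a: "a = m + t" "a' = m - t" using p by (auto simp: m_def t_def field_simps)
  have tE: "\<bar>t\<bar> \<le> E / 2" using E by (simp add: t_def)
  have E0: "0 \<le> E" using E by linarith
  have D0: "0 \<le> D" using pD by linarith
  have md: "m \<le> \<delta> / 2" "- \<delta> / 2 \<le> m" using pD Dd by (auto simp: m_def)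
  have Qm: "normal_tail m \<le> normal_tail (\<delta> / 2) + (\<delta> / 2 - m)"
    using normal_tail_lipschitz[OF md(1)] by simp
  \<comment> \<open>The crude bound, good enough as long as \<delta>^2 is at most of order \<rho>^2
    + E^2.\<close>
  have lip: "(normal_tail a + normal_tail a') / 2 - normal_tail (\<delta> / 2) \<le> \<delta> + E"
  proof -
    have "normal_tail a \<le> normal_tail m + \<bar>t\<bar>" "normal_tail a' \<le> normal_tail m + \<bar>t\<bar>"
      using normal_tail_le_add[of a m] normal_tail_le_add[of a' m] by (auto simp: a)
    then have "(normal_tail a + normal_tail a') / 2 \<le> normal_tail m + E / 2" using tE by simp
    also have "\<dots> \<le> (normal_tail (\<delta> / 2) + (\<delta> / 2 - m)) + E / 2" using Qm by (rule add_right_mono)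
    also have "\<dots> \<le> (normal_tail (\<delta> / 2) + \<delta>) + E"
      using md E0 by (intro add_mono order_refl) auto
    finally show ?thesis by (simp add: algebra_simps)
  qed
  define z where "z = \<rho>\<^sup>2 + E\<^sup>2"
  have z0: "0 < z" using \<rho> by (simp add: z_def add_pos_nonneg)
  show ?thesis
  proof (cases "\<delta> \<le> \<rho>")
    case True
    have "2 * (\<rho> * E) \<le> z" using sum_squares_bound[of \<rho> E] by (simp add: z_def)
    moreover have "\<rho> * \<rho> \<le> z" by (simp add: z_def power2_eq_square)
    ultimately have "\<rho> * (\<rho> + E) \<le> 2 * z" using z0 by (simp add: algebra_simps)
    then have "\<rho> + E \<le> 2 * (z / \<rho>)" using \<rho> by (simp add: field_simps)
    also have "\<dots> \<le> 100 * (z / \<rho>)" using z0 \<rho> by (simp add: field_simps)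
    finally show ?thesis using lip True by (simp add: z_def max_absorb2)
  next
    case False
    then have d: "0 < \<delta>" "max \<delta> \<rho> = \<delta>" using \<rho> by auto
    show ?thesis
    proof (cases "\<delta>\<^sup>2 \<le> 64 * z")
      case True
      have "2 * (\<delta> * E) \<le> \<delta>\<^sup>2 + E\<^sup>2" using sum_squares_bound[of \<delta> E] by simp
      moreover have "E\<^sup>2 \<le> z" by (simp add: z_def)
      ultimately have "\<delta> * (\<delta> + E) \<le> \<delta>\<^sup>2 + (\<delta>\<^sup>2 + z) / 2" by (simp add: power2_eq_square algebra_simps)
      \<comment> \<open>With \<delta>^2 \<le> 64 z the left side is at most 64 z + 32.5 z; this case
        is the origin of the constant 100.\<close>
      also have "\<dots> \<le> 100 * z" using True z0 unfolding add_divide_distrib by linarith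
      finally have r: "\<delta> + E \<le> 100 * (z / \<delta>)" using d by (simp add: field_simps)
      show ?thesis using lip r d by (simp add: z_def)
    next
      case False
      \<comment> \<open>Both errors are now small against \<delta>: the threshold 64 gives D \<ge> 3
        \<delta> / 4 and E \<le> \<delta> / 8, hence m \<ge> \<delta> / 4 and |t| \<le> m / 2, as
        the second-order bound demands.\<close>
      then have zs: "z < \<delta>\<^sup>2 / 64" by simp
      have "4 * \<rho>\<^sup>2 \<le> \<delta>\<^sup>2 / 16" using zs by (simp add: z_def) (smt (verit) zero_le_power2)
      moreover have "(\<delta> * 3/4)\<^sup>2 = 9 / 16 * \<delta>\<^sup>2" by (simp add: power2_eq_square)
      ultimately have "(\<delta> * 3/4)\<^sup>2 \<le> D\<^sup>2" using bias zero_le_power2[of \<delta>] by linarith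
      then have D34: "\<delta> * 3 / 4 \<le> D" using D0 power2_le_imp_le by blast
      have E8: "E\<^sup>2 \<le> (\<delta> / 8)\<^sup>2" using zs by (simp add: z_def power2_eq_square) (smt (verit) zero_le_square)
      then have E8': "E \<le> \<delta> / 8" using d by (intro power2_le_imp_le[OF E8]) auto
      have "(\<delta> * 3 / 4) * (D - p) \<le> D * (D - p)" using D34 pD by (intro mult_right_mono) auto
      then have Dp: "\<delta> * (D - p) \<le> 8 / 3 * E\<^sup>2" using DE by simp
      then have "\<delta> * (D - p) \<le> \<delta> * (\<delta> / 24)" using E8 by (simp add: power2_eq_square)
      then have "D - p \<le> \<delta> / 24" using d by simp
      then have mm: "\<delta> / 4 \<le> m" using D34 d by (simp add: m_def)
      have m0: "0 < m" using mm d by linarith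
      have "(normal_tail a + normal_tail a') / 2 \<le> normal_tail m + t\<^sup>2 / m"
        unfolding a using mm tE E8' m0 by (intro normal_tail_second_order) auto
      moreover have "t\<^sup>2 / m \<le> E\<^sup>2 / \<delta>"
      proof -
        have "t\<^sup>2 \<le> (E / 2)\<^sup>2" using tE E0 by (subst abs_le_square_iff[symmetric]) auto
        then have "t\<^sup>2 / m \<le> (E / 2)\<^sup>2 / (\<delta> / 4)" using mm d by (intro frac_le) auto
        then show ?thesis by (simp add: power2_eq_square)
      qed
      moreover have "\<delta> / 2 - m \<le> 4 * (z / \<delta>)"
      proof -
        \<comment> \<open>Factoring \<delta>^2 - D^2 shows that the truncation loss \<delta> - D is
          of order \<rho>^2 / \<delta>.\<close>
        have "\<delta> * (\<delta> - D) \<le> (\<delta> + D) * (\<delta> - D)" using D0 Dd by (intro mult_right_mono) auto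
        also have "\<dots> \<le> 4 * \<rho>\<^sup>2" using bias by (simp add: power2_eq_square algebra_simps)
        finally have "\<delta> * (\<delta> - p) \<le> 4 * \<rho>\<^sup>2 + 8 / 3 * E\<^sup>2" using Dp by (simp add: algebra_simps)
        also have "\<dots> \<le> 4 * z" by (simp add: z_def)
        finally have "\<delta> - p \<le> 4 * (z / \<delta>)" using d by (simp add: field_simps)
        then show ?thesis using pD Dd by (simp add: m_def)
      qed
      moreover have "E\<^sup>2 / \<delta> \<le> z / \<delta>" using d by (intro divide_right_mono) (auto simp: z_def)
      ultimately have "(normal_tail a + normal_tail a') / 2 - normal_tail (\<delta> / 2) \<le> 5 * (z / \<delta>)" using Qm unfolding add_divide_distrib by linarith
      also have "\<dots> \<le> 100 * (z / \<delta>)" using z0 d by (simp add: field_simps)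
      finally show ?thesis by (simp add: d z_def)
    qed
  qed
qed

section \<open>Total variation between shifted Brownian paths\<close>

text \<open>Induction over the generated sigma-algebra: for a countable union the remainder is cut
  off by continuity, and the finitely many sets left are approximated one by one.
  \<open>\<nu>\<close> is an abstract set function because it is applied to the sum of two laws, so
  that one approximating set serves both.\<close>

lemma sigma_sets_approx:
  fixes \<nu> :: "'a set \<Rightarrow> real"
  assumes G: "G \<subseteq> \<A>" and GP: "G \<subseteq> Pow \<Omega>" and AS: "\<A> \<subseteq> sigma_sets \<Omega> G"
    and emp: "{} \<in> \<A>" and compl: "\<And>A. A \<in> \<A> \<Longrightarrow> \<Omega> - A \<in> \<A>" and un: "\<And>A B. A \<in> \<A> \<Longrightarrow> B \<in> \<A> \<Longrightarrow> A \<union> B \<in> \<A>"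
    and mono: "\<And>A B. A \<in> sigma_sets \<Omega> G \<Longrightarrow> B \<in> sigma_sets \<Omega> G \<Longrightarrow> A \<subseteq> B \<Longrightarrow> \<nu> A \<le> \<nu> B"
    and sub: "\<And>A B. A \<in> sigma_sets \<Omega> G \<Longrightarrow> B \<in> sigma_sets \<Omega> G \<Longrightarrow> \<nu> (A \<union> B) \<le> \<nu> A + \<nu> B"
    and nemp: "\<nu> {} = 0"
    and cont: "\<And>A. range A \<subseteq> sigma_sets \<Omega> G \<Longrightarrow> (\<lambda>n. \<nu> ((\<Union>i. A i) - (\<Union>i<n. A i))) \<longlonglongrightarrow> 0"
    and A: "A \<in> sigma_sets \<Omega> G" and e: "e > 0"
  shows "\<exists>B\<in>\<A>. \<nu> ((A - B) \<union> (B - A)) < e"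
proof -
  interpret sigma_algebra \<Omega> "sigma_sets \<Omega> G" by (rule sigma_algebra_sigma_sets[OF GP])
  have AO: "B \<subseteq> \<Omega>" if "B \<in> \<A>" for B using that AS sets_into_space by blast
  show ?thesis using A e
  proof (induction arbitrary: e rule: sigma_sets.induct)
    case (Basic a)
    then show ?case using G nemp by (intro bexI[of _ a]) auto
  next
    case Empty
    then show ?case using emp nemp by (intro bexI[of _ "{}"]) auto
  next
    case (Compl a)
    then obtain B where B: "B \<in> \<A>" "\<nu> ((a - B) \<union> (B - a)) < e" by blast
    have "a \<subseteq> \<Omega>" using Compl sets_into_space by blast
    then have "((\<Omega> - a) - (\<Omega> - B)) \<union> ((\<Omega> - B) - (\<Omega> - a)) = (a - B) \<union> (B - a)" using AO[OF B(1)] by blast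
    then show ?case using B compl by (intro bexI[of _ "\<Omega> - B"]) auto
  next
    case (Union a)
    have ra: "range a \<subseteq> sigma_sets \<Omega> G" using Union by auto
    from cont[OF ra] \<open>e > 0\<close> have "\<forall>\<^sub>F n in sequentially. \<nu> ((\<Union>i. a i) - (\<Union>i<n. a i)) < e / 2"
      by (intro order_tendstoD(2)) auto
    then obtain n where n: "\<nu> ((\<Union>i. a i) - (\<Union>i<n. a i)) < e / 2" by (auto simp: eventually_sequentially)
    \<comment> \<open>Errors of this size for n sets add up to at most e / 2; \<open>Suc n\<close>
      avoids a division by 0.\<close>
    have pos: "e / (2 * real (Suc n)) > 0" using \<open>e > 0\<close> by simp
    obtain B where B: "\<And>i. B i \<in> \<A>" "\<And>i. \<nu> ((a i - B i) \<union> (B i - a i)) < e / (2 * real (Suc n))"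
      using Union.IH[OF pos] by metis
    have SB: "B i \<in> sigma_sets \<Omega> G" "a i \<in> sigma_sets \<Omega> G" for i using B(1) AS ra by auto
    have UB: "(\<Union>i<m. B i) \<in> \<A>" for m
    proof (induction m)
      case (Suc m) then show ?case using un[OF Suc B(1)[of m]] by (simp add: lessThan_Suc Un_commute)
    qed (simp add: emp)
    have US: "\<nu> (\<Union>i<m. (a i - B i) \<union> (B i - a i)) \<le> (\<Sum>i<m. \<nu> ((a i - B i) \<union> (B i - a i)))" for m
    proof (induction m)
      case (Suc m)
      have "(\<Union>i<Suc m. (a i - B i) \<union> (B i - a i)) = (\<Union>i<m. (a i - B i) \<union> (B i - a i)) \<union> ((a m - B m) \<union> (B m - a m))"
        by (auto simp: lessThan_Suc)
      also have "\<nu> \<dots> \<le> \<nu> (\<Union>i<m. (a i - B i) \<union> (B i - a i)) + \<nu> ((a m - B m) \<union> (B m - a m))"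
        using SB by (intro sub finite_UN ballI Un Diff finite_lessThan)
      finally show ?case using Suc by simp
    qed (simp add: nemp)
    have "(\<Sum>i<n. \<nu> ((a i - B i) \<union> (B i - a i))) \<le> (\<Sum>i<n. e / (2 * real (Suc n)))"
      using B(2) by (intro sum_mono) (auto intro: less_imp_le)
    also have "\<dots> \<le> e / 2" using \<open>e > 0\<close> by (simp add: field_simps)
    finally have s: "\<nu> (\<Union>i<n. (a i - B i) \<union> (B i - a i)) \<le> e / 2" using US[of n] by simp
    have inS: "(\<Union>i. a i) \<in> sigma_sets \<Omega> G" "(\<Union>i<n. a i) \<in> sigma_sets \<Omega> G" "(\<Union>i<n. B i) \<in> sigma_sets \<Omega> G"
      "(\<Union>i<n. (a i - B i) \<union> (B i - a i)) \<in> sigma_sets \<Omega> G"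
      using SB ra by (auto intro!: finite_UN countable_nat_UN Un Diff simp del: UN_simps)
    have "\<nu> (((\<Union>i. a i) - (\<Union>i<n. B i)) \<union> ((\<Union>i<n. B i) - (\<Union>i. a i)))
      \<le> \<nu> (((\<Union>i. a i) - (\<Union>i<n. a i)) \<union> (\<Union>i<n. (a i - B i) \<union> (B i - a i)))"
    proof (rule mono)
      show "((\<Union>i. a i) - (\<Union>i<n. B i)) \<union> ((\<Union>i<n. B i) - (\<Union>i. a i)) \<in> sigma_sets \<Omega> G"
        using inS by (intro Un Diff)
      show "((\<Union>i. a i) - (\<Union>i<n. a i)) \<union> (\<Union>i<n. (a i - B i) \<union> (B i - a i)) \<in> sigma_sets \<Omega> G"
        using inS by (intro Un Diff)
      show "((\<Union>i. a i) - (\<Union>i<n. B i)) \<union> ((\<Union>i<n. B i) - (\<Union>i. a i)) \<subseteq> ((\<Union>i. a i) - (\<Union>i<n. a i)) \<union> (\<Union>i<n. (a i - B i) \<union> (B i - a i))"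
        by blast
    qed
    also have "\<dots> \<le> \<nu> ((\<Union>i. a i) - (\<Union>i<n. a i)) + \<nu> (\<Union>i<n. (a i - B i) \<union> (B i - a i))"
 using inS by (intro sub Diff)
    also have "\<dots> < e" using n s by simp
    finally show ?case using UB by blast
  qed
qed

text \<open>Each coordinate has likelihood ratio exp(a x / \<sigma>^2 - a^2 / (2 \<sigma>^2)), found
  by completing the square. A product measure is determined by rectangles, and over these the
  integral of a product of one-dimensional functions factorises.\<close>

lemma (in prob_space) gaussian_shift_density:
  fixes U :: "nat \<Rightarrow> 'a \<Rightarrow> real"
  assumes I: "finite I" "I \<noteq> {}"
    and ind: "indep_vars (\<lambda>_. borel) U I"
    and U: "\<And>i. i \<in> I \<Longrightarrow> distributed M lborel (U i) (normal_density 0 (\<sigma> i))" and s: "\<And>i. i \<in> I \<Longrightarrow> \<sigma> i > 0"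
  shows "distr M (\<Pi>\<^sub>M i\<in>I. borel) (\<lambda>\<omega>. \<lambda>i\<in>I. U i \<omega> + a i) =
    density (distr M (\<Pi>\<^sub>M i\<in>I. borel) (\<lambda>\<omega>. \<lambda>i\<in>I. U i \<omega>))
      (\<lambda>x. \<Prod>i\<in>I. ennreal (exp (a i * x i / (\<sigma> i)\<^sup>2 - (a i)\<^sup>2 / (2 * (\<sigma> i)\<^sup>2))))"
proof -
  have Um[measurable]: "U i \<in> borel_measurable M" if "i \<in> I" for i
    using distributed_measurable[OF U[OF that]] by simp
  \<comment> \<open>\<open>product_prob_space\<close> asks for a probability measure at every index;
    the point mass at 0 is a filler outside I, where nothing is known about U.\<close>
  let ?N = "\<lambda>i. if i \<in> I then distr M borel (U i) else return borel 0"
  let ?Na = "\<lambda>i. if i \<in> I then distr M borel (\<lambda>\<omega>. U i \<omega> + a i) else return borel 0"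
  let ?L = "\<lambda>i x. ennreal (exp (a i * x / (\<sigma> i)\<^sup>2 - (a i)\<^sup>2 / (2 * (\<sigma> i)\<^sup>2)))"
  have pN: "prob_space (?N i)" "prob_space (?Na i)" for i
    by (auto intro!: prob_space_distr prob_space_return)
  interpret N: product_prob_space ?N I
    by (intro product_prob_spaceI pN)
  interpret Na: product_prob_space ?Na I
    by (intro product_prob_spaceI pN)
  have "distr M (\<Pi>\<^sub>M i\<in>I. borel) (\<lambda>\<omega>. \<lambda>i\<in>I. U i \<omega>) = (\<Pi>\<^sub>M i\<in>I. distr M borel (U i))"
    using ind by (subst (asm) indep_vars_iff_distr_eq_PiM'[OF I(2)]) auto
  also have "\<dots> = PiM I ?N" by (intro PiM_cong) auto
  finally have dN: "distr M (\<Pi>\<^sub>M i\<in>I. borel) (\<lambda>\<omega>. \<lambda>i\<in>I. U i \<omega>) = PiM I ?N" .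
  have "indep_vars (\<lambda>_. borel) (\<lambda>i \<omega>. U i \<omega> + a i) I"
    by (rule indep_vars_compose2[OF ind, of "\<lambda>i x. x + a i"]) auto
  then have "distr M (\<Pi>\<^sub>M i\<in>I. borel) (\<lambda>\<omega>. \<lambda>i\<in>I. U i \<omega> + a i) = (\<Pi>\<^sub>M i\<in>I. distr M borel (\<lambda>\<omega>. U i \<omega> + a i))"
    by (subst (asm) indep_vars_iff_distr_eq_PiM'[OF I(2)]) auto
  also have "\<dots> = PiM I ?Na" by (intro PiM_cong) auto
  finally have dNa: "distr M (\<Pi>\<^sub>M i\<in>I. borel) (\<lambda>\<omega>. \<lambda>i\<in>I. U i \<omega> + a i) = PiM I ?Na" .
  have setsN: "sets (PiM I ?N) = sets (PiM I (\<lambda>_. borel))" "sets (PiM I ?Na) = sets (PiM I (\<lambda>_. borel))"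
    by (auto intro!: sets_PiM_cong)
  have one: "(\<integral>\<^sup>+x. ?L i x * indicator A x \<partial>distr M borel (U i)) = emeasure (distr M borel (\<lambda>\<omega>. U i \<omega> + a i)) A"
    if i: "i \<in> I" and A: "A \<in> sets borel" for i A
  proof -
    have Ua: "distributed M lborel (\<lambda>\<omega>. a i + 1 * U i \<omega>) (normal_density (a i + 1 * 0) (\<bar>1\<bar> * \<sigma> i))"
      by (rule normal_density_affine[OF U[OF i] s[OF i]]) simp
    have d0: "distr M borel (U i) = density lborel (normal_density 0 (\<sigma> i))"
      using U[OF i] distr_cong[of M M borel lborel "U i" "U i"] unfolding distributed_def by simp
    have d1: "distr M borel (\<lambda>\<omega>. U i \<omega> + a i) = density lborel (normal_density (a i) (\<sigma> i))"
      using Ua distr_cong[of M M borel lborel "\<lambda>\<omega>. U i \<omega> + a i" "\<lambda>\<omega>. a i + 1 * U i \<omega>"] unfolding distributed_def by simp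
    have nd: "normal_density (a i) (\<sigma> i) x = normal_density 0 (\<sigma> i) x * exp (a i * x / (\<sigma> i)\<^sup>2 - (a i)\<^sup>2 / (2 * (\<sigma> i)\<^sup>2))" for x
    proof -
      have "- (x - a i)\<^sup>2 / (2 * (\<sigma> i)\<^sup>2) = - (x - 0)\<^sup>2 / (2 * (\<sigma> i)\<^sup>2) + (a i * x / (\<sigma> i)\<^sup>2 - (a i)\<^sup>2 / (2 * (\<sigma> i)\<^sup>2))"
        using s[OF i] by (simp add: field_simps power2_eq_square)
      then show ?thesis by (simp only: normal_density_def exp_add mult.assoc)
    qed
    have "(\<integral>\<^sup>+x. ?L i x * indicator A x \<partial>distr M borel (U i)) = (\<integral>\<^sup>+x. ennreal (normal_density 0 (\<sigma> i) x) * (?L i x * indicator A x) \<partial>lborel)"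
      unfolding d0 using A by (subst nn_integral_density) auto
    also have "\<dots> = (\<integral>\<^sup>+x. ennreal (normal_density (a i) (\<sigma> i) x) * indicator A x \<partial>lborel)"
      by (intro nn_integral_cong) (simp add: nd ennreal_mult mult.assoc)
    also have "\<dots> = emeasure (distr M borel (\<lambda>\<omega>. U i \<omega> + a i)) A"
      unfolding d1 using A by (subst emeasure_density) auto
    finally show ?thesis .
  qed
  have Lm: "(\<lambda>x. \<Prod>i\<in>I. ?L i (x i)) \<in> borel_measurable (PiM I ?N)"
    unfolding measurable_cong_sets[OF setsN(1) refl] by measurable
  have "density (PiM I ?N) (\<lambda>x. \<Prod>i\<in>I. ?L i (x i)) = PiM I ?Na"
  proof (rule Na.PiM_eqI[OF I(1)])
    show "sets (density (PiM I ?N) (\<lambda>x. \<Prod>i\<in>I. ?L i (x i))) = PiM I ?Na" using setsN by simp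
    fix A assume A: "\<And>i. i \<in> I \<Longrightarrow> A i \<in> sets (?Na i)"
    then have Ab: "A i \<in> sets borel" if "i \<in> I" for i using that by fastforce
    have PA: "Pi\<^sub>E I A \<in> sets (PiM I ?N)" using I Ab by (intro sets_PiM_I_finite) auto
    have "emeasure (density (PiM I ?N) (\<lambda>x. \<Prod>i\<in>I. ?L i (x i))) (Pi\<^sub>E I A) =
      (\<integral>\<^sup>+x. (\<Prod>i\<in>I. ?L i (x i)) * indicator (Pi\<^sub>E I A) x \<partial>PiM I ?N)"
      by (rule emeasure_density[OF Lm PA])
    also have "\<dots> = (\<integral>\<^sup>+x. (\<Prod>i\<in>I. ?L i (x i) * indicator (A i) (x i)) \<partial>PiM I ?N)"
    proof (rule nn_integral_cong)
      fix x assume "x \<in> space (PiM I ?N)"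
      then have "x \<in> extensional I" by (auto simp: space_PiM PiE_def)
      then have "indicator (Pi\<^sub>E I A) x = (\<Prod>i\<in>I. indicator (A i) (x i) :: ennreal)"
        using I by (auto simp: indicator_def PiE_def Pi_iff prod_zero_iff)
      then show "(\<Prod>i\<in>I. ?L i (x i)) * indicator (Pi\<^sub>E I A) x = (\<Prod>i\<in>I. ?L i (x i) * indicator (A i) (x i))"
        by (simp add: prod.distrib)
    qed
    also have "\<dots> = (\<Prod>i\<in>I. \<integral>\<^sup>+x. ?L i x * indicator (A i) x \<partial>?N i)"
      using I Ab by (intro N.product_nn_integral_prod) auto
    also have "\<dots> = (\<Prod>i\<in>I. emeasure (?Na i) (A i))"
      using Ab by (intro prod.cong refl) (simp add: one)
    finally show "emeasure (density (PiM I ?N) (\<lambda>x. \<Prod>i\<in>I. ?L i (x i))) (Pi\<^sub>E I A) = (\<Prod>i\<in>I. emeasure (?Na i) (A i))" .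
  qed
  then show ?thesis unfolding dN dNa by simp
qed

text \<open>By the Neyman-Pearson argument the difference of the two laws is largest on the set
  where the likelihood ratio is at least 1. For Gaussian shifts this set is a half-space, so both of
  its probabilities are normal tails.\<close>

lemma (in prob_space) gaussian_shift_tv:
  fixes U :: "nat \<Rightarrow> 'a \<Rightarrow> real"
  assumes I: "finite I"
    and ind: "indep_vars (\<lambda>_. borel) U I"
    and U: "\<And>i. i \<in> I \<Longrightarrow> distributed M lborel (U i) (normal_density 0 (\<sigma> i))" and s: "\<And>i. i \<in> I \<Longrightarrow> \<sigma> i > 0"
    and B: "B \<in> sets (\<Pi>\<^sub>M i\<in>I. borel)"
  shows "prob {\<omega>\<in>space M. (\<lambda>i\<in>I. U i \<omega> + a i) \<in> B} - prob {\<omega>\<in>space M. (\<lambda>i\<in>I. U i \<omega>) \<in> B}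
    \<le> 1 - 2 * normal_tail (sqrt (\<Sum>i\<in>I. (a i)\<^sup>2 / (\<sigma> i)\<^sup>2) / 2)"
proof -
  have Um[measurable]: "U i \<in> borel_measurable M" if "i \<in> I" for i
    using distributed_measurable[OF U[OF that]] by simp
  define v where "v = (\<Sum>i\<in>I. (a i)\<^sup>2 / (\<sigma> i)\<^sup>2)"
  have v0: "0 \<le> v" unfolding v_def by (intro sum_nonneg) auto
  show ?thesis
  proof (cases "v = 0")
    \<comment> \<open>Here there is no shift. The case includes an empty I, which the product
      construction excludes.\<close>
    case True
    then have "\<forall>i\<in>I. (a i)\<^sup>2 / (\<sigma> i)\<^sup>2 = 0"
      using I unfolding v_def by (subst (asm) sum_nonneg_eq_0_iff) auto
    then have a0: "a i = 0" if "i \<in> I" for i using that s[OF that] by (auto dest!: bspec[OF _ that])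
    then have "(\<lambda>i\<in>I. U i \<omega> + a i) = (\<lambda>i\<in>I. U i \<omega>)" for \<omega> by (intro restrict_ext) auto
    moreover have "normal_tail 0 = 1 / 2" using normal_tail_minus[of 0] by simp
    ultimately show ?thesis using True by (simp add: v_def[symmetric])
  next
    case False
    then have v: "v > 0" using v0 by simp
    then have "I \<noteq> {}" by (auto simp: v_def)
    let ?P = "\<Pi>\<^sub>M i\<in>I. (borel :: real measure)"
    define D where "D = distr M ?P (\<lambda>\<omega>. \<lambda>i\<in>I. U i \<omega>)"
    define Da where "Da = distr M ?P (\<lambda>\<omega>. \<lambda>i\<in>I. U i \<omega> + a i)"
    define c where "c i = a i / (\<sigma> i)\<^sup>2" for i
    define l where "l x = exp ((\<Sum>i\<in>I. c i * x i) - v / 2)" for x :: "nat \<Rightarrow> real"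
    have um: "(\<lambda>\<omega>. \<lambda>i\<in>I. U i \<omega>) \<in> measurable M ?P" "(\<lambda>\<omega>. \<lambda>i\<in>I. U i \<omega> + a i) \<in> measurable M ?P" by measurable
    interpret D: prob_space D unfolding D_def by (rule prob_space_distr) fact
    interpret Da: prob_space Da unfolding Da_def by (rule prob_space_distr) fact
    have [simp]: "sets D = sets ?P" "sets Da = sets ?P" "space D = space ?P" by (auto simp: D_def Da_def)
    have lm[measurable]: "l \<in> borel_measurable ?P" unfolding l_def by measurable
    have lmD: "l \<in> borel_measurable D" by (simp add: measurable_cong_sets[OF \<open>sets D = sets ?P\<close> refl])
    have lprod: "(\<Prod>i\<in>I. ennreal (exp (a i * x i / (\<sigma> i)\<^sup>2 - (a i)\<^sup>2 / (2 * (\<sigma> i)\<^sup>2)))) = ennreal (l x)" for x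
    proof -
      have "(\<Sum>i\<in>I. a i * x i / (\<sigma> i)\<^sup>2 - (a i)\<^sup>2 / (2 * (\<sigma> i)\<^sup>2)) = (\<Sum>i\<in>I. c i * x i) - v / 2"
        by (simp add: v_def c_def sum_subtractf sum_divide_distrib mult.commute)
      then show ?thesis using I by (simp add: prod_ennreal l_def exp_sum[symmetric])
    qed
    have DaL: "Da = density D (\<lambda>x. ennreal (l x))"
      unfolding D_def Da_def using gaussian_shift_density[OF I \<open>I \<noteq> {}\<close> ind U s, of a] by (simp add: lprod)
    have intl: "integrable D l"
    proof (rule integrableI_bounded[OF lmD])
      have "emeasure Da (space D) = (\<integral>\<^sup>+x. ennreal (l x) * indicator (space D) x \<partial>D)"
        unfolding DaL using lmD by (intro emeasure_density) auto
      also have "\<dots> = (\<integral>\<^sup>+x. ennreal (l x) \<partial>D)" by (intro nn_integral_cong) auto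
      finally have "(\<integral>\<^sup>+x. ennreal (l x) \<partial>D) = emeasure Da (space Da)" by (simp add: D_def Da_def)
      also have "\<dots> = 1" by (rule Da.emeasure_space_1)
      finally show "(\<integral>\<^sup>+x. ennreal (norm (l x)) \<partial>D) < \<infinity>" by (simp add: l_def)
    qed
    have ma: "measure Da A = (\<integral>x. l x * indicat_real A x \<partial>D)" "measure D A = (\<integral>x. indicat_real A x \<partial>D)" "integrable D (\<lambda>x. l x * indicat_real A x)"
      if A: "A \<in> sets ?P" for A
    proof -
      show "integrable D (\<lambda>x. l x * indicat_real A x)"
        using integrable_mult_indicator[OF _ intl, of A] A by (simp add: mult.commute)
      have "measure Da A = (\<integral>x. indicat_real A x \<partial>Da)" using A by simp
      also have "\<dots> = (\<integral>x. l x *\<^sub>R indicat_real A x \<partial>D)"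
        unfolding DaL using A by (intro integral_density lmD borel_measurable_indicator) (auto simp: l_def)
      finally show "measure Da A = (\<integral>x. l x * indicat_real A x \<partial>D)" by simp
      show "measure D A = (\<integral>x. indicat_real A x \<partial>D)" using A by simp
    qed
    define T where "T = {x \<in> space ?P. v / 2 \<le> (\<Sum>i\<in>I. c i * x i)}"
    have T: "T \<in> sets ?P" unfolding T_def by measurable
    have lT: "1 \<le> l x \<longleftrightarrow> x \<in> T" if "x \<in> space ?P" for x using that by (simp add: T_def l_def)
    have "measure Da B - measure D B = (\<integral>x. l x * indicat_real B x - indicat_real B x \<partial>D)"
      using B ma[OF B] by (simp add: D.emeasure_eq_measure)
    also have "\<dots> \<le> (\<integral>x. l x * indicat_real T x - indicat_real T x \<partial>D)"
    proof (rule integral_mono)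
      \<comment> \<open>The factor l - 1 is nonnegative on T and negative off T, so T maximises (l -
        1) times an indicator pointwise.\<close>
      fix x assume "x \<in> space D"
      then have "1 \<le> l x \<longleftrightarrow> x \<in> T" using lT by simp
      then show "l x * indicat_real B x - indicat_real B x \<le> l x * indicat_real T x - indicat_real T x"
        by (auto simp: indicator_def)
    qed (use B T ma(3)[OF B] ma(3)[OF T] in \<open>auto simp: D.emeasure_eq_measure\<close>)
    also have "\<dots> = measure Da T - measure D T"
      using T ma[OF T] by (simp add: D.emeasure_eq_measure)
    finally have le: "measure Da B - measure D B \<le> measure Da T - measure D T" .
    have mD: "measure D A = prob {\<omega>\<in>space M. (\<lambda>i\<in>I. U i \<omega>) \<in> A}" "measure Da A = prob {\<omega>\<in>space M. (\<lambda>i\<in>I. U i \<omega> + a i) \<in> A}" if "A \<in> sets ?P" for A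
      unfolding D_def Da_def using that um by (auto simp: measure_distr vimage_def Int_def conj_commute intro!: arg_cong[where f=prob])
    \<comment> \<open>The linear statistic with coefficients c has variance v, and the shift moves
      its mean from 0 to v (\<open>ca\<close>). The threshold v / 2 is therefore sqrt v / 2 standard
      deviations away from both means.\<close>
    have cs: "(\<Sum>i\<in>I. (c i)\<^sup>2 * (\<sigma> i)\<^sup>2) = v"
      unfolding v_def c_def by (intro sum.cong refl) (use s in \<open>force simp: power2_eq_square field_simps\<close>)
    have tail: "prob {\<omega>\<in>space M. y \<le> (\<Sum>i\<in>I. c i * U i \<omega>)} = normal_tail (y / sqrt v)" for y
    proof (rule prob_ge_of_normal_char[OF _ v])
      show "char (distr M borel (\<lambda>\<omega>. \<Sum>i\<in>I. c i * U i \<omega>)) t = complex_of_real (exp (- (t\<^sup>2 * v) / 2))" for t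
        using char_sum_indep_normal[OF ind U s I, of c t] by (simp add: cs)
    qed auto
    have sp: "(\<lambda>i\<in>I. x i) \<in> space ?P" for x by (simp add: space_PiM)
    have "measure D T = prob {\<omega>\<in>space M. v / 2 \<le> (\<Sum>i\<in>I. c i * U i \<omega>)}"
      unfolding mD(1)[OF T] using sp by (simp add: T_def)
    also have "\<dots> = normal_tail (v / 2 / sqrt v)" by (rule tail)
    also have "v / 2 / sqrt v = sqrt v / 2" using v by (simp add: real_div_sqrt)
    finally have 1: "measure D T = normal_tail (sqrt v / 2)" .
    have ca: "(\<Sum>i\<in>I. c i * a i) = v" unfolding v_def c_def by (simp add: power2_eq_square)
    have "measure Da T = prob {\<omega>\<in>space M. v / 2 \<le> (\<Sum>i\<in>I. c i * (U i \<omega> + a i))}"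
      unfolding mD(2)[OF T] using sp by (simp add: T_def)
    also have "\<dots> = prob {\<omega>\<in>space M. - (v / 2) \<le> (\<Sum>i\<in>I. c i * U i \<omega>)}"
      using ca by (intro arg_cong[where f=prob]) (auto simp: distrib_left sum.distrib)
    also have "\<dots> = normal_tail (- (v / 2) / sqrt v)" by (rule tail)
    also have "- (v / 2) / sqrt v = - (sqrt v / 2)" using v by (simp add: real_div_sqrt)
    finally have 2: "measure Da T = 1 - normal_tail (sqrt v / 2)" by (simp add: normal_tail_minus)
    show ?thesis using le unfolding 1 2 mD[OF B] v_def[symmetric] by simp
  qed
qed

section \<open>From Gaussian vectors to cylinders and to all measurable sets of paths\<close>

lemma finite_set_enum:
  fixes J :: "real set"
  assumes "finite J" "0 \<in> J" "\<And>x. x \<in> J \<Longrightarrow> 0 \<le> x"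
  obtains k t where "t 0 = (0::real)" "J = t ` {..k}" "\<And>i. i < k \<Longrightarrow> t i < t (Suc i)"
proof -
  have "set (sorted_list_of_set J) = J" "sorted_wrt (<) (sorted_list_of_set J)" using assms by auto
  then obtain l where l: "set l = J" "sorted_wrt (<) l" by blast
  define k where "k = length l - 1"
  have lk: "length l = Suc k" using l(1) assms(2) by (cases l) (auto simp: k_def)
  have mono: "l ! i < l ! j" if "i < j" "j < Suc k" for i j
    using sorted_wrt_nth_less[OF l(2)] that lk by simp
  have "set l = (\<lambda>i. l ! i) ` {..<length l}" by (auto simp: set_conv_nth)
  also have "{..<length l} = {..k}" using lk by auto
  finally have im: "J = (\<lambda>i. l ! i) ` {..k}" using l(1) by simp
  obtain i where i: "i \<le> k" "l ! i = 0" using assms(2) unfolding im by auto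
  have "l ! 0 \<in> J" unfolding im by auto
  then have "0 \<le> l ! 0" using assms by auto
  have "i = 0"
  proof (rule ccontr)
    assume "i \<noteq> 0" then show False using mono[of 0 i] i \<open>0 \<le> l ! 0\<close> by auto
  qed
  then show ?thesis using that[of "\<lambda>i. l ! i" k] im i mono by auto
qed

text \<open>The observed path of one class as a map on trajectories, so that observations become
  measurable functions of the driving path.\<close>

definition shift_path :: "(real \<Rightarrow> real) \<Rightarrow> (real \<Rightarrow> real) \<Rightarrow> real \<Rightarrow> real" where
  "shift_path h x = restrict (\<lambda>t. drift h t + x t) {0..1}"

lemma shift_path_measurable [measurable]: "shift_path h \<in> measurable traj_space traj_space"
  unfolding shift_path_def traj_space_def
  by (intro measurable_restrict borel_measurable_add measurable_component_singleton) auto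

context brownian
begin

lemma path_measurable: "(\<lambda>\<omega>. restrict (W \<omega>) {0..1}) \<in> measurable M traj_space"
  unfolding traj_space_def by (intro measurable_restrict W_measurable)

lemma shift_measurable: "(\<lambda>\<omega>. shift_path h (W \<omega>)) \<in> measurable M traj_space"
  unfolding shift_path_def traj_space_def by (intro measurable_restrict borel_measurable_add W_measurable) auto

text \<open>Path values on J are partial sums of increments, so a cylinder is an event about a
  Gaussian vector whose mean consists of drift increments. \<open>gaussian_shift_tv\<close> applies,
  and \<open>sq_drift_increments_le\<close> bounds the shift by the L2 distance, uniformly over all
  grids.\<close>

lemma cylinder_tv:
  assumes f: "sq_integrable unit_leb f" and g: "sq_integrable unit_leb g"
    and J: "finite J" "J \<subseteq> {0..1}" and A: "A \<in> sets (\<Pi>\<^sub>M t\<in>J. borel)"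
  shows "prob {\<omega>\<in>space M. restrict (shift_path f (W \<omega>)) J \<in> A} - prob {\<omega>\<in>space M. restrict (shift_path g (W \<omega>)) J \<in> A}
    \<le> 1 - 2 * normal_tail (sqrt (\<integral>x. (f x - g x)\<^sup>2 \<partial>unit_leb) / 2)"
proof -
  \<comment> \<open>Time 0 joins the grid because values are recovered as sums of increments that
    start from \<open>W \<omega> 0\<close>, which vanishes almost surely.\<close>
  obtain k t where t: "t 0 = 0" "insert 0 J = t ` {..k}" "\<And>i. i < k \<Longrightarrow> t i < t (Suc i)"
  proof (rule finite_set_enum[of "insert 0 J"])
    show "0 \<le> x" if "x \<in> insert 0 J" for x using that J by auto
  qed (use J in auto)
  have tm: "t i \<in> {0..1}" if "i \<le> k" for i
  proof -
    have "t i \<in> insert 0 J" using t(2) that by auto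
    then show ?thesis using J by auto
  qed
  have t01: "0 \<le> t 0" "t k \<le> 1" using t(1) tm[of k] by auto
  define U where "U i \<omega> = W \<omega> (t (Suc i)) - W \<omega> (t i)" for i \<omega>
  define \<sigma> where "\<sigma> i = sqrt (t (Suc i) - t i)" for i
  define inc where "inc h i = drift h (t (Suc i)) - drift h (t i)" for h i
  let ?I = "{..<k}"
  let ?P = "\<Pi>\<^sub>M i\<in>?I. (borel :: real measure)"
  have ind: "indep_vars (\<lambda>_. borel) U ?I" unfolding U_def by (rule W_increments(1)[OF t01 t(3)])
  have Ud: "distributed M lborel (U i) (normal_density 0 (\<sigma> i))" if "i \<in> ?I" for i
    using that unfolding U_def \<sigma>_def by (intro W_increments(2)[OF t01 t(3)]) auto
  have s: "\<sigma> i > 0" if "i \<in> ?I" for i using that t(3) by (simp add: \<sigma>_def)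
  have Um[measurable]: "U i \<in> borel_measurable M" if "i \<in> ?I" for i using distributed_measurable[OF Ud[OF that]] by simp
  have "\<exists>i\<le>k. t i = x" if "x \<in> J" for x
  proof -
    have "x \<in> t ` {..k}" unfolding t(2)[symmetric] using that by simp
    then show ?thesis by auto
  qed
  then obtain idx where idx: "\<And>x. x \<in> J \<Longrightarrow> idx x \<le> k" "\<And>x. x \<in> J \<Longrightarrow> t (idx x) = x" by metis
  define Rm where "Rm y = (\<lambda>x\<in>J. \<Sum>i<idx x. y i)" for y :: "nat \<Rightarrow> real"
  have Rmm[measurable]: "Rm \<in> measurable ?P (\<Pi>\<^sub>M t\<in>J. borel)"
    unfolding Rm_def using idx(1)
    by (intro measurable_restrict borel_measurable_sum measurable_component_singleton) (force intro: less_le_trans)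
  define B where "B = Rm -` A \<inter> space ?P"
  have B: "B \<in> sets ?P" unfolding B_def using A by measurable
  have dr0: "drift h 0 = 0" if "sq_integrable unit_leb h" for h
    using that by (subst drift_eq) (auto simp: sq_integrable_def measurable_unit_leb)
  have key: "AE \<omega> in M. restrict (shift_path h (W \<omega>)) J = Rm (\<lambda>i\<in>?I. U i \<omega> + inc h i)" if h: "sq_integrable unit_leb h" for h
    using W_0
  proof eventually_elim
    fix \<omega> assume W0: "W \<omega> 0 = 0"
    show "restrict (shift_path h (W \<omega>)) J = Rm (\<lambda>i\<in>?I. U i \<omega> + inc h i)"
      unfolding Rm_def
    proof (rule restrict_ext)
      fix x assume x: "x \<in> J"
      have "(\<Sum>i<idx x. (\<lambda>i\<in>?I. U i \<omega> + inc h i) i) = (\<Sum>i<idx x. (W \<omega> (t (Suc i)) + drift h (t (Suc i))) - (W \<omega> (t i) + drift h (t i)))"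
        using idx(1)[OF x] by (intro sum.cong refl) (auto simp: U_def inc_def)
      also have "\<dots> = (W \<omega> (t (idx x)) + drift h (t (idx x))) - (W \<omega> (t 0) + drift h (t 0))"
        by (rule sum_lessThan_telescope[of "\<lambda>i. W \<omega> (t i) + drift h (t i)"])
      also have "\<dots> = shift_path h (W \<omega>) x"
        using x J by (auto simp: t(1) W0 dr0[OF h] idx shift_path_def)
      finally show "shift_path h (W \<omega>) x = (\<Sum>i<idx x. (\<lambda>i\<in>?I. U i \<omega> + inc h i) i)" ..
    qed
  qed
  have rs: "(\<lambda>\<omega>. restrict (shift_path h (W \<omega>)) J) \<in> measurable M (\<Pi>\<^sub>M t\<in>J. borel)" for h
    using measurable_compose[OF shift_measurable[of h, unfolded traj_space_def] measurable_restrict_subset[OF J(2)]] by simp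
  have rs'[measurable]: "{\<omega>\<in>space M. restrict (shift_path h (W \<omega>)) J \<in> A} \<in> events" for h
    using measurable_sets[OF rs A, of h] by (simp add: vimage_def Int_def conj_commute)
  have pr: "prob {\<omega>\<in>space M. restrict (shift_path h (W \<omega>)) J \<in> A} = prob {\<omega>\<in>space M. (\<lambda>i\<in>?I. U i \<omega> + inc h i) \<in> B}"
    if h: "sq_integrable unit_leb h" for h
  proof (rule finite_measure_eq_AE)
    show "AE \<omega> in M. (\<omega> \<in> {\<omega>\<in>space M. restrict (shift_path h (W \<omega>)) J \<in> A}) = (\<omega> \<in> {\<omega>\<in>space M. (\<lambda>i\<in>?I. U i \<omega> + inc h i) \<in> B})"
      using key[OF h] by eventually_elim (auto simp: B_def space_PiM)
    have um: "(\<lambda>\<omega>. \<lambda>i\<in>?I. U i \<omega> + inc h i) \<in> measurable M ?P" by measurable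
    show "{\<omega>\<in>space M. (\<lambda>i\<in>?I. U i \<omega> + inc h i) \<in> B} \<in> events"
      using measurable_sets[OF um B] by (simp add: vimage_def Int_def conj_commute)
  qed (rule rs')
  \<comment> \<open>Translating by the drift increments of g turns the second law into the centred
    one and the first into a shift by the difference.\<close>
  define B' where "B' = (\<lambda>y. \<lambda>i\<in>?I. y i + inc g i) -` B \<inter> space ?P"
  have "(\<lambda>y. \<lambda>i\<in>?I. y i + inc g i) \<in> measurable ?P ?P"
    by (intro measurable_restrict borel_measurable_add measurable_component_singleton) auto
  then have B': "B' \<in> sets ?P" unfolding B'_def using B by (rule measurable_sets)
  have e1: "(\<lambda>i\<in>?I. U i \<omega> + (inc f i - inc g i)) \<in> B' \<longleftrightarrow> (\<lambda>i\<in>?I. U i \<omega> + inc f i) \<in> B" for \<omega>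
  proof -
    have "(\<lambda>i\<in>?I. (\<lambda>i\<in>?I. U i \<omega> + (inc f i - inc g i)) i + inc g i) = (\<lambda>i\<in>?I. U i \<omega> + inc f i)"
      by (intro restrict_ext) auto
    then show ?thesis by (simp add: B'_def space_PiM)
  qed
  have e2: "(\<lambda>i\<in>?I. U i \<omega>) \<in> B' \<longleftrightarrow> (\<lambda>i\<in>?I. U i \<omega> + inc g i) \<in> B" for \<omega>
  proof -
    have "(\<lambda>i\<in>?I. (\<lambda>i\<in>?I. U i \<omega>) i + inc g i) = (\<lambda>i\<in>?I. U i \<omega> + inc g i)"
      by (intro restrict_ext) auto
    then show ?thesis by (simp add: B'_def space_PiM)
  qed
  have "prob {\<omega>\<in>space M. restrict (shift_path f (W \<omega>)) J \<in> A} - prob {\<omega>\<in>space M. restrict (shift_path g (W \<omega>)) J \<in> A}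
    \<le> 1 - 2 * normal_tail (sqrt (\<Sum>i<k. (inc f i - inc g i)\<^sup>2 / (\<sigma> i)\<^sup>2) / 2)"
    unfolding pr[OF f] pr[OF g] using gaussian_shift_tv[OF finite_lessThan ind Ud s B', of "\<lambda>i. inc f i - inc g i"]
    unfolding e1 e2 by simp
  also have "\<dots> \<le> 1 - 2 * normal_tail (sqrt (\<integral>x. (f x - g x)\<^sup>2 \<partial>unit_leb) / 2)"
  proof -
    have "(\<Sum>i<k. (inc f i - inc g i)\<^sup>2 / (\<sigma> i)\<^sup>2) = (\<Sum>i<k. (drift (\<lambda>x. f x - g x) (t (Suc i)) - drift (\<lambda>x. f x - g x) (t i))\<^sup>2 / (t (Suc i) - t i))"
    proof (intro sum.cong refl)
      fix i assume "i \<in> {..<k}"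
      then have "t i \<in> {0..1}" "t (Suc i) \<in> {0..1}" "t i < t (Suc i)" using tm t(3) by auto
      then show "(inc f i - inc g i)\<^sup>2 / (\<sigma> i)\<^sup>2 = (drift (\<lambda>x. f x - g x) (t (Suc i)) - drift (\<lambda>x. f x - g x) (t i))\<^sup>2 / (t (Suc i) - t i)"
        by (simp add: inc_def \<sigma>_def drift_minus[OF f g] algebra_simps)
    qed
    also have "\<dots> \<le> (\<integral>x. (f x - g x)\<^sup>2 \<partial>unit_leb)"
      by (rule sq_drift_increments_le[OF sq_integrable_diff[OF f g] t01 t(3)])
    finally show ?thesis using normal_tail_antimono by simp
  qed
  finally show ?thesis .
qed

text \<open>A single cylinder approximates A under both laws at once, so the bound for cylinders
  passes to A with an arbitrarily small error.\<close>

lemma path_tv: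
  assumes f: "sq_integrable unit_leb f" and g: "sq_integrable unit_leb g" and A: "A \<in> sets traj_space"
  shows "prob {\<omega>\<in>space M. shift_path f (W \<omega>) \<in> A} - prob {\<omega>\<in>space M. shift_path g (W \<omega>) \<in> A}
    \<le> 1 - 2 * normal_tail (sqrt (\<integral>x. (f x - g x)\<^sup>2 \<partial>unit_leb) / 2)" (is "_ \<le> ?K")
proof -
  let ?pa = "prod_algebra {0..1::real} (\<lambda>_. borel :: real measure)"
  let ?\<Omega> = "\<Pi>\<^sub>E i\<in>{0..1::real}. space (borel :: real measure)"
  \<comment> \<open>All cylinders with an arbitrary measurable base, and not only rectangles, since
    these form an algebra: two cylinders are brought to the common index set J \<union> K.\<close>
  define \<A> where "\<A> = {prod_emb {0..1} (\<lambda>_. borel) J X | J X. finite J \<and> J \<subseteq> {0..1::real} \<and> X \<in> sets (\<Pi>\<^sub>M t\<in>J. (borel :: real measure))}"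
  have S: "sets traj_space = sigma_sets ?\<Omega> ?pa" by (simp add: traj_space_def sets_PiM)
  define F where "F h = distr M traj_space (\<lambda>\<omega>. shift_path h (W \<omega>))" for h
  interpret F: prob_space "F h" for h unfolding F_def by (rule prob_space_distr[OF shift_measurable])
  have [simp]: "sets (F h) = sets traj_space" for h by (simp add: F_def)
  have FP: "measure (F h) B = prob {\<omega>\<in>space M. shift_path h (W \<omega>) \<in> B}" if "B \<in> sets traj_space" for h B
    unfolding F_def using that shift_measurable[of h] by (simp add: measure_distr vimage_def Int_def conj_commute)
  define \<nu> where "\<nu> B = measure (F f) B + measure (F g) B" for B
  have cyl: "measure (F f) B - measure (F g) B \<le> ?K" if "B \<in> \<A>" for B
  proof -
    from that obtain J X where B: "B = prod_emb {0..1} (\<lambda>_. borel) J X" "finite J" "J \<subseteq> {0..1::real}" "X \<in> sets (\<Pi>\<^sub>M t\<in>J. (borel :: real measure))"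
      by (auto simp: \<A>_def)
    have BS: "B \<in> sets traj_space" unfolding B(1) traj_space_def using B by (intro measurable_prod_emb) auto
    have "shift_path h x \<in> B \<longleftrightarrow> restrict (shift_path h x) J \<in> X" for h x
      unfolding B(1) prod_emb_iff by (auto simp: shift_path_def)
    then show ?thesis unfolding FP[OF BS] using cylinder_tv[OF f g B(2-4)] by simp
  qed
  have apx: "\<exists>B\<in>\<A>. \<nu> ((A - B) \<union> (B - A)) < e" if "e > 0" for e
  proof (rule sigma_sets_approx[where \<Omega>="?\<Omega>" and G="?pa"])
    show "?pa \<subseteq> \<A>" unfolding \<A>_def
      by (auto elim!: prod_algebraE intro!: exI sets_PiM_I_finite)
    show "?pa \<subseteq> Pow ?\<Omega>" by (rule prod_algebra_sets_into_space)
    show "\<A> \<subseteq> sigma_sets ?\<Omega> ?pa" unfolding S[symmetric] \<A>_def traj_space_def by auto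
    show "{} \<in> \<A>" unfolding \<A>_def by (rule CollectI, rule exI[of _ "{}"], rule exI[of _ "{}"]) auto
    show "?\<Omega> - B \<in> \<A>" if "B \<in> \<A>" for B
    proof -
      from that obtain J X where B: "B = prod_emb {0..1} (\<lambda>_. borel) J X" "finite J" "J \<subseteq> {0..1::real}" "X \<in> sets (\<Pi>\<^sub>M t\<in>J. (borel :: real measure))"
        by (auto simp: \<A>_def)
      have "?\<Omega> - B = prod_emb {0..1} (\<lambda>_. borel) J (space (\<Pi>\<^sub>M t\<in>J. (borel :: real measure)) - X)"
        using B(3) unfolding B(1) by (auto simp: prod_emb_def space_PiM)
      moreover have "space (\<Pi>\<^sub>M t\<in>J. (borel :: real measure)) - X \<in> sets (\<Pi>\<^sub>M t\<in>J. (borel :: real measure))"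
        using B by (intro sets.compl_sets)
      ultimately show ?thesis using B(2,3) unfolding \<A>_def by blast
    qed
    show "B \<union> C \<in> \<A>" if "B \<in> \<A>" "C \<in> \<A>" for B C
    proof -
      from that obtain J X K Y where B: "B = prod_emb {0..1} (\<lambda>_. borel) J X" "finite J" "J \<subseteq> {0..1::real}" "X \<in> sets (\<Pi>\<^sub>M t\<in>J. (borel :: real measure))"
        and C: "C = prod_emb {0..1} (\<lambda>_. borel) K Y" "finite K" "K \<subseteq> {0..1::real}" "Y \<in> sets (\<Pi>\<^sub>M t\<in>K. (borel :: real measure))"
        by (auto simp: \<A>_def)
      have "B \<union> C = prod_emb {0..1} (\<lambda>_. borel) (J \<union> K) (prod_emb (J \<union> K) (\<lambda>_. borel) J X \<union> prod_emb (J \<union> K) (\<lambda>_. borel) K Y)"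
        using B C by simp
      moreover have "prod_emb (J \<union> K) (\<lambda>_. borel) J X \<union> prod_emb (J \<union> K) (\<lambda>_. borel) K Y \<in> sets (\<Pi>\<^sub>M t\<in>J\<union>K. (borel :: real measure))"
        using B C by (intro sets.Un measurable_prod_emb) auto
      ultimately show ?thesis using B C unfolding \<A>_def by blast
    qed
    show "\<nu> B \<le> \<nu> C" if "B \<in> sigma_sets ?\<Omega> ?pa" "C \<in> sigma_sets ?\<Omega> ?pa" "B \<subseteq> C" for B C
      using that unfolding \<nu>_def S[symmetric] by (intro add_mono F.finite_measure_mono) auto
    show "\<nu> (B \<union> C) \<le> \<nu> B + \<nu> C" if "B \<in> sigma_sets ?\<Omega> ?pa" "C \<in> sigma_sets ?\<Omega> ?pa" for B C
    proof -
      have "measure (F h) (B \<union> C) \<le> measure (F h) B + measure (F h) C" for h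
        using that unfolding S[symmetric] by (intro measure_Un_le) auto
      from this[of f] this[of g] show ?thesis by (simp add: \<nu>_def)
    qed
    show "\<nu> {} = 0" by (simp add: \<nu>_def)
    show "(\<lambda>n. \<nu> ((\<Union>i. B i) - (\<Union>i<n. B i))) \<longlonglongrightarrow> 0" if "range B \<subseteq> sigma_sets ?\<Omega> ?pa" for B :: "nat \<Rightarrow> _"
    proof -
      have Bm: "B i \<in> sets traj_space" for i using that S by auto
      have "(\<lambda>n. measure (F h) ((\<Union>i. B i) - (\<Union>i<n. B i))) \<longlonglongrightarrow> measure (F h) (\<Inter>n. (\<Union>i. B i) - (\<Union>i<n. B i))" for h
      proof (rule F.finite_Lim_measure_decseq)
        show "range (\<lambda>n. (\<Union>i. B i) - (\<Union>i<n. B i)) \<subseteq> F.events h" using Bm by auto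
        show "decseq (\<lambda>n. (\<Union>i. B i) - (\<Union>i<n. B i))" by (rule decseq_SucI) auto
      qed
      moreover have "(\<Inter>n. (\<Union>i. B i) - (\<Union>i<n. B i)) = {}" by blast
      ultimately have l: "(\<lambda>n. measure (F h) ((\<Union>i. B i) - (\<Union>i<n. B i))) \<longlonglongrightarrow> 0" for h
        by (simp only: measure_empty)
      show ?thesis unfolding \<nu>_def using tendsto_add[OF l[of f] l[of g]] by simp
    qed
    show "A \<in> sigma_sets ?\<Omega> ?pa" using A S by simp
  qed fact
  have e: "measure (F f) A - measure (F g) A \<le> ?K + e" if "e > 0" for e
  proof -
    obtain B where B: "B \<in> \<A>" "\<nu> ((A - B) \<union> (B - A)) < e" using apx[OF \<open>e > 0\<close>] by blast
    have BS: "B \<in> sets traj_space" using B(1) unfolding \<A>_def traj_space_def by auto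
    have "measure (F f) A \<le> measure (F f) (B \<union> ((A - B) \<union> (B - A)))" using A BS by (intro F.finite_measure_mono) auto
    also have "\<dots> \<le> measure (F f) B + measure (F f) ((A - B) \<union> (B - A))" using A BS by (intro measure_Un_le) auto
    finally have 1: "measure (F f) A \<le> measure (F f) B + measure (F f) ((A - B) \<union> (B - A))" .
    have "measure (F g) B \<le> measure (F g) (A \<union> ((A - B) \<union> (B - A)))" using A BS by (intro F.finite_measure_mono) auto
    also have "\<dots> \<le> measure (F g) A + measure (F g) ((A - B) \<union> (B - A))" using A BS by (intro measure_Un_le) auto
    finally have 2: "measure (F g) B \<le> measure (F g) A + measure (F g) ((A - B) \<union> (B - A))" .
    show ?thesis using 1 2 cyl[OF B(1)] B(2) unfolding \<nu>_def by linarith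
  qed
  have "measure (F f) A - measure (F g) A \<le> ?K" by (rule field_le_epsilon) (use e in auto)
  then show ?thesis unfolding FP[OF A] .
qed

end

section \<open>Coefficients, bias and the geometry of the plug-in rule\<close>

locale L2_basis =
  fixes \<phi> :: "nat \<Rightarrow> real \<Rightarrow> real"
  assumes basis: "orthonormal_basis_L2 \<phi>"
begin

lemma phi_sq: "j \<ge> 1 \<Longrightarrow> sq_integrable unit_leb (\<phi> j)"
  using basis by (auto simp: orthonormal_basis_L2_def L2_01_iff)

lemma phi_orth: "i \<ge> 1 \<Longrightarrow> j \<ge> 1 \<Longrightarrow> (\<integral>x. \<phi> i x * \<phi> j x \<partial>unit_leb) = (if i = j then 1 else 0)"
proof -
  assume ij: "i \<ge> 1" "j \<ge> 1"
  then have "l2_inner (\<phi> i) (\<phi> j) = (if i = j then 1 else 0)"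
    using basis unfolding orthonormal_basis_L2_def by blast
  then show ?thesis by (simp add: l2_inner_eq[OF phi_sq[OF ij(1)] phi_sq[OF ij(2)]])
qed

lemma phi_complete:
  assumes h: "sq_integrable unit_leb h" and o: "\<And>j. j \<ge> 1 \<Longrightarrow> (\<integral>x. \<phi> j x * h x \<partial>unit_leb) = 0"
  shows "(\<integral>x. (h x)\<^sup>2 \<partial>unit_leb) = 0"
proof -
  have "l2_norm h = 0"
    using basis h o phi_sq by (auto simp: orthonormal_basis_L2_def L2_01_iff l2_inner_eq)
  then show ?thesis using h by (simp add: l2_norm_def l2_inner_eq power2_eq_square)
qed

text \<open>The partial sums of squared coefficients increase and are bounded, so the partial
  expansions are Cauchy. Their limit Z has the same coefficients as h, and completeness of the basis
  forces the two to agree in L2.\<close>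

lemma Parseval:
  assumes h: "sq_integrable unit_leb h"
  shows "(\<lambda>d. \<Sum>j=1..d. (\<integral>x. \<phi> j x * h x \<partial>unit_leb)\<^sup>2) \<longlonglongrightarrow> (\<integral>x. (h x)\<^sup>2 \<partial>unit_leb)"
proof -
  define c where "c j = (\<integral>x. h x * \<phi> j x \<partial>unit_leb)" for j
  define a where "a d = (\<Sum>j=1..d. (c j)\<^sup>2)" for d
  define S where "S d x = (\<Sum>j=1..d. c j * \<phi> j x)" for d :: nat and x
  have Ssq: "sq_integrable unit_leb (S d)" for d
    unfolding S_def by (intro sq_integrable_sum sq_integrable_cmult phi_sq) auto
  have res: "(\<integral>x. (h x - S d x)\<^sup>2 \<partial>unit_leb) = (\<integral>x. (h x)\<^sup>2 \<partial>unit_leb) - a d" for d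
    unfolding S_def
    by (subst sq_orthogonal_expansion[where w="\<lambda>_. 1"])
       (auto simp: h phi_sq phi_orth c_def[symmetric] a_def power2_eq_square)
  have ale: "a d \<le> (\<integral>x. (h x)\<^sup>2 \<partial>unit_leb)" for d
  proof -
    have "0 \<le> (\<integral>x. (h x - S d x)\<^sup>2 \<partial>unit_leb)" by simp
    then show ?thesis unfolding res by simp
  qed
  have inc: "incseq a" by (rule incseq_SucI) (simp add: a_def)
  then have "Cauchy a"
    using incseq_convergent[OF inc, of "\<integral>x. (h x)\<^sup>2 \<partial>unit_leb"] ale by (metis LIMSEQ_imp_Cauchy)
  have "\<exists>N. \<forall>l\<ge>N. \<forall>k\<ge>N. \<bar>a k - a l\<bar> \<le> e" if "e > 0" for e
    using metric_CauchyD[OF \<open>Cauchy a\<close> that] by (auto simp: dist_real_def) (meson less_imp_le)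
  then obtain r where r: "strict_mono r" "\<And>m k. k \<ge> r m \<Longrightarrow> \<bar>a k - a (r m)\<bar> \<le> (1/4)^m"
    using fast_Cauchy_index[of "\<lambda>k l. \<bar>a k - a l\<bar>"] by metis
  \<comment> \<open>The squared distance of two partial expansions is the mass of the coefficients
    between them, which transfers the Cauchy property from the real sequence
    \<open>a\<close>.\<close>
  have diff: "(\<integral>x. (S k x - S l x)\<^sup>2 \<partial>unit_leb) = a k - a l" if "l \<le> k" for k l
  proof -
    have spl: "{1..k} = {1..l} \<union> {Suc l..k}" "{1..l} \<inter> {Suc l..k} = {}" using that by auto
    have "S k x - S l x = (\<Sum>j=Suc l..k. c j * \<phi> j x)" for x
      unfolding S_def spl(1) by (subst sum.union_disjoint) auto
    then have "(\<integral>x. (S k x - S l x)\<^sup>2 \<partial>unit_leb) = (\<integral>x. (0 - (\<Sum>j=Suc l..k. c j * \<phi> j x))\<^sup>2 \<partial>unit_leb)"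
      by simp
    also have "\<dots> = (\<Sum>j=Suc l..k. (c j)\<^sup>2)"
      by (subst sq_orthogonal_expansion[where w="\<lambda>_. 1"]) (auto simp: sq_integrable_zero phi_sq phi_orth)
    also have "\<dots> = a k - a l" unfolding a_def spl(1) by (subst sum.union_disjoint) auto
    finally show ?thesis .
  qed
  define Z where "Z x = lim (\<lambda>m. S (r m) x)" for x
  have Z: "sq_integrable unit_leb Z" "(\<lambda>k. \<integral>x. (Z x - S k x)\<^sup>2 \<partial>unit_leb) \<longlonglongrightarrow> 0"
    unfolding Z_def using r(2) by (intro unit_leb.sq_complete_subseq[OF Ssq r(1)]; force simp: diff)+
  have "(\<integral>x. (h x - Z x)\<^sup>2 \<partial>unit_leb) = 0"
  proof (rule phi_complete)
    show "sq_integrable unit_leb (\<lambda>x. h x - Z x)" by (intro sq_integrable_diff h Z)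
    fix j :: nat assume j: "j \<ge> 1"
    have "(\<lambda>k. \<integral>x. S k x * \<phi> j x \<partial>unit_leb) \<longlonglongrightarrow> (\<integral>x. Z x * \<phi> j x \<partial>unit_leb)"
      using Z(2) by (intro sq_tendsto_inner Ssq Z phi_sq j) (simp add: power2_commute)
    moreover have "(\<integral>x. S k x * \<phi> j x \<partial>unit_leb) = c j" if "k \<ge> j" for k
    proof -
      have "(\<integral>x. S k x * \<phi> j x \<partial>unit_leb) = (\<integral>x. (\<Sum>i=1..k. c i * (\<phi> i x * \<phi> j x)) \<partial>unit_leb)"
        unfolding S_def sum_distrib_right by (simp add: mult.assoc)
      also have "\<dots> = (\<Sum>i=1..k. c i * (\<integral>x. \<phi> i x * \<phi> j x \<partial>unit_leb))"
        using sq_integrable_mult[OF phi_sq phi_sq[OF j]] by (subst Bochner_Integration.integral_sum) auto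
      also have "\<dots> = (\<Sum>i=1..k. if i = j then c i else 0)"
        using j by (intro sum.cong refl) (auto simp: phi_orth)
      finally show ?thesis using that j by simp
    qed
    then have "(\<lambda>k. \<integral>x. S k x * \<phi> j x \<partial>unit_leb) \<longlonglongrightarrow> c j"
      by (intro tendsto_eventually) (auto simp: eventually_sequentially)
    ultimately have "(\<integral>x. Z x * \<phi> j x \<partial>unit_leb) = c j" by (rule LIMSEQ_unique)
    then show "(\<integral>x. \<phi> j x * (h x - Z x) \<partial>unit_leb) = 0"
      using sq_integrable_mult[OF phi_sq[OF j] h] sq_integrable_mult[OF phi_sq[OF j] Z(1)]
      by (simp add: right_diff_distrib c_def mult.commute)
  qed
  then have "(\<integral>x. (h x - S d x)\<^sup>2 \<partial>unit_leb) \<le> 2 * (\<integral>x. (Z x - S d x)\<^sup>2 \<partial>unit_leb)" for d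
    using sq_dist_triangle[OF h Z(1) Ssq, of d] by simp
  moreover have "(\<lambda>d. 2 * (\<integral>x. (Z x - S d x)\<^sup>2 \<partial>unit_leb)) \<longlonglongrightarrow> 0"
    using tendsto_mult[OF tendsto_const Z(2), of 2] by simp
  ultimately have "(\<lambda>d. \<integral>x. (h x - S d x)\<^sup>2 \<partial>unit_leb) \<longlonglongrightarrow> 0"
    by (intro tendsto_sandwich[of "\<lambda>_. 0" "\<lambda>d. \<integral>x. (h x - S d x)\<^sup>2 \<partial>unit_leb" _ "\<lambda>d. 2 * (\<integral>x. (Z x - S d x)\<^sup>2 \<partial>unit_leb)"] always_eventually allI tendsto_const) simp_all
  then have "(\<lambda>d. (\<integral>x. (h x)\<^sup>2 \<partial>unit_leb) - (\<integral>x. (h x - S d x)\<^sup>2 \<partial>unit_leb)) \<longlonglongrightarrow> (\<integral>x. (h x)\<^sup>2 \<partial>unit_leb) - 0"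
    by (intro tendsto_diff tendsto_const)
  then show ?thesis by (simp add: res a_def c_def mult.commute)
qed

text \<open>For j > d the weight j^(2 s) is at least (d + 1)^(2 s), which turns the constraints on f
  and g into a bound for the tail of the coefficients; 4 R^2 is 2 R^2 + 2 R^2 from (x - y)^2 \<le> 2
  x^2 + 2 y^2. The base \<open>Suc d\<close> is the first omitted index, and this absorbs the
  rounding when d is a floor.\<close>

lemma sobolev_bias:
  assumes f: "f \<in> sobolev_class \<phi> s R" and g: "g \<in> sobolev_class \<phi> s R" and s: "s > 0"
  shows "(\<integral>x. (f x - g x)\<^sup>2 \<partial>unit_leb) - (\<Sum>j=1..d. (l2_inner (\<phi> j) f - l2_inner (\<phi> j) g)\<^sup>2) \<le> 4 * R\<^sup>2 * real (Suc d) powr (- 2 * s)"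
    "(\<Sum>j=1..d. (l2_inner (\<phi> j) f - l2_inner (\<phi> j) g)\<^sup>2) \<le> (\<integral>x. (f x - g x)\<^sup>2 \<partial>unit_leb)"
proof -
  have fs: "sq_integrable unit_leb f" and gs: "sq_integrable unit_leb g"
    using f g by (auto simp: sobolev_class_def L2_01_iff)
  have hs: "sq_integrable unit_leb (\<lambda>x. f x - g x)" by (intro sq_integrable_diff fs gs)
  define b where "b j = l2_inner (\<phi> j) f - l2_inner (\<phi> j) g" for j
  have bj: "(\<integral>x. \<phi> j x * (f x - g x) \<partial>unit_leb) = b j" if "j \<ge> 1" for j
    using sq_integrable_mult[OF phi_sq[OF that] fs] sq_integrable_mult[OF phi_sq[OF that] gs] phi_sq[OF that] fs gs
    by (simp add: b_def l2_inner_eq right_diff_distrib)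
  have "(\<lambda>d. \<Sum>j=1..d. (\<integral>x. \<phi> j x * (f x - g x) \<partial>unit_leb)\<^sup>2) = (\<lambda>d. \<Sum>j=1..d. (b j)\<^sup>2)"
    by (intro ext sum.cong refl) (simp add: bj)
  then have lim: "(\<lambda>d. \<Sum>j=1..d. (b j)\<^sup>2) \<longlonglongrightarrow> (\<integral>x. (f x - g x)\<^sup>2 \<partial>unit_leb)"
    using Parseval[OF hs] by simp
  have inc: "incseq (\<lambda>d. \<Sum>j=1..d. (b j)\<^sup>2)" by (rule incseq_SucI) simp
  show "(\<Sum>j=1..d. (l2_inner (\<phi> j) f - l2_inner (\<phi> j) g)\<^sup>2) \<le> (\<integral>x. (f x - g x)\<^sup>2 \<partial>unit_leb)"
    using incseq_le[OF inc lim, of d] by (simp add: b_def)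
  have fin: "(\<Sum>j\<in>J. (l2_inner (\<phi> j) h)\<^sup>2 * real j powr (2 * s)) \<le> R\<^sup>2" if "h \<in> sobolev_class \<phi> s R" "finite J" "J \<subseteq> {1..}" for h J
  proof -
    have "(\<Sum>j\<in>J. (l2_inner (\<phi> j) h)\<^sup>2 * real j powr (2 * s)) \<le> (\<Sum>\<^sub>\<infinity>j\<in>{1..}. (l2_inner (\<phi> j) h)\<^sup>2 * real j powr (2 * s))"
      using that by (intro finite_sum_le_infsum) (auto simp: sobolev_class_def)
    then show ?thesis using that by (simp add: sobolev_class_def)
  qed
  define m where "m = real (Suc d) powr (2 * s)"
  have m0: "m > 0" by (simp add: m_def)
  have "(\<Sum>j=1..K. (b j)\<^sup>2) - (\<Sum>j=1..d. (b j)\<^sup>2) \<le> 4 * R\<^sup>2 / m" if "K \<ge> d" for K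
  proof -
    have spl: "{1..K} = {1..d} \<union> {Suc d..K}" "{1..d} \<inter> {Suc d..K} = {}" using that by auto
    have "(\<Sum>j=1..K. (b j)\<^sup>2) - (\<Sum>j=1..d. (b j)\<^sup>2) = (\<Sum>j=Suc d..K. (b j)\<^sup>2)"
      unfolding spl(1) by (subst sum.union_disjoint) auto
    also have "m * \<dots> \<le> (\<Sum>j=Suc d..K. 2 * ((l2_inner (\<phi> j) f)\<^sup>2 * real j powr (2 * s)) + 2 * ((l2_inner (\<phi> j) g)\<^sup>2 * real j powr (2 * s)))"
      unfolding sum_distrib_left
    proof (rule sum_mono)
      fix j assume j: "j \<in> {Suc d..K}"
      have "m \<le> real j powr (2 * s)" unfolding m_def using j s by (intro powr_mono2) auto
      then have "m * (b j)\<^sup>2 \<le> real j powr (2 * s) * (b j)\<^sup>2" by (intro mult_right_mono) auto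
      also have "\<dots> \<le> real j powr (2 * s) * (2 * (l2_inner (\<phi> j) f)\<^sup>2 + 2 * (l2_inner (\<phi> j) g)\<^sup>2)"
      proof (rule mult_left_mono)
        have "0 \<le> (l2_inner (\<phi> j) f + l2_inner (\<phi> j) g)\<^sup>2" by simp
        then show "(b j)\<^sup>2 \<le> 2 * (l2_inner (\<phi> j) f)\<^sup>2 + 2 * (l2_inner (\<phi> j) g)\<^sup>2"
          unfolding b_def by (simp add: power2_eq_square algebra_simps)
      qed simp
      finally show "m * (b j)\<^sup>2 \<le> 2 * ((l2_inner (\<phi> j) f)\<^sup>2 * real j powr (2 * s)) + 2 * ((l2_inner (\<phi> j) g)\<^sup>2 * real j powr (2 * s))"
        by (simp add: algebra_simps)
    qed
    also have "\<dots> \<le> 2 * R\<^sup>2 + 2 * R\<^sup>2"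
      unfolding sum.distrib sum_distrib_left[symmetric]
      by (intro add_mono mult_left_mono fin f g) auto
    finally show ?thesis using m0 by (simp add: field_simps)
  qed
  then have "eventually (\<lambda>K. (\<Sum>j=1..K. (b j)\<^sup>2) - (\<Sum>j=1..d. (b j)\<^sup>2) \<le> 4 * R\<^sup>2 / m) sequentially"
    by (auto simp: eventually_sequentially)
  moreover have "(\<lambda>K. (\<Sum>j=1..K. (b j)\<^sup>2) - (\<Sum>j=1..d. (b j)\<^sup>2)) \<longlonglongrightarrow> (\<integral>x. (f x - g x)\<^sup>2 \<partial>unit_leb) - (\<Sum>j=1..d. (b j)\<^sup>2)"
    by (intro tendsto_diff lim tendsto_const)
  ultimately have "(\<integral>x. (f x - g x)\<^sup>2 \<partial>unit_leb) - (\<Sum>j=1..d. (b j)\<^sup>2) \<le> 4 * R\<^sup>2 / m"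
    by (intro tendsto_upperbound) auto
  then show "(\<integral>x. (f x - g x)\<^sup>2 \<partial>unit_leb) - (\<Sum>j=1..d. (l2_inner (\<phi> j) f - l2_inner (\<phi> j) g)\<^sup>2) \<le> 4 * R\<^sup>2 * real (Suc d) powr (- 2 * s)"
    by (simp add: b_def m_def powr_minus field_simps)
qed

end

text \<open>Here th and mu are the true centres, th' and mu' their estimates, and a, a' the signed
  distances of th and mu from the hyperplane that bisects the estimates. The sum p = a + a' is the
  projection of th - mu onto the direction of v, and with w = v - (th - mu) one has |w|^2 = (V -
  p)^2 + D^2 - p^2. Hence the loss D - p is quadratic in the estimation error.\<close>

lemma plugin_geometry:
  fixes th mu th' mu' :: "nat \<Rightarrow> real"
  assumes J: "finite J"
  defines "v \<equiv> \<lambda>j. th' j - mu' j" and "b \<equiv> \<lambda>j. (th' j + mu' j) / 2"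
  defines "V \<equiv> L2_set v J" and "D \<equiv> L2_set (\<lambda>j. th j - mu j) J"
    and "E \<equiv> L2_set (\<lambda>j. th' j - th j) J + L2_set (\<lambda>j. mu' j - mu j) J"
    and "a \<equiv> (\<Sum>j\<in>J. v j * (th j - b j)) / L2_set v J" and "a' \<equiv> - (\<Sum>j\<in>J. v j * (mu j - b j)) / L2_set v J"
  shows "\<bar>a - a'\<bar> \<le> E" "\<bar>a + a'\<bar> \<le> D" "D * (D - (a + a')) \<le> 2 * E\<^sup>2"
proof -
  have V0: "0 \<le> V" "0 \<le> D" by (auto simp: V_def D_def)
  have cs: "\<bar>\<Sum>j\<in>J. x j * y j\<bar> \<le> L2_set x J * L2_set y J" for x y :: "nat \<Rightarrow> real"
  proof -
    have "\<bar>\<Sum>j\<in>J. x j * y j\<bar> \<le> (\<Sum>j\<in>J. \<bar>x j\<bar> * \<bar>y j\<bar>)" unfolding abs_mult[symmetric] by (rule sum_abs)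
    also have "\<dots> \<le> L2_set x J * L2_set y J" by (rule L2_set_mult_ineq)
    finally show ?thesis .
  qed
  have div: "\<bar>(\<Sum>j\<in>J. v j * y j) / V\<bar> \<le> L2_set y J" for y
  proof (cases "V = 0")
    case False
    then have "V > 0" using V0 by simp
    then show ?thesis using cs[of v y] by (simp add: V_def[symmetric] abs_divide divide_le_eq mult.commute)
  qed simp
  define w where "w j = (th' j - th j) - (mu' j - mu j)" for j
  have neg: "L2_set (\<lambda>j. - x j) J = L2_set x J" for x :: "nat \<Rightarrow> real" by (simp add: L2_set_def)
  have wE: "L2_set w J \<le> E"
  proof -
    have "w = (\<lambda>j. (th' j - th j) + - (mu' j - mu j))" by (auto simp: w_def)
    then have "L2_set w J = L2_set (\<lambda>j. (th' j - th j) + - (mu' j - mu j)) J" by simp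
    also have "\<dots> \<le> E" unfolding E_def using L2_set_triangle_ineq[of "\<lambda>j. th' j - th j" "\<lambda>j. - (mu' j - mu j)" J] unfolding neg .
    finally show ?thesis .
  qed
  have "a - a' = (\<Sum>j\<in>J. v j * (- ((th' j - th j) + (mu' j - mu j)))) / V"
  proof -
    have "(\<Sum>j\<in>J. v j * (th j - b j)) + (\<Sum>j\<in>J. v j * (mu j - b j)) = (\<Sum>j\<in>J. v j * (- ((th' j - th j) + (mu' j - mu j))))"
      unfolding sum.distrib[symmetric] by (intro sum.cong refl) (simp add: b_def algebra_simps)
    then show ?thesis unfolding a_def a'_def V_def by (simp add: add_divide_distrib[symmetric])
  qed
  then have "\<bar>a - a'\<bar> \<le> L2_set (\<lambda>j. - ((th' j - th j) + (mu' j - mu j))) J" using div by simp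
  also have "\<dots> \<le> E" unfolding neg E_def by (rule L2_set_triangle_ineq)
  finally show "\<bar>a - a'\<bar> \<le> E" .
  define p where "p = (\<Sum>j\<in>J. v j * (th j - mu j)) / V"
  have pe: "a + a' = p"
  proof -
    have "(\<Sum>j\<in>J. v j * (th j - b j)) - (\<Sum>j\<in>J. v j * (mu j - b j)) = (\<Sum>j\<in>J. v j * (th j - mu j))"
      unfolding sum_subtractf[symmetric] by (intro sum.cong refl) (simp add: algebra_simps)
    then show ?thesis unfolding a_def a'_def p_def V_def by (simp add: diff_divide_distrib[symmetric])
  qed
  show pD: "\<bar>a + a'\<bar> \<le> D" unfolding pe p_def D_def by (rule div)
  have sq: "(L2_set x J)\<^sup>2 = (\<Sum>j\<in>J. (x j)\<^sup>2)" for x :: "nat \<Rightarrow> real" by (simp add: L2_set_def sum_nonneg)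
  have pV: "p * V = (\<Sum>j\<in>J. v j * (th j - mu j))"
  proof (cases "V = 0")
    \<comment> \<open>Division by V = 0 gives p = 0, and the right side vanishes because v
      does.\<close>
    case True
    then have "\<forall>j\<in>J. v j = 0" unfolding V_def using J by (simp add: L2_set_eq_0_iff)
    then show ?thesis using True by simp
  qed (simp add: p_def)
  have "(L2_set w J)\<^sup>2 = (\<Sum>j\<in>J. (v j)\<^sup>2) - 2 * (\<Sum>j\<in>J. v j * (th j - mu j)) + (\<Sum>j\<in>J. (th j - mu j)\<^sup>2)"
    unfolding sq sum_distrib_left sum_subtractf[symmetric] sum.distrib[symmetric]
    by (intro sum.cong refl) (simp add: w_def v_def power2_eq_square algebra_simps)
  then have "(L2_set w J)\<^sup>2 = V\<^sup>2 - 2 * (p * V) + D\<^sup>2"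
    unfolding pV unfolding V_def D_def sq .
  then have w2: "(L2_set w J)\<^sup>2 = (V - p)\<^sup>2 + (D\<^sup>2 - p\<^sup>2)" by (simp add: power2_diff)
  have "D * (D - p) \<le> 2 * (L2_set w J)\<^sup>2"
  proof (cases "p \<ge> 0")
    case True
    have "p * p \<le> D * p" using pD True unfolding pe by (intro mult_right_mono) auto
    then have "D * (D - p) \<le> D\<^sup>2 - p\<^sup>2" by (simp add: power2_eq_square algebra_simps)
    also have "\<dots> \<le> (L2_set w J)\<^sup>2" unfolding w2 by simp
    also have "\<dots> \<le> 2 * (L2_set w J)\<^sup>2" by simp
    finally show ?thesis .
  next
    \<comment> \<open>An estimated direction that points the wrong way has V - p \<ge> |p|, so the
      identity gives D^2 \<le> |w|^2, while D - p \<le> 2 D.\<close>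
    case False
    then have "p\<^sup>2 \<le> (V - p)\<^sup>2" using V0 by (subst abs_le_square_iff[symmetric]) auto
    then have "D\<^sup>2 \<le> (L2_set w J)\<^sup>2" unfolding w2 by simp
    moreover have "D * (D - p) \<le> D * (2 * D)" using pD V0 unfolding pe by (intro mult_left_mono) auto
    ultimately show ?thesis by (simp add: power2_eq_square)
  qed
  also have "\<dots> \<le> 2 * E\<^sup>2" using wE by (intro mult_left_mono power_mono) auto
  finally show "D * (D - (a + a')) \<le> 2 * E\<^sup>2" unfolding pe .
qed

text \<open>The explicit Z, class coefficient plus Wiener integral, is an L2 limit of the dyadic
  sums of the observed path. The choice in \<open>stoch_int\<close> therefore picks some limit of
  the same sequence, and two limits agree almost everywhere.\<close>

lemma (in brownian) stoch_int_obs_path: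
  assumes phi: "sq_integrable unit_leb \<phi>" and f: "sq_integrable unit_leb f" and g: "sq_integrable unit_leb g"
    and Y: "Y \<in> measurable M (count_space UNIV)"
  shows "stoch_int M \<phi> (obs_path f g W Y) \<in> borel_measurable M"
    "AE \<omega> in M. stoch_int M \<phi> (obs_path f g W Y) \<omega> = (if Y \<omega> then l2_inner \<phi> f else l2_inner \<phi> g) + wiener_int \<phi> (W \<omega>)"
proof -
  note [measurable] = Y
  define df where "df k = (\<integral>x. dyadic_step \<phi> k x * f x \<partial>unit_leb)" for k
  define dg where "dg k = (\<integral>x. dyadic_step \<phi> k x * g x \<partial>unit_leb)" for k
  define S where "S k \<omega> = dyadic_sum \<phi> (obs_path f g W Y \<omega>) k" for k \<omega>
  define Z where "Z \<omega> = (if Y \<omega> then l2_inner \<phi> f else l2_inner \<phi> g) + wiener_int \<phi> (W \<omega>)" for \<omega>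
  have df: "df \<longlonglongrightarrow> l2_inner \<phi> f" and dg: "dg \<longlonglongrightarrow> l2_inner \<phi> g"
    unfolding df_def dg_def l2_inner_eq[OF phi f] l2_inner_eq[OF phi g]
    by (intro sq_tendsto_inner sq_integrable_dyadic_step phi f g dyadic_step_tendsto)+
  have S_eq: "S k = (\<lambda>\<omega>. (if Y \<omega> then df k else dg k) + dyadic_sum \<phi> (W \<omega>) k)" for k
  proof
    fix \<omega>
    have "S k \<omega> = dyadic_sum \<phi> (\<lambda>t. (if Y \<omega> then drift f t else drift g t) + W \<omega> t) k"
      unfolding S_def obs_path_def by (rule dyadic_sum_cong) simp
    also have "\<dots> = dyadic_sum \<phi> (\<lambda>t. if Y \<omega> then drift f t else drift g t) k + dyadic_sum \<phi> (W \<omega>) k"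
      by (rule dyadic_sum_add)
    also have "dyadic_sum \<phi> (\<lambda>t. if Y \<omega> then drift f t else drift g t) k = (if Y \<omega> then df k else dg k)"
      unfolding df_def dg_def using dyadic_sum_drift[OF f, of \<phi> k] dyadic_sum_drift[OF g, of \<phi> k] by simp
    finally show "S k \<omega> = (if Y \<omega> then df k else dg k) + dyadic_sum \<phi> (W \<omega>) k" .
  qed
  have cst: "sq_integrable M (\<lambda>\<omega>. if Y \<omega> then x else y)" for x y :: real
    by (rule sq_integrable_bounded[where K="max \<bar>x\<bar> \<bar>y\<bar>"]) auto
  have Ssq: "sq_integrable M (S k)" for k
    unfolding S_eq by (intro sq_integrable_add cst dyadic_sum_sq_integrable)
  have Zsq: "sq_integrable M Z"
    unfolding Z_def by (intro sq_integrable_add cst wiener_int_sq phi)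
  have Zlim: "(\<lambda>k. \<integral>\<omega>. (Z \<omega> - S k \<omega>)\<^sup>2 \<partial>M) \<longlonglongrightarrow> 0"
  proof (rule tendsto_sandwich[of "\<lambda>_. 0"])
    let ?B = "\<lambda>k. 2 * ((l2_inner \<phi> f - df k)\<^sup>2 + (l2_inner \<phi> g - dg k)\<^sup>2) + 2 * (\<integral>\<omega>. (wiener_int \<phi> (W \<omega>) - dyadic_sum \<phi> (W \<omega>) k)\<^sup>2 \<partial>M)"
    have "?B \<longlonglongrightarrow> 2 * ((l2_inner \<phi> f - l2_inner \<phi> f)\<^sup>2 + (l2_inner \<phi> g - l2_inner \<phi> g)\<^sup>2) + 2 * 0"
      by (intro tendsto_intros df dg wiener_int_sq phi)
    then show "?B \<longlonglongrightarrow> 0" by simp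
    have wd: "integrable M (\<lambda>\<omega>. (wiener_int \<phi> (W \<omega>) - dyadic_sum \<phi> (W \<omega>) k)\<^sup>2)" for k
      by (intro sq_integrable_square sq_integrable_diff wiener_int_sq phi dyadic_sum_sq_integrable)
    have "(\<integral>\<omega>. (Z \<omega> - S k \<omega>)\<^sup>2 \<partial>M) \<le> ?B k" for k
    proof -
      have "(\<integral>\<omega>. (Z \<omega> - S k \<omega>)\<^sup>2 \<partial>M) \<le> (\<integral>\<omega>. 2 * ((l2_inner \<phi> f - df k)\<^sup>2 + (l2_inner \<phi> g - dg k)\<^sup>2) + 2 * (wiener_int \<phi> (W \<omega>) - dyadic_sum \<phi> (W \<omega>) k)\<^sup>2 \<partial>M)"
      proof (rule integral_mono)
        show "integrable M (\<lambda>\<omega>. (Z \<omega> - S k \<omega>)\<^sup>2)" by (intro sq_integrable_square sq_integrable_diff Zsq Ssq)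
        show "integrable M (\<lambda>\<omega>. 2 * ((l2_inner \<phi> f - df k)\<^sup>2 + (l2_inner \<phi> g - dg k)\<^sup>2) + 2 * (wiener_int \<phi> (W \<omega>) - dyadic_sum \<phi> (W \<omega>) k)\<^sup>2)"
          using wd by simp
        fix \<omega>
        define x where "x = (if Y \<omega> then l2_inner \<phi> f - df k else l2_inner \<phi> g - dg k)"
        define y where "y = wiener_int \<phi> (W \<omega>) - dyadic_sum \<phi> (W \<omega>) k"
        have eq: "Z \<omega> - S k \<omega> = x + y" by (simp add: Z_def S_eq x_def y_def)
        have "(x + y)\<^sup>2 \<le> 2 * x\<^sup>2 + 2 * y\<^sup>2"
          using zero_le_power2[of "x - y"] by (simp add: power2_eq_square algebra_simps)
        moreover have "x\<^sup>2 \<le> (l2_inner \<phi> f - df k)\<^sup>2 + (l2_inner \<phi> g - dg k)\<^sup>2" by (simp add: x_def)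
        ultimately show "(Z \<omega> - S k \<omega>)\<^sup>2 \<le> 2 * ((l2_inner \<phi> f - df k)\<^sup>2 + (l2_inner \<phi> g - dg k)\<^sup>2) + 2 * (wiener_int \<phi> (W \<omega>) - dyadic_sum \<phi> (W \<omega>) k)\<^sup>2"
          unfolding y_def[symmetric] eq by (meson add_right_mono mult_left_mono order_trans zero_le_numeral)
      qed
      also have "\<dots> = ?B k" using wd by (simp add: prob_space)
      finally show ?thesis .
    qed
    then show "\<forall>\<^sub>F k in sequentially. (\<integral>\<omega>. (Z \<omega> - S k \<omega>)\<^sup>2 \<partial>M) \<le> ?B k" by simp
  qed auto
  have nn: "(\<integral>\<^sup>+\<omega>. ennreal ((Z' \<omega> - S k \<omega>)\<^sup>2) \<partial>M) = ennreal (\<integral>\<omega>. (Z' \<omega> - S k \<omega>)\<^sup>2 \<partial>M)" if "sq_integrable M Z'" for Z' k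
    by (intro nn_integral_eq_integral sq_integrable_square sq_integrable_diff that Ssq) auto
  let ?P = "\<lambda>Z. Z \<in> borel_measurable M \<and> (\<lambda>k. \<integral>\<^sup>+\<omega>. ennreal ((Z \<omega> - S k \<omega>)\<^sup>2) \<partial>M) \<longlonglongrightarrow> 0"
  have "?P Z"
    unfolding nn[OF Zsq] using Zsq tendsto_ennrealI[OF Zlim] by (simp add: sq_integrable_def)
  then have "?P (SOME Z. ?P Z)" by (rule someI[of ?P])
  moreover have "stoch_int M \<phi> (obs_path f g W Y) = (SOME Z. ?P Z)" by (simp add: stoch_int_def S_def)
  ultimately have P: "?P (stoch_int M \<phi> (obs_path f g W Y))" by simp
  let ?X = "stoch_int M \<phi> (obs_path f g W Y)"
  show Xm: "?X \<in> borel_measurable M" using P by blast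
  have [measurable]: "S k \<in> borel_measurable M" for k using Ssq by (simp add: sq_integrable_def)
  have "\<forall>\<^sub>F k in sequentially. (\<integral>\<^sup>+\<omega>. ennreal ((?X \<omega> - S k \<omega>)\<^sup>2) \<partial>M) < 1"
    using P by (intro order_tendstoD(2)[of _ 0]) auto
  \<comment> \<open>The chosen function is only known to be measurable; its finite distance from one
    S k makes it square integrable.\<close>
  then obtain k where k: "(\<integral>\<^sup>+\<omega>. ennreal ((?X \<omega> - S k \<omega>)\<^sup>2) \<partial>M) < 1" by (auto simp: eventually_sequentially)
  have "integrable M (\<lambda>\<omega>. (?X \<omega> - S k \<omega>)\<^sup>2)"
    using k Xm by (intro integrableI_bounded) (auto intro: less_trans)
  then have "sq_integrable M (\<lambda>\<omega>. ?X \<omega> - S k \<omega>)" using Xm by (simp add: sq_integrable_def)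
  from sq_integrable_add[OF this Ssq[of k]] have Xsq: "sq_integrable M ?X" by simp
  have "(\<lambda>k. ennreal (\<integral>\<omega>. (?X \<omega> - S k \<omega>)\<^sup>2 \<partial>M)) \<longlonglongrightarrow> ennreal 0" using P unfolding nn[OF Xsq] by simp
  then have Xlim: "(\<lambda>k. \<integral>\<omega>. (?X \<omega> - S k \<omega>)\<^sup>2 \<partial>M) \<longlonglongrightarrow> 0"
    by (rule tendsto_ennrealD) auto
  show "AE \<omega> in M. ?X \<omega> = (if Y \<omega> then l2_inner \<phi> f else l2_inner \<phi> g) + wiener_int \<phi> (W \<omega>)"
    using sq_limit_unique[OF Ssq Xsq Zsq Xlim Zlim] by (simp add: Z_def)
qed

section \<open>Conditioning on the sample\<close>

text \<open>Fubini for the sample and the new observation, with \<open>\<omega>'\<close> as an independent copy of \<open>\<omega>\<close> carrying the sample.\<close>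

lemma (in prob_space) indep_vars_split:
  fixes V :: "nat \<Rightarrow> 'a \<Rightarrow> 'b"
  assumes ind: "indep_vars (\<lambda>_. T) V {..n}"
    and P: "{x \<in> space ((\<Pi>\<^sub>M i\<in>{1..n}. T) \<Otimes>\<^sub>M T). P (fst x) (snd x)} \<in> sets ((\<Pi>\<^sub>M i\<in>{1..n}. T) \<Otimes>\<^sub>M T)"
  shows "ennreal (prob {\<omega> \<in> space M. P (\<lambda>i\<in>{1..n}. V i \<omega>) (V 0 \<omega>)}) =
    (\<integral>\<^sup>+\<omega>'. ennreal (prob {\<omega> \<in> space M. P (\<lambda>i\<in>{1..n}. V i \<omega>') (V 0 \<omega>)}) \<partial>M)"
proof -
  \<comment> \<open>The new observation is treated as a family over the index set {0}, since
    \<open>indep_vars_restrict\<close> speaks of product spaces; \<open>snd x 0\<close> in the set E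
    undoes this.\<close>
  let ?T1 = "\<Pi>\<^sub>M i\<in>{1..n}. T" and ?T0 = "\<Pi>\<^sub>M i\<in>{0::nat}. T"
  let ?S = "\<lambda>\<omega>. \<lambda>i\<in>{1..n}. V i \<omega>" and ?V = "\<lambda>\<omega>. \<lambda>i\<in>{0::nat}. V i \<omega>"
  have Vm: "V i \<in> measurable M T" if "i \<le> n" for i using ind that by (auto simp: indep_vars_def)
  have Sm: "?S \<in> measurable M ?T1" and V0m: "?V \<in> measurable M ?T0"
    by (auto intro!: measurable_restrict Vm)
  have "indep_vars (\<lambda>j. PiM (case_bool {1..n} {0} j) (\<lambda>_. T)) (\<lambda>j \<omega>. restrict (\<lambda>i. V i \<omega>) (case_bool {1..n} {0} j)) (UNIV :: bool set)"
    by (rule indep_vars_restrict[OF ind]) (auto simp: disjoint_family_on_def split: bool.splits)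
  moreover have "(\<lambda>j. PiM (case_bool {1..n} {0::nat} j) (\<lambda>_. T)) = case_bool ?T1 ?T0"
    by (auto split: bool.split)
  moreover have "(\<lambda>j \<omega>. restrict (\<lambda>i. V i \<omega>) (case_bool {1..n} {0} j)) = case_bool ?S ?V"
    by (auto split: bool.split)
  ultimately have "indep_var ?T1 ?S ?T0 ?V" by (simp add: indep_var_def)
  then have eq: "distr M ?T1 ?S \<Otimes>\<^sub>M distr M ?T0 ?V = distr M (?T1 \<Otimes>\<^sub>M ?T0) (\<lambda>\<omega>. (?S \<omega>, ?V \<omega>))"
    by (simp add: indep_var_distribution_eq)
  define E where "E = {x \<in> space (?T1 \<Otimes>\<^sub>M ?T0). P (fst x) (snd x 0)}"
  have "(\<lambda>x. (fst x, snd x 0)) \<in> measurable (?T1 \<Otimes>\<^sub>M ?T0) (?T1 \<Otimes>\<^sub>M T)"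
    by (intro measurable_Pair measurable_fst measurable_compose[OF measurable_snd measurable_component_singleton]) auto
  from measurable_sets[OF this P] have E: "E \<in> sets (?T1 \<Otimes>\<^sub>M ?T0)"
    by (auto simp: E_def vimage_def Int_def space_pair_measure space_PiM PiE_iff conj_commute cong: conj_cong elim!: back_subst[of "\<lambda>x. x \<in> sets _"])
  interpret DV: prob_space "distr M ?T0 ?V" by (rule prob_space_distr[OF V0m])
  have sp: "?S \<omega> \<in> space ?T1" "?V \<omega> \<in> space ?T0" if "\<omega> \<in> space M" for \<omega>
    using measurable_space[OF Sm that] measurable_space[OF V0m that] by auto
  have "ennreal (prob {\<omega> \<in> space M. P (?S \<omega>) (V 0 \<omega>)}) = emeasure M ((\<lambda>\<omega>. (?S \<omega>, ?V \<omega>)) -` E \<inter> space M)"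
    unfolding emeasure_eq_measure[symmetric]
    by (intro arg_cong[where f="emeasure M"]) (use sp in \<open>auto simp: E_def space_pair_measure\<close>)
  also have "\<dots> = emeasure (distr M ?T1 ?S \<Otimes>\<^sub>M distr M ?T0 ?V) E"
    unfolding eq by (subst emeasure_distr) (use E Sm V0m in auto)
  also have "\<dots> = (\<integral>\<^sup>+s. emeasure (distr M ?T0 ?V) (Pair s -` E) \<partial>distr M ?T1 ?S)"
    using E by (intro DV.emeasure_pair_measure_alt) simp
  also have "\<dots> = (\<integral>\<^sup>+\<omega>'. emeasure (distr M ?T0 ?V) (Pair (?S \<omega>') -` E) \<partial>M)"
    using E by (intro nn_integral_distr Sm DV.measurable_emeasure_Pair) simp
  also have "\<dots> = (\<integral>\<^sup>+\<omega>'. ennreal (prob {\<omega> \<in> space M. P (?S \<omega>') (V 0 \<omega>)}) \<partial>M)"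
  proof (rule nn_integral_cong)
    fix \<omega>' assume w: "\<omega>' \<in> space M"
    have "emeasure (distr M ?T0 ?V) (Pair (?S \<omega>') -` E) = emeasure M (?V -` (Pair (?S \<omega>') -` E) \<inter> space M)"
      using E V0m by (intro emeasure_distr sets_Pair1) auto
    also have "?V -` (Pair (?S \<omega>') -` E) \<inter> space M = {\<omega> \<in> space M. P (?S \<omega>') (V 0 \<omega>)}"
      using sp w by (auto simp: E_def space_pair_measure)
    finally show "emeasure (distr M ?T0 ?V) (Pair (?S \<omega>') -` E) = ennreal (prob {\<omega> \<in> space M. P (?S \<omega>') (V 0 \<omega>)})"
      by (simp only: emeasure_eq_measure)
  qed
  finally show ?thesis .
qed

text \<open>Independence and zero means make the summands orthogonal, so the expansion of the
  squared norm applies with f = 0.\<close>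

lemma (in prob_space) indep_sum_second_moment:
  fixes X :: "'i \<Rightarrow> 'a \<Rightarrow> real"
  assumes I: "finite I" and ind: "indep_vars (\<lambda>_. borel) X I"
    and sq: "\<And>i. i \<in> I \<Longrightarrow> sq_integrable M (X i)" and mean: "\<And>i. i \<in> I \<Longrightarrow> expectation (X i) = 0"
  shows "expectation (\<lambda>\<omega>. (\<Sum>i\<in>I. X i \<omega>)\<^sup>2) = (\<Sum>i\<in>I. expectation (\<lambda>\<omega>. (X i \<omega>)\<^sup>2))"
proof -
  have "(\<integral>\<omega>. (0 - (\<Sum>i\<in>I. 1 * X i \<omega>))\<^sup>2 \<partial>M) = (\<integral>\<omega>. 0\<^sup>2 \<partial>M) - 2 * (\<Sum>i\<in>I. 1 * (\<integral>\<omega>. 0 * X i \<omega> \<partial>M)) + (\<Sum>i\<in>I. expectation (\<lambda>\<omega>. (X i \<omega>)\<^sup>2) * 1\<^sup>2)"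
  proof (rule sq_orthogonal_expansion[OF I sq_integrable_zero sq])
    show "expectation (\<lambda>x. X i x * X j x) = (if i = j then expectation (\<lambda>\<omega>. (X i \<omega>)\<^sup>2) else 0)" if "i \<in> I" "j \<in> I" for i j
    proof (cases "i = j")
      case False
      then show ?thesis using indep_vars_pair_integral[OF ind that False] sq mean that
        by (simp add: sq_integrable_imp_integrable)
    qed (simp add: power2_eq_square)
  qed
  then show ?thesis by simp
qed

text \<open>The value \<open>x / 0 = 0\<close> matches the convention that an estimator without observations is 0.\<close>

definition label_mean :: "nat \<Rightarrow> (nat \<Rightarrow> bool) \<Rightarrow> (nat \<Rightarrow> real) \<Rightarrow> real" where
  "label_mean n b z = (\<Sum>i=1..n. if b i then z i else 0) / (\<Sum>i=1..n. if b i then 1 else 0)"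

text \<open>The index sets of the two classes depend on \<omega>. Summing over all i with an
  indicator instead makes measurability and independence accessible.\<close>

lemma hat_Phi_iff:
  "hat_Phi d n Y Z \<omega> \<longleftrightarrow>
     L2_set (\<lambda>j. Z 0 j \<omega> - label_mean n (\<lambda>i. Y i \<omega>) (\<lambda>i. Z i j \<omega>)) {1..d}
     \<le> L2_set (\<lambda>j. Z 0 j \<omega> - label_mean n (\<lambda>i. \<not> Y i \<omega>) (\<lambda>i. Z i j \<omega>)) {1..d}"
proof -
  have "(if card {i\<in>{1..n}. b i} > 0 then (\<Sum>i\<in>{i\<in>{1..n}. b i}. z i) / real (card {i\<in>{1..n}. b i}) else 0) = label_mean n b z" for b z
  proof -
    have "real (card {i\<in>{1..n}. b i}) = (\<Sum>i=1..n. if b i then 1 else 0)"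
      by (simp add: sum.inter_filter[symmetric])
    moreover have "(\<Sum>i\<in>{i\<in>{1..n}. b i}. z i) = (\<Sum>i=1..n. if b i then z i else 0)"
      by (rule sum.inter_filter) simp
    ultimately show ?thesis unfolding label_mean_def by (metis div_by_0 gr0I of_nat_0)
  qed
  then show ?thesis unfolding hat_Phi_def Let_def by simp
qed

text \<open>The positive count excludes the default value 0. The constant then passes through the
  mean, so the estimation error is a mean of noise alone.\<close>

lemma label_mean_shift:
  assumes "\<And>i. i \<in> {1..n} \<Longrightarrow> b i \<Longrightarrow> z i = c + x i" and "(\<Sum>i=1..n. if b i then 1 else 0) > (0::real)"
  shows "label_mean n b z - c = label_mean n b x"
proof -
  have "(\<Sum>i=1..n. if b i then z i else 0) = (\<Sum>i=1..n. c * (if b i then 1 else 0) + (if b i then x i else 0))"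
    using assms(1) by (intro sum.cong refl) auto
  also have "\<dots> = c * (\<Sum>i=1..n. if b i then 1 else 0) + (\<Sum>i=1..n. if b i then x i else 0)"
    by (simp add: sum.distrib sum_distrib_left)
  finally show ?thesis unfolding label_mean_def using assms(2) by (simp add: add_divide_distrib)
qed

text \<open>Balanced labels allow the random class size to be replaced by n / 4, whence 16 = 4^2.
  The denominator is then deterministic, and the second moment of the numerator can be taken without
  conditioning on the labels.\<close>

lemma label_mean_sq_le:
  assumes "(\<Sum>i=1..n. if b i then 1 else 0) \<ge> real n / 4" "n > 0"
  shows "(label_mean n b x)\<^sup>2 \<le> 16 / (real n)\<^sup>2 * (\<Sum>i=1..n. if b i then x i else 0)\<^sup>2"
proof -
  let ?N = "\<Sum>i=1..n. if b i then 1 else (0::real)"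
  have "(real n / 4)\<^sup>2 \<le> ?N\<^sup>2" using assms by (intro power_mono) auto
  moreover have "0 < (real n / 4)\<^sup>2" using assms by simp
  ultimately have "(\<Sum>i=1..n. if b i then x i else 0)\<^sup>2 / ?N\<^sup>2 \<le> (\<Sum>i=1..n. if b i then x i else 0)\<^sup>2 / (real n / 4)\<^sup>2"
    by (intro divide_left_mono mult_pos_pos) (auto intro: less_le_trans)
  then show ?thesis unfolding label_mean_def power_divide by (simp add: mult.commute)
qed

text \<open>The terms quadratic in z cancel, so the nearest-centre rule is a half-space bounded by
  the perpendicular bisector.\<close>

lemma L2_set_le_iff:
  fixes z th' mu' :: "nat \<Rightarrow> real"
  shows "L2_set (\<lambda>j. z j - th' j) J \<le> L2_set (\<lambda>j. z j - mu' j) J \<longleftrightarrow>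
    0 \<le> (\<Sum>j\<in>J. (th' j - mu' j) * (z j - (th' j + mu' j) / 2))"
proof -
  have "L2_set (\<lambda>j. z j - th' j) J \<le> L2_set (\<lambda>j. z j - mu' j) J \<longleftrightarrow> 0 \<le> (\<Sum>j\<in>J. (z j - mu' j)\<^sup>2) - (\<Sum>j\<in>J. (z j - th' j)\<^sup>2)"
    by (simp add: L2_set_def)
  also have "(\<Sum>j\<in>J. (z j - mu' j)\<^sup>2) - (\<Sum>j\<in>J. (z j - th' j)\<^sup>2) = 2 * (\<Sum>j\<in>J. (th' j - mu' j) * (z j - (th' j + mu' j) / 2))"
    unfolding sum_subtractf[symmetric] sum_distrib_left by (intro sum.cong refl) (simp add: power2_eq_square field_simps)
  finally show ?thesis by simp
qed

text \<open>The estimates are fixed vectors here, and \<open>H c\<close> is the decision for an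
  observation with mean c. Its error probabilities are normal tails at the signed distances of
  \<open>plugin_geometry\<close>, to which the scalar bound applies.\<close>

lemma (in brownian) plugin_conditional_risk:
  fixes th mu th' mu' :: "nat \<Rightarrow> real"
  assumes J: "finite J" and e: "\<And>j. j \<in> J \<Longrightarrow> sq_integrable unit_leb (e j)"
    and orth: "\<And>i j. i \<in> J \<Longrightarrow> j \<in> J \<Longrightarrow> (\<integral>x. e i x * e j x \<partial>unit_leb) = (if i = j then 1 else 0)"
    and bias: "\<delta>\<^sup>2 - (\<Sum>j\<in>J. (th j - mu j)\<^sup>2) \<le> 4 * \<rho>\<^sup>2" and le: "(\<Sum>j\<in>J. (th j - mu j)\<^sup>2) \<le> \<delta>\<^sup>2" and d0: "0 \<le> \<delta>" and \<rho>: "\<rho> > 0"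
  defines "H \<equiv> \<lambda>c \<omega>. L2_set (\<lambda>j. c j + wiener_int (e j) (W \<omega>) - th' j) J \<le> L2_set (\<lambda>j. c j + wiener_int (e j) (W \<omega>) - mu' j) J"
  shows "(prob {\<omega> \<in> space M. \<not> H th \<omega>} + prob {\<omega> \<in> space M. H mu \<omega>}) / 2 \<le> normal_tail (\<delta> / 2) +
    100 * ((\<rho>\<^sup>2 + 2 * ((\<Sum>j\<in>J. (th' j - th j)\<^sup>2) + (\<Sum>j\<in>J. (mu' j - mu j)\<^sup>2))) / max \<delta> \<rho>)"
proof -
  define v where "v j = th' j - mu' j" for j
  define b where "b j = (th' j + mu' j) / 2" for j
  define D where "D = L2_set (\<lambda>j. th j - mu j) J"
  define E where "E = L2_set (\<lambda>j. th' j - th j) J + L2_set (\<lambda>j. mu' j - mu j) J"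
  define a where "a = (\<Sum>j\<in>J. v j * (th j - b j)) / L2_set v J"
  define a' where "a' = - (\<Sum>j\<in>J. v j * (mu j - b j)) / L2_set v J"
  note geo = plugin_geometry[OF J, where th=th and mu=mu and th'=th' and mu'=mu', folded v_def b_def, folded D_def E_def a_def a'_def]
  let ?X = "\<lambda>\<omega>. \<Sum>j\<in>J. v j * wiener_int (e j) (W \<omega>)"
  have Xm[measurable]: "?X \<in> borel_measurable M"
    using wiener_int_sq(1)[OF e] by (intro borel_measurable_sum borel_measurable_times) (auto simp: sq_integrable_def)
  have H: "H c \<omega> \<longleftrightarrow> - (\<Sum>j\<in>J. v j * (c j - b j)) \<le> ?X \<omega>" for c \<omega>
    unfolding H_def L2_set_le_iff v_def[symmetric] b_def[symmetric]
    by (simp add: distrib_left right_diff_distrib sum.distrib sum_subtractf algebra_simps)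
  have risk: "(prob {\<omega> \<in> space M. \<not> H th \<omega>} + prob {\<omega> \<in> space M. H mu \<omega>}) / 2 = (normal_tail a + normal_tail a') / 2"
  proof (cases "L2_set v J = 0")
    \<comment> \<open>For equal estimates the tie is decided in favour of label 1, so the two errors
      are 0 and 1. Their average 1/2 is the tail at 0, and division by 0 sets a = a' = 0.\<close>
    case True
    then have v0: "\<And>j. j \<in> J \<Longrightarrow> v j = 0" using J by (simp add: L2_set_eq_0_iff)
    then have "H c \<omega>" for c \<omega> unfolding H by simp
    then have "prob {\<omega> \<in> space M. \<not> H th \<omega>} = 0" "prob {\<omega> \<in> space M. H mu \<omega>} = 1" by (auto simp: prob_space)
    moreover have "normal_tail 0 = 1 / 2" using normal_tail_minus[of 0] by simp
    ultimately show ?thesis using True by (simp add: a_def a'_def)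
  next
    case False
    then have pos: "(\<Sum>j\<in>J. (v j)\<^sup>2) > 0" unfolding L2_set_def by (simp add: sum_nonneg order.strict_iff_order)
    have tail: "prob {\<omega> \<in> space M. x \<le> ?X \<omega>} = normal_tail (x / L2_set v J)" for x
      unfolding L2_set_def by (rule prob_wiener_ge[OF J e orth pos])
    have "prob {\<omega> \<in> space M. \<not> H th \<omega>} = 1 - prob {\<omega> \<in> space M. H th \<omega>}"
      unfolding H by (rule prob_neg) measurable
    also have "prob {\<omega> \<in> space M. H th \<omega>} = normal_tail (- a)" unfolding H tail a_def by simp
    finally have 1: "prob {\<omega> \<in> space M. \<not> H th \<omega>} = normal_tail a" by (simp add: normal_tail_minus)
    have "prob {\<omega> \<in> space M. H mu \<omega>} = normal_tail a'" unfolding H tail a'_def by simp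
    then show ?thesis using 1 by simp
  qed
  have sq: "(L2_set x J)\<^sup>2 = (\<Sum>j\<in>J. (x j)\<^sup>2)" for x :: "nat \<Rightarrow> real" by (simp add: L2_set_def sum_nonneg)
  have "(normal_tail a + normal_tail a') / 2 - normal_tail (\<delta> / 2) \<le> 100 * ((\<rho>\<^sup>2 + E\<^sup>2) / max \<delta> \<rho>)"
  proof (rule excess_risk_scalar[OF refl geo(1) geo(2) _ _ geo(3) \<rho>])
    show "D \<le> \<delta>" using le d0 unfolding D_def by (rule_tac power2_le_imp_le) (simp_all add: sq)
    show "\<delta>\<^sup>2 - D\<^sup>2 \<le> 4 * \<rho>\<^sup>2" using bias unfolding D_def by (simp add: sq)
  qed
  also have "\<dots> \<le> 100 * ((\<rho>\<^sup>2 + 2 * ((\<Sum>j\<in>J. (th' j - th j)\<^sup>2) + (\<Sum>j\<in>J. (mu' j - mu j)\<^sup>2))) / max \<delta> \<rho>)"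
  proof (intro mult_left_mono divide_right_mono add_left_mono)
    show "E\<^sup>2 \<le> 2 * ((\<Sum>j\<in>J. (th' j - th j)\<^sup>2) + (\<Sum>j\<in>J. (mu' j - mu j)\<^sup>2))"
      unfolding E_def sq[symmetric] using zero_le_power2[of "L2_set (\<lambda>j. th' j - th j) J - L2_set (\<lambda>j. mu' j - mu j) J"]
      by (simp add: power2_eq_square algebra_simps)
  qed (use \<rho> in auto)
  finally show ?thesis unfolding risk by (simp only: diff_le_eq add.commute)
qed

section \<open>The experiment: labels, noise and class sizes\<close>

locale bm_experiment = prob_space M + L2_basis \<phi>
  for M :: "'a measure" and \<phi> +
  fixes n :: nat and W :: "nat \<Rightarrow> 'a \<Rightarrow> real \<Rightarrow> real" and Y :: "nat \<Rightarrow> 'a \<Rightarrow> bool" and f g :: "real \<Rightarrow> real"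
  assumes model: "bm_model M n W Y"
    and f: "sq_integrable unit_leb f" and g: "sq_integrable unit_leb g"
begin

abbreviation T :: "((real \<Rightarrow> real) \<times> bool) measure" where "T \<equiv> traj_space \<Otimes>\<^sub>M count_space UNIV"

definition path :: "nat \<Rightarrow> 'a \<Rightarrow> real \<Rightarrow> real" where "path i \<omega> = restrict (W i \<omega>) {0..1}"

text \<open>Almost surely the deviation of the j-th coefficient of observation i from its class
  mean.\<close>

definition noise :: "nat \<Rightarrow> nat \<Rightarrow> 'a \<Rightarrow> real" where "noise i j \<omega> = wiener_int (\<phi> j) (W i \<omega>)"

lemma brownian_W: "i \<le> n \<Longrightarrow> brownian M (W i)"
  using model by (auto simp: bm_model_def brownian_def brownian_axioms_def)

lemma Y_measurable: "i \<le> n \<Longrightarrow> Y i \<in> measurable M (count_space UNIV)"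
  using model by (auto simp: bm_model_def)

lemma Y_half: "i \<le> n \<Longrightarrow> prob {\<omega> \<in> space M. Y i \<omega>} = 1/2"
  using model by (auto simp: bm_model_def)

lemma Y_half_not: "i \<le> n \<Longrightarrow> prob {\<omega> \<in> space M. \<not> Y i \<omega>} = 1/2"
proof -
  assume i: "i \<le> n"
  note [measurable] = Y_measurable[OF i]
  have "prob {\<omega> \<in> space M. \<not> Y i \<omega>} = 1 - prob {\<omega> \<in> space M. Y i \<omega>}" by (rule prob_neg) measurable
  then show ?thesis using Y_half[OF i] by simp
qed

lemma path_measurable: "i \<le> n \<Longrightarrow> path i \<in> measurable M traj_space"
  using brownian.path_measurable[OF brownian_W] by (simp add: path_def[abs_def])

lemma data_indep: "indep_vars (\<lambda>_. T) (\<lambda>i \<omega>. (path i \<omega>, Y i \<omega>)) {..n}"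
  using model by (auto simp: bm_model_def path_def)

lemma path_label_indep:
  assumes "i \<le> n"
  shows "indep_set {path i -` A \<inter> space M | A. A \<in> sets traj_space} {Y i -` B \<inter> space M | B. B \<in> sets (count_space (UNIV::bool set))}"
  using model assms unfolding bm_model_def indep_set_def path_def[abs_def] by blast

text \<open>Independence gives products of probabilities on the events that fix the label, and each
  label has probability 1/2. The error probability for a frozen sample takes this form, with error
  sets A1 and A0 that depend on the label.\<close>

lemma label_split:
  assumes i: "i \<le> n" and A: "A1 \<in> sets traj_space" "A0 \<in> sets traj_space"
  shows "prob {\<omega> \<in> space M. if Y i \<omega> then path i \<omega> \<in> A1 else path i \<omega> \<in> A0} =
    (prob {\<omega> \<in> space M. path i \<omega> \<in> A1} + prob {\<omega> \<in> space M. path i \<omega> \<in> A0}) / 2"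
proof -
  note [measurable] = Y_measurable[OF i] path_measurable[OF i] A
  have pr: "prob ((path i -` A \<inter> space M) \<inter> (Y i -` B \<inter> space M)) = prob (path i -` A \<inter> space M) * prob (Y i -` B \<inter> space M)"
    if "A \<in> sets traj_space" for A B
    by (rule path_label_indep[OF i, unfolded indep_sets2_eq, THEN conjunct2, THEN conjunct2, rule_format]) (use that in auto)
  have s1: "(path i -` A1 \<inter> space M) \<inter> (Y i -` {True} \<inter> space M) = {\<omega> \<in> space M. path i \<omega> \<in> A1 \<and> Y i \<omega>}"
    and s0: "(path i -` A0 \<inter> space M) \<inter> (Y i -` {False} \<inter> space M) = {\<omega> \<in> space M. path i \<omega> \<in> A0 \<and> \<not> Y i \<omega>}"
    and y1: "Y i -` {True} \<inter> space M = {\<omega> \<in> space M. Y i \<omega>}" and y0: "Y i -` {False} \<inter> space M = {\<omega> \<in> space M. \<not> Y i \<omega>}"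
    and p: "path i -` A \<inter> space M = {\<omega> \<in> space M. path i \<omega> \<in> A}" for A
    by auto
  have "prob {\<omega> \<in> space M. if Y i \<omega> then path i \<omega> \<in> A1 else path i \<omega> \<in> A0} =
    prob ({\<omega> \<in> space M. path i \<omega> \<in> A1 \<and> Y i \<omega>} \<union> {\<omega> \<in> space M. path i \<omega> \<in> A0 \<and> \<not> Y i \<omega>})"
    by (intro arg_cong[where f=prob]) auto
  also have "\<dots> = prob {\<omega> \<in> space M. path i \<omega> \<in> A1 \<and> Y i \<omega>} + prob {\<omega> \<in> space M. path i \<omega> \<in> A0 \<and> \<not> Y i \<omega>}"
    by (rule finite_measure_Union) auto
  finally show ?thesis
    using pr[OF A(1), of "{True}"] pr[OF A(2), of "{False}"]
    unfolding s1 s0 unfolding y1 y0 p Y_half[OF i] Y_half_not[OF i] by simp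
qed

text \<open>The model states independence for families of preimages. Both families are stable under
  intersection, so it extends to the generated sigma-algebras and from there to functions of path
  and label.\<close>

lemma label_mult_expectation:
  fixes p :: "bool \<Rightarrow> real" and q :: "(real \<Rightarrow> real) \<Rightarrow> real"
  assumes i: "i \<le> n" and q: "q \<in> borel_measurable traj_space" and int: "integrable M (\<lambda>\<omega>. q (path i \<omega>))"
  shows "expectation (\<lambda>\<omega>. p (Y i \<omega>) * q (path i \<omega>)) = expectation (\<lambda>\<omega>. p (Y i \<omega>)) * expectation (\<lambda>\<omega>. q (path i \<omega>))"
proof -
  note [measurable] = Y_measurable[OF i] path_measurable[OF i] q
  let ?A = "{path i -` A \<inter> space M | A. A \<in> sets traj_space}" and ?B = "{Y i -` B \<inter> space M | B. B \<in> sets (count_space (UNIV::bool set))}"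
  have "Int_stable ?A"
  proof (rule Int_stableI)
    fix a b assume "a \<in> ?A" "b \<in> ?A"
    then obtain A B where "a = path i -` A \<inter> space M" "b = path i -` B \<inter> space M" "A \<in> sets traj_space" "B \<in> sets traj_space" by blast
    then show "a \<inter> b \<in> ?A" by (intro CollectI exI[of _ "A \<inter> B"]) auto
  qed
  moreover have "Int_stable ?B"
  proof (rule Int_stableI)
    fix a b assume "a \<in> ?B" "b \<in> ?B"
    then obtain A B where "a = Y i -` A \<inter> space M" "b = Y i -` B \<inter> space M" by blast
    then show "a \<inter> b \<in> ?B" by (intro CollectI exI[of _ "A \<inter> B"]) auto
  qed
  ultimately have "indep_set (sigma_sets (space M) ?A) (sigma_sets (space M) ?B)"
    by (intro indep_set_sigma_sets path_label_indep[OF i])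
  then have "indep_set (sigma_sets (space M) {(\<lambda>\<omega>. q (path i \<omega>)) -` A \<inter> space M | A. A \<in> sets borel})
     (sigma_sets (space M) {(\<lambda>\<omega>. p (Y i \<omega>)) -` A \<inter> space M | A. A \<in> sets borel})"
    unfolding indep_set_def
  proof (rule indep_sets_mono_sets)
    have "{(\<lambda>\<omega>. q (path i \<omega>)) -` A \<inter> space M | A. A \<in> sets borel} \<subseteq> ?A"
    proof safe
      fix A :: "real set" assume "A \<in> sets borel"
      then have "q -` A \<inter> space traj_space \<in> sets traj_space" using q by measurable
      moreover have "(\<lambda>\<omega>. q (path i \<omega>)) -` A \<inter> space M = path i -` (q -` A \<inter> space traj_space) \<inter> space M"
        using measurable_space[OF path_measurable[OF i]] by auto
      ultimately show "\<exists>B. (\<lambda>\<omega>. q (path i \<omega>)) -` A \<inter> space M = path i -` B \<inter> space M \<and> B \<in> sets traj_space" by blast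
    qed
    moreover have "{(\<lambda>\<omega>. p (Y i \<omega>)) -` A \<inter> space M | A. A \<in> sets borel} \<subseteq> ?B"
    proof safe
      fix A :: "real set" assume "A \<in> sets borel"
      have "(\<lambda>\<omega>. p (Y i \<omega>)) -` A \<inter> space M = Y i -` (p -` A) \<inter> space M" by auto
      then show "\<exists>B. (\<lambda>\<omega>. p (Y i \<omega>)) -` A \<inter> space M = Y i -` B \<inter> space M \<and> B \<in> sets (count_space (UNIV::bool set))" by auto
    qed
    ultimately show "case_bool (sigma_sets (space M) {(\<lambda>\<omega>. q (path i \<omega>)) -` A \<inter> space M | A. A \<in> sets borel})
        (sigma_sets (space M) {(\<lambda>\<omega>. p (Y i \<omega>)) -` A \<inter> space M | A. A \<in> sets borel}) b
      \<subseteq> case_bool (sigma_sets (space M) ?A) (sigma_sets (space M) ?B) b" for b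
      by (cases b) (auto simp del: subset_iff intro!: sigma_sets_mono')
  qed
  then have ind: "indep_var borel (\<lambda>\<omega>. q (path i \<omega>)) borel (\<lambda>\<omega>. p (Y i \<omega>))"
    unfolding indep_var_eq by simp
  have pb: "integrable M (\<lambda>\<omega>. p (Y i \<omega>))"
    by (rule integrable_const_bound[where B="max \<bar>p True\<bar> \<bar>p False\<bar>"]) (auto intro!: AE_I2 split: bool.split, metis (full_types) max.cobounded1 max.cobounded2)
  show ?thesis using indep_var_lebesgue_integral[OF ind int pb] by (simp add: mult.commute)
qed

lemma noise_path: "noise i j \<omega> = wiener_int (\<phi> j) (path i \<omega>)"
  by (simp add: noise_def path_def wiener_int_restrict)

lemma noise_sq: "i \<le> n \<Longrightarrow> j \<ge> 1 \<Longrightarrow> sq_integrable M (noise i j)"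
  unfolding noise_def[abs_def] by (intro brownian.wiener_int_sq[OF brownian_W] phi_sq)

lemma noise_moments:
  assumes "i \<le> n" "j \<ge> 1"
  shows "expectation (noise i j) = 0" "expectation (\<lambda>\<omega>. (noise i j \<omega>)\<^sup>2) = 1"
  using brownian.wiener_int_moments[OF brownian_W[OF assms(1)] phi_sq[OF assms(2)]] phi_orth[OF assms(2) assms(2)]
  by (simp_all add: noise_def[abs_def] power2_eq_square)

text \<open>Multiplying the noise by a label indicator keeps it centred, since label and path are
  independent, and keeps it independent across i. The n summands are thus orthogonal, each with
  second moment at most 1, and the random class size never enters.\<close>

lemma label_noise_second_moment:
  fixes p :: "bool \<Rightarrow> bool"
  assumes j: "j \<ge> 1"
  shows "sq_integrable M (\<lambda>\<omega>. \<Sum>i=1..n. if p (Y i \<omega>) then noise i j \<omega> else 0)"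
    "expectation (\<lambda>\<omega>. (\<Sum>i=1..n. if p (Y i \<omega>) then noise i j \<omega> else 0)\<^sup>2) \<le> real n"
proof -
  let ?X = "\<lambda>i \<omega>. of_bool (p (Y i \<omega>)) * noise i j \<omega>"
  have X_eq: "(\<Sum>i=1..n. if p (Y i \<omega>) then noise i j \<omega> else 0) = (\<Sum>i\<in>{1..n}. ?X i \<omega>)" for \<omega>
    by (intro sum.cong refl) auto
  have sq: "sq_integrable M (?X i)" if i: "i \<in> {1..n}" for i
  proof -
    have [measurable]: "Y i \<in> measurable M (count_space UNIV)" using i by (intro Y_measurable) simp
    have [measurable]: "noise i j \<in> borel_measurable M" using noise_sq[of i j] i j by (simp add: sq_integrable_def)
    have "integrable M (\<lambda>\<omega>. (?X i \<omega>)\<^sup>2)"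
    proof (rule Bochner_Integration.integrable_bound[where f="\<lambda>\<omega>. (noise i j \<omega>)\<^sup>2"])
      show "integrable M (\<lambda>\<omega>. (noise i j \<omega>)\<^sup>2)" using noise_sq[of i j] i j by (simp add: sq_integrable_def)
      show "AE x in M. norm ((?X i x)\<^sup>2) \<le> norm ((noise i j x)\<^sup>2)" by (rule AE_I2) simp
    qed measurable
    then show ?thesis unfolding sq_integrable_def by simp
  qed
  show "sq_integrable M (\<lambda>\<omega>. \<Sum>i=1..n. if p (Y i \<omega>) then noise i j \<omega> else 0)"
    unfolding X_eq by (intro sq_integrable_sum sq)
  have "indep_vars (\<lambda>_. borel) (\<lambda>i \<omega>. (\<lambda>v. of_bool (p (snd v)) * wiener_int (\<phi> j) (fst v)) (path i \<omega>, Y i \<omega>)) {..n}"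
    by (rule indep_vars_compose2[OF data_indep]) measurable
  then have "indep_vars (\<lambda>_. borel) ?X {..n}" by (simp only: noise_path fst_conv snd_conv)
  then have ind: "indep_vars (\<lambda>_. borel) ?X {1..n}" by (rule indep_vars_subset) auto
  have "expectation (\<lambda>\<omega>. (\<Sum>i\<in>{1..n}. ?X i \<omega>)\<^sup>2) = (\<Sum>i\<in>{1..n}. expectation (\<lambda>\<omega>. (?X i \<omega>)\<^sup>2))"
  proof (rule indep_sum_second_moment[OF _ ind sq])
    fix i assume i: "i \<in> {1..n}"
    then show "expectation (?X i) = 0"
      using label_mult_expectation[of i "wiener_int (\<phi> j)" "\<lambda>b. of_bool (p b)"] noise_sq[of i j] noise_moments(1)[of i j] j
      by (simp add: noise_path[symmetric] sq_integrable_imp_integrable)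
  qed auto
  also have "\<dots> \<le> (\<Sum>i\<in>{1..n}. 1)"
  proof (rule sum_mono)
    fix i assume i: "i \<in> {1..n}"
    have "expectation (\<lambda>\<omega>. (?X i \<omega>)\<^sup>2) \<le> expectation (\<lambda>\<omega>. (noise i j \<omega>)\<^sup>2)"
      using sq[OF i] noise_sq[of i j] i j by (intro integral_mono) (auto simp: sq_integrable_def)
    then show "expectation (\<lambda>\<omega>. (?X i \<omega>)\<^sup>2) \<le> 1" using noise_moments(2)[of i j] i j by simp
  qed
  finally show "expectation (\<lambda>\<omega>. (\<Sum>i=1..n. if p (Y i \<omega>) then noise i j \<omega> else 0)\<^sup>2) \<le> real n"
    unfolding X_eq by simp
qed

definition bad :: "'a set" where
  "bad = {\<omega> \<in> space M. (\<Sum>i=1..n. if Y i \<omega> then 1 else 0) < real n / 4 \<or> (\<Sum>i=1..n. if \<not> Y i \<omega> then 1 else 0) < real n / 4}"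

lemma bad_events: "bad \<in> events"
proof -
  have [measurable]: "Measurable.pred M (Y i)" if "i \<in> {1..n}" for i using that Y_measurable[of i] by simp
  show ?thesis unfolding bad_def by measurable
qed

text \<open>The class sizes add up to n, so if one of them is below n / 4, the count of label 1
  deviates from n / 2 by at least n / 4. Its variance is n / 4, and Chebyshev's inequality gives (n
  / 4) / (n / 4)^2.\<close>

lemma prob_bad:
  assumes n: "n > 0"
  shows "prob bad \<le> 4 / real n"
proof -
  let ?X = "\<lambda>i \<omega>. of_bool (Y i \<omega>) - 1/2 :: real"
  let ?S = "\<lambda>\<omega>. \<Sum>i\<in>{1..n}. ?X i \<omega>"
  have Ym: "Y i \<in> measurable M (count_space UNIV)" if "i \<in> {1..n}" for i using that Y_measurable[of i] by simp
  have sq: "sq_integrable M (?X i)" if i: "i \<in> {1..n}" for i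
    by (rule sq_integrable_bounded[where K=1]) (use Ym[OF i] in auto)
  have "indep_vars (\<lambda>_. borel) (\<lambda>i \<omega>. (\<lambda>v. of_bool (snd v) - 1/2 :: real) (path i \<omega>, Y i \<omega>)) {..n}"
    by (rule indep_vars_compose2[OF data_indep]) measurable
  then have "indep_vars (\<lambda>_. borel) ?X {..n}" by (simp only: snd_conv)
  then have ind: "indep_vars (\<lambda>_. borel) ?X {1..n}" by (rule indep_vars_subset) auto
  have mean: "expectation (?X i) = 0" if i: "i \<in> {1..n}" for i
  proof -
    note [measurable] = Ym[OF i]
    have "expectation (\<lambda>\<omega>. of_bool (Y i \<omega>)) = expectation (indicat_real {\<omega> \<in> space M. Y i \<omega>})"
      by (intro Bochner_Integration.integral_cong refl) (auto simp: indicator_def)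
    also have "\<dots> = 1/2" using Y_half[of i] i by simp
    finally show ?thesis
      using sq_integrable_imp_integrable[OF sq_integrable_bounded[of "\<lambda>\<omega>. of_bool (Y i \<omega>)" 1]] by (simp add: prob_space)
  qed
  have "expectation (\<lambda>\<omega>. (?S \<omega>)\<^sup>2) = (\<Sum>i\<in>{1..n}. expectation (\<lambda>\<omega>. (?X i \<omega>)\<^sup>2))"
    by (rule indep_sum_second_moment[OF _ ind sq mean]) auto
  also have "\<dots> = (\<Sum>i\<in>{1..n}. 1/4)"
  proof (rule sum.cong[OF refl])
    fix i
    have "(\<lambda>\<omega>. (?X i \<omega>)\<^sup>2) = (\<lambda>\<omega>. 1/4)" by (auto simp: of_bool_def power2_eq_square)
    then show "expectation (\<lambda>\<omega>. (?X i \<omega>)\<^sup>2) = 1/4" by (simp add: prob_space)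
  qed
  finally have ES: "expectation (\<lambda>\<omega>. (?S \<omega>)\<^sup>2) = real n / 4" by simp
  have intS: "integrable M (\<lambda>\<omega>. (?S \<omega>)\<^sup>2)" by (intro sq_integrable_square sq_integrable_sum sq)
  have "bad \<subseteq> {\<omega> \<in> space M. (real n / 4)\<^sup>2 \<le> (?S \<omega>)\<^sup>2}"
  proof
    fix \<omega> assume w: "\<omega> \<in> bad"
    have 1: "?S \<omega> = (\<Sum>i=1..n. if Y i \<omega> then 1 else 0) - real n / 2"
      by (simp add: sum_subtractf of_bool_def)
    have "(\<Sum>i=1..n. if Y i \<omega> then 1 else 0) + (\<Sum>i=1..n. if \<not> Y i \<omega> then 1 else 0) = (\<Sum>i=1..n. 1::real)"
      unfolding sum.distrib[symmetric] by (intro sum.cong) auto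
    then have "real n / 4 \<le> \<bar>?S \<omega>\<bar>" using w 1 unfolding bad_def by auto
    then have "(real n / 4)\<^sup>2 \<le> (?S \<omega>)\<^sup>2" using n by (subst abs_le_square_iff[symmetric]) auto
    then show "\<omega> \<in> {\<omega> \<in> space M. (real n / 4)\<^sup>2 \<le> (?S \<omega>)\<^sup>2}" using w by (simp add: bad_def)
  qed
  then have "prob bad \<le> prob {\<omega> \<in> space M. (real n / 4)\<^sup>2 \<le> (?S \<omega>)\<^sup>2}"
    using intS by (intro finite_measure_mono) auto
  also have "\<dots> \<le> expectation (\<lambda>\<omega>. (?S \<omega>)\<^sup>2) / (real n / 4)\<^sup>2"
    using n intS by (intro integral_Markov_inequality_measure[where A="{}"]) auto
  also have "\<dots> = 4 / real n" unfolding ES using n by (simp add: power2_eq_square field_simps)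
  finally show ?thesis .
qed

end

section \<open>Excess risk of the plug-in classifier\<close>

lemma shift_path_restrict: "shift_path h (restrict x {0..1}) = shift_path h x"
  unfolding shift_path_def by (intro restrict_ext) auto

context bm_experiment
begin

text \<open>With A the set of paths labelled 1 for a frozen sample, the conditional risk is (1 -
  P_f(A) + P_g(A)) / 2, and \<open>path_tv\<close> bounds P_f(A) - P_g(A). The bound holds for every
  value of the sample, so integration over the sample preserves it.\<close>

lemma opt_risk_ge:
  "normal_tail (sqrt (\<integral>x. (f x - g x)\<^sup>2 \<partial>unit_leb) / 2) \<le> opt_risk M n (\<lambda>i. obs_path f g (W i) (Y i)) Y"
  unfolding opt_risk_def
proof (rule cINF_greatest)
  show "measurable (classifier_space n) (count_space (UNIV :: bool set)) \<noteq> {}"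
  proof -
    have "(\<lambda>_. True) \<in> measurable (classifier_space n) (count_space UNIV)" by simp
    then show ?thesis by blast
  qed
  fix \<Phi> :: "(nat \<Rightarrow> (real \<Rightarrow> real) \<times> bool) \<times> (real \<Rightarrow> real) \<Rightarrow> bool"
  assume Phi[measurable]: "\<Phi> \<in> measurable (classifier_space n) (count_space UNIV)"
  let ?K = "normal_tail (sqrt (\<integral>x. (f x - g x)\<^sup>2 \<partial>unit_leb) / 2)"
  \<comment> \<open>Rebuilds an observation from its driving path and label, so that
    misclassification becomes an event about the independent pairs \<open>V i\<close>.\<close>
  define obs where "obs v = (if snd v then shift_path f (fst v) else shift_path g (fst v))" for v :: "(real \<Rightarrow> real) \<times> bool"
  define V where "V i \<omega> = (path i \<omega>, Y i \<omega>)" for i \<omega>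
  define P where "P s v \<longleftrightarrow> \<Phi> ((\<lambda>i\<in>{1..n}. (obs (s i), snd (s i))), obs v) \<noteq> snd v" for s v
  have obs[measurable]: "obs \<in> measurable T traj_space" unfolding obs_def by measurable
  have obs_V: "obs_path f g (W i) (Y i) \<omega> = obs (V i \<omega>)" for i \<omega>
    unfolding obs_def V_def path_def fst_conv snd_conv shift_path_restrict
    by (simp add: shift_path_def obs_path_def)
  have sd: "\<Phi> (sample_data n (\<lambda>i. obs_path f g (W i) (Y i)) Y \<omega>) \<noteq> Y 0 \<omega> \<longleftrightarrow> P (\<lambda>i\<in>{1..n}. V i \<omega>) (V 0 \<omega>)" for \<omega>
  proof -
    have "sample_data n (\<lambda>i. obs_path f g (W i) (Y i)) Y \<omega> =
      ((\<lambda>i\<in>{1..n}. (obs ((\<lambda>i\<in>{1..n}. V i \<omega>) i), snd ((\<lambda>i\<in>{1..n}. V i \<omega>) i))), obs (V 0 \<omega>))"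
      unfolding sample_data_def obs_V by (auto simp: V_def fun_eq_iff restrict_def)
    then show ?thesis unfolding P_def by (simp add: V_def)
  qed
  have cm: "(\<lambda>s. \<lambda>i\<in>{1..n}. (obs (s i), snd (s i))) \<in> measurable (\<Pi>\<^sub>M i\<in>{1..n}. T) (\<Pi>\<^sub>M i\<in>{1..n}. T)"
  proof (intro measurable_restrict)
    fix i assume "i \<in> {1..n}"
    then have c: "(\<lambda>s. s i) \<in> measurable (\<Pi>\<^sub>M i\<in>{1..n}. T) T" by (rule measurable_component_singleton)
    show "(\<lambda>s. (obs (s i), snd (s i))) \<in> measurable (\<Pi>\<^sub>M i\<in>{1..n}. T) T"
      by (intro measurable_Pair measurable_compose[OF c obs] measurable_compose[OF c measurable_snd])
  qed
  have Pm: "{x \<in> space ((\<Pi>\<^sub>M i\<in>{1..n}. T) \<Otimes>\<^sub>M T). P (fst x) (snd x)} \<in> sets ((\<Pi>\<^sub>M i\<in>{1..n}. T) \<Otimes>\<^sub>M T)"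
  proof -
    have [measurable]: "(\<lambda>x. \<Phi> ((\<lambda>i\<in>{1..n}. (obs (fst x i), snd (fst x i))), obs (snd x))) \<in> measurable ((\<Pi>\<^sub>M i\<in>{1..n}. T) \<Otimes>\<^sub>M T) (count_space UNIV)"
      by (rule measurable_compose[OF _ Phi], unfold classifier_space_def)
         (intro measurable_Pair measurable_compose[OF measurable_fst cm] measurable_compose[OF measurable_snd obs])
    show ?thesis unfolding P_def by measurable
  qed
  have ind: "indep_vars (\<lambda>_. T) V {..n}" using data_indep by (simp add: V_def[abs_def])
  have sec: "?K \<le> prob {\<omega> \<in> space M. P (\<lambda>i\<in>{1..n}. V i \<omega>') (V 0 \<omega>)}" if w: "\<omega>' \<in> space M" for \<omega>'
  proof -
    interpret B: brownian M "W 0" by (rule brownian_W) simp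
    define s where "s = (\<lambda>i\<in>{1..n}. (obs ((\<lambda>i\<in>{1..n}. V i \<omega>') i), snd ((\<lambda>i\<in>{1..n}. V i \<omega>') i)))"
    have Vm: "V i \<in> measurable M T" if "i \<le> n" for i
      unfolding V_def[abs_def] using path_measurable[OF that] Y_measurable[OF that] by measurable
    have "(\<lambda>i\<in>{1..n}. V i \<omega>') \<in> space (\<Pi>\<^sub>M i\<in>{1..n}. T)"
      using w Vm by (auto simp: space_PiM intro!: measurable_space[OF Vm])
    then have sS: "s \<in> space (\<Pi>\<^sub>M i\<in>{1..n}. T)" unfolding s_def by (rule measurable_space[OF cm])
    define A where "A = {x \<in> space traj_space. \<Phi> (s, x)}"
    have [measurable]: "(\<lambda>x. \<Phi> (s, x)) \<in> measurable traj_space (count_space UNIV)"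
      by (rule measurable_compose[OF measurable_Pair1'[OF sS] Phi[unfolded classifier_space_def]])
    have A: "A \<in> sets traj_space" unfolding A_def by measurable
    let ?A1 = "{x \<in> space traj_space. shift_path f x \<notin> A}" and ?A0 = "{x \<in> space traj_space. shift_path g x \<in> A}"
    have A10: "?A1 \<in> sets traj_space" "?A0 \<in> sets traj_space" using A by measurable
    have ps: "path 0 \<omega> \<in> space traj_space" if "\<omega> \<in> space M" for \<omega> by (rule measurable_space[OF path_measurable that]) simp
    have ss: "shift_path h x \<in> space traj_space" if "x \<in> space traj_space" for h x by (rule measurable_space[OF shift_path_measurable that])
    have "{\<omega> \<in> space M. P (\<lambda>i\<in>{1..n}. V i \<omega>') (V 0 \<omega>)} = {\<omega> \<in> space M. if Y 0 \<omega> then path 0 \<omega> \<in> ?A1 else path 0 \<omega> \<in> ?A0}"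
      unfolding P_def s_def[symmetric] using ps ss by (auto simp: A_def obs_def V_def)
    then have "prob {\<omega> \<in> space M. P (\<lambda>i\<in>{1..n}. V i \<omega>') (V 0 \<omega>)} = (prob {\<omega> \<in> space M. path 0 \<omega> \<in> ?A1} + prob {\<omega> \<in> space M. path 0 \<omega> \<in> ?A0}) / 2"
      using label_split[OF _ A10, of 0] by simp
    also have "prob {\<omega> \<in> space M. path 0 \<omega> \<in> ?A0} = prob {\<omega> \<in> space M. shift_path g (W 0 \<omega>) \<in> A}"
      using ps by (intro arg_cong[where f=prob]) (auto simp: path_def shift_path_restrict)
    also have "prob {\<omega> \<in> space M. path 0 \<omega> \<in> ?A1} = prob {\<omega> \<in> space M. \<not> shift_path f (W 0 \<omega>) \<in> A}"
      using ps by (intro arg_cong[where f=prob]) (auto simp: path_def shift_path_restrict)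
    also have "\<dots> = 1 - prob {\<omega> \<in> space M. shift_path f (W 0 \<omega>) \<in> A}"
      using measurable_sets[OF B.shift_measurable A] by (intro prob_neg) (simp add: vimage_def Int_def conj_commute)
    finally show ?thesis using B.path_tv[OF f g A] unfolding add_divide_distrib diff_divide_distrib by linarith
  qed
  have "ennreal ?K = (\<integral>\<^sup>+\<omega>'. ennreal ?K \<partial>M)" by (simp add: emeasure_space_1)
  also have "\<dots> \<le> (\<integral>\<^sup>+\<omega>'. ennreal (prob {\<omega> \<in> space M. P (\<lambda>i\<in>{1..n}. V i \<omega>') (V 0 \<omega>)}) \<partial>M)"
    by (intro nn_integral_mono ennreal_leI sec)
  also have "\<dots> = ennreal (prob {\<omega> \<in> space M. P (\<lambda>i\<in>{1..n}. V i \<omega>) (V 0 \<omega>)})"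
    by (rule indep_vars_split[OF ind Pm, symmetric])
  finally have "?K \<le> prob {\<omega> \<in> space M. P (\<lambda>i\<in>{1..n}. V i \<omega>) (V 0 \<omega>)}" by simp
  then show "?K \<le> measure M {\<omega> \<in> space M. \<Phi> (sample_data n (\<lambda>i. obs_path f g (W i) (Y i)) Y \<omega>) \<noteq> Y 0 \<omega>}"
    unfolding sd .
qed

text \<open>The constant is 8 + 100 (1 + 2 (16 + 16)): 8 for unbalanced labels, 100 from the scalar
  bound and 16 from the mean of each \<open>G\<close>. The assumption \<open>mx\<close> makes the
  probability 4 / n of unbalanced labels comparable to the rate.\<close>

lemma plugin_risk_le:
  assumes n: "n > 0" and \<rho>: "\<rho> > 0" and d0: "0 \<le> \<delta>"
  defines "th \<equiv> \<lambda>j. l2_inner (\<phi> j) f" and "mu \<equiv> \<lambda>j. l2_inner (\<phi> j) g"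
  assumes bias: "\<delta>\<^sup>2 - (\<Sum>j=1..d. (th j - mu j)\<^sup>2) \<le> 4 * \<rho>\<^sup>2" and le: "(\<Sum>j=1..d. (th j - mu j)\<^sup>2) \<le> \<delta>\<^sup>2"
    and dn: "real d / real n \<le> \<rho>\<^sup>2" and mx: "max \<delta> \<rho> \<le> 2 * (real n * \<rho>\<^sup>2)"
  shows "prob {\<omega> \<in> space M. hat_Phi d n Y (\<lambda>i j. stoch_int M (\<phi> j) (obs_path f g (W i) (Y i))) \<omega> \<noteq> Y 0 \<omega>}
    \<le> normal_tail (\<delta> / 2) + 6508 * (\<rho>\<^sup>2 / max \<delta> \<rho>)"
proof -
  let ?J = "{1..d}"
  define V where "V i \<omega> = (path i \<omega>, Y i \<omega>)" for i \<omega>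
  define zz where "zz v j = (if snd v then th j else mu j) + wiener_int (\<phi> j) (fst v)" for v :: "(real \<Rightarrow> real) \<times> bool" and j
  define hm where "hm b s j = label_mean n (\<lambda>i. snd (s i) = b) (\<lambda>i. zz (s i) j)" for b and s :: "nat \<Rightarrow> (real \<Rightarrow> real) \<times> bool" and j
  define P where "P s v \<longleftrightarrow> (L2_set (\<lambda>j. zz v j - hm True s j) ?J \<le> L2_set (\<lambda>j. zz v j - hm False s j) ?J) \<noteq> snd v" for s v
  have hm_restrict: "hm b (\<lambda>i\<in>{1..n}. V i \<omega>) j = label_mean n (\<lambda>i. Y i \<omega> = b) (\<lambda>i. zz (V i \<omega>) j)" for b \<omega> j
    unfolding hm_def label_mean_def by (intro arg_cong2[where f="(/)"] sum.cong) (auto simp: V_def)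
  have zm[measurable]: "(\<lambda>v. zz v j) \<in> borel_measurable T" for j unfolding zz_def by measurable
  have Pm: "{x \<in> space ((\<Pi>\<^sub>M i\<in>{1..n}. T) \<Otimes>\<^sub>M T). P (fst x) (snd x)} \<in> sets ((\<Pi>\<^sub>M i\<in>{1..n}. T) \<Otimes>\<^sub>M T)"
  proof -
    let ?S = "(\<Pi>\<^sub>M i\<in>{1..n}. T) \<Otimes>\<^sub>M T"
    have c: "(\<lambda>x. fst x i) \<in> measurable ?S T" if "i \<in> {1..n}" for i
      by (rule measurable_compose[OF measurable_fst measurable_component_singleton[OF that]])
    have c1[measurable]: "(\<lambda>x. zz (fst x i) j) \<in> borel_measurable ?S" if "i \<in> {1..n}" for i j
      by (rule measurable_compose[OF c[OF that] zm])
    have c2[measurable]: "Measurable.pred ?S (\<lambda>x. snd (fst x i) = b)" if "i \<in> {1..n}" for i b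
      using measurable_compose[OF c[OF that] measurable_snd] by measurable
    have [measurable]: "(\<lambda>x. hm b (fst x) j) \<in> borel_measurable ?S" for b j
      unfolding hm_def label_mean_def by measurable
    show ?thesis unfolding P_def L2_set_def by measurable
  qed
  have ind: "indep_vars (\<lambda>_. T) V {..n}" using data_indep by (simp add: V_def[abs_def])
  \<comment> \<open>Dominates the squared estimation error of one class when the labels are
    balanced; with its deterministic denominator it is defined and integrable over all
    outcomes.\<close>
  define G where "G p \<omega> = 16 / (real n)\<^sup>2 * (\<Sum>j=1..d. (\<Sum>i=1..n. if p (Y i \<omega>) then noise i j \<omega> else 0)\<^sup>2)" for p :: "bool \<Rightarrow> bool" and \<omega>
  have G0: "0 \<le> G p \<omega>" for p \<omega> unfolding G_def by (intro mult_nonneg_nonneg sum_nonneg) auto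
  have Gint: "integrable M (G p)" for p
    unfolding G_def by (intro integrable_mult_right Bochner_Integration.integrable_sum sq_integrable_square label_noise_second_moment) auto
  \<comment> \<open>Each of the d coordinates contributes at most n, so the mean is at most 16 d /
    n.\<close>
  have GE: "expectation (G p) \<le> 16 * \<rho>\<^sup>2" for p
  proof -
    have "expectation (G p) = 16 / (real n)\<^sup>2 * (\<Sum>j=1..d. expectation (\<lambda>\<omega>. (\<Sum>i=1..n. if p (Y i \<omega>) then noise i j \<omega> else 0)\<^sup>2))"
      unfolding G_def using label_noise_second_moment(1)[of _ p] by (simp add: sq_integrable_square Bochner_Integration.integral_sum)
    also have "\<dots> \<le> 16 / (real n)\<^sup>2 * (\<Sum>j=1..d. real n)"
      by (intro mult_left_mono sum_mono label_noise_second_moment(2)) auto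
    also have "\<dots> = 16 * (real d / real n)" using n by (simp add: power2_eq_square field_simps)
    finally show ?thesis using dn by simp
  qed
  define mxx where "mxx = max \<delta> \<rho>"
  have m0: "mxx > 0" using \<rho> by (simp add: mxx_def)
  \<comment> \<open>The indicator of \<open>bad\<close> contributes 1 there, which dominates any
    conditional error probability.\<close>
  define B where "B \<omega> = normal_tail (\<delta> / 2) + indicat_real bad \<omega> + 100 * ((\<rho>\<^sup>2 + 2 * (G (\<lambda>b. b) \<omega> + G Not \<omega>)) / mxx)" for \<omega>
  interpret W0: brownian M "W 0" by (rule brownian_W) simp
  have sec: "prob {\<omega> \<in> space M. P (\<lambda>i\<in>{1..n}. V i \<omega>') (V 0 \<omega>)} \<le> B \<omega>'" if w: "\<omega>' \<in> space M" for \<omega>'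
  proof (cases "\<omega>' \<in> bad")
    case True
    have "0 \<le> 100 * ((\<rho>\<^sup>2 + 2 * (G (\<lambda>b. b) \<omega>' + G Not \<omega>')) / mxx)"
      using G0 m0 by (intro mult_nonneg_nonneg divide_nonneg_pos add_nonneg_nonneg) auto
    then have "1 \<le> B \<omega>'" unfolding B_def using True normal_tail_bounds(1)[of "\<delta>/2"] by simp
    then show ?thesis using prob_le_1 order_trans by blast
  next
    case False
    then have good: "(\<Sum>i=1..n. if Y i \<omega>' then 1 else 0) \<ge> real n / 4" "(\<Sum>i=1..n. if \<not> Y i \<omega>' then 1 else 0) \<ge> real n / 4"
      using w by (auto simp: bad_def not_less)
    define th' where "th' = hm True (\<lambda>i\<in>{1..n}. V i \<omega>')"
    define mu' where "mu' = hm False (\<lambda>i\<in>{1..n}. V i \<omega>')"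
    define H where "H c x \<longleftrightarrow> L2_set (\<lambda>j. c j + wiener_int (\<phi> j) x - th' j) ?J \<le> L2_set (\<lambda>j. c j + wiener_int (\<phi> j) x - mu' j) ?J" for c :: "nat \<Rightarrow> real" and x
    have Hm[measurable]: "Measurable.pred traj_space (H c)" for c
    proof -
      have lm: "(\<lambda>x. L2_set (\<lambda>j. c j + wiener_int (\<phi> j) x - t j) ?J) \<in> borel_measurable traj_space" for t
        unfolding L2_set_def
        by (intro borel_measurable_sqrt borel_measurable_sum borel_measurable_power borel_measurable_diff borel_measurable_add borel_measurable_const wiener_int_measurable measurable_compose[OF _ borel_measurable_sqrt])
      show ?thesis unfolding H_def[abs_def] pred_def by (rule borel_measurable_le[OF lm lm])
    qed
    let ?A1 = "{x \<in> space traj_space. \<not> H th x}" and ?A0 = "{x \<in> space traj_space. H mu x}"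
    have A10: "?A1 \<in> sets traj_space" "?A0 \<in> sets traj_space" by measurable
    have ps: "path 0 \<omega> \<in> space traj_space" if "\<omega> \<in> space M" for \<omega> by (rule measurable_space[OF path_measurable that]) simp
    have "{\<omega> \<in> space M. P (\<lambda>i\<in>{1..n}. V i \<omega>') (V 0 \<omega>)} = {\<omega> \<in> space M. if Y 0 \<omega> then path 0 \<omega> \<in> ?A1 else path 0 \<omega> \<in> ?A0}"
      unfolding P_def th'_def[symmetric] mu'_def[symmetric] using ps by (auto simp: H_def V_def zz_def)
    then have "prob {\<omega> \<in> space M. P (\<lambda>i\<in>{1..n}. V i \<omega>') (V 0 \<omega>)} = (prob {\<omega> \<in> space M. path 0 \<omega> \<in> ?A1} + prob {\<omega> \<in> space M. path 0 \<omega> \<in> ?A0}) / 2"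
      using label_split[OF _ A10, of 0] by simp
    also have "prob {\<omega> \<in> space M. path 0 \<omega> \<in> ?A0} = prob {\<omega> \<in> space M. H mu (W 0 \<omega>)}"
      using ps by (intro arg_cong[where f=prob]) (auto simp: path_def H_def wiener_int_restrict)
    also have "prob {\<omega> \<in> space M. path 0 \<omega> \<in> ?A1} = prob {\<omega> \<in> space M. \<not> H th (W 0 \<omega>)}"
      using ps by (intro arg_cong[where f=prob]) (auto simp: path_def H_def wiener_int_restrict)
    also have "(prob {\<omega> \<in> space M. \<not> H th (W 0 \<omega>)} + prob {\<omega> \<in> space M. H mu (W 0 \<omega>)}) / 2 \<le> normal_tail (\<delta> / 2) +
      100 * ((\<rho>\<^sup>2 + 2 * ((\<Sum>j\<in>?J. (th' j - th j)\<^sup>2) + (\<Sum>j\<in>?J. (mu' j - mu j)\<^sup>2))) / max \<delta> \<rho>)"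
      unfolding H_def by (rule W0.plugin_conditional_risk) (use phi_sq phi_orth bias le d0 \<rho> in auto)
    also have "\<dots> \<le> B \<omega>'"
    proof -
      have pos: "(\<Sum>i=1..n. if Y i \<omega>' then 1 else 0) > (0::real)" "(\<Sum>i=1..n. if \<not> Y i \<omega>' then 1 else 0) > (0::real)"
        using good n by (auto intro: less_le_trans[of 0 "real n / 4"])
      have e1: "(\<Sum>j\<in>?J. (th' j - th j)\<^sup>2) \<le> G (\<lambda>b. b) \<omega>'"
        unfolding G_def sum_distrib_left
      proof (rule sum_mono)
        fix j
        have "th' j - th j = label_mean n (\<lambda>i. Y i \<omega>') (\<lambda>i. noise i j \<omega>')"
          unfolding th'_def hm_restrict using pos(1)
          by (subst label_mean_shift[where x="\<lambda>i. noise i j \<omega>'"]) (auto simp: zz_def V_def noise_path)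
        then show "(th' j - th j)\<^sup>2 \<le> 16 / (real n)\<^sup>2 * (\<Sum>i=1..n. if Y i \<omega>' then noise i j \<omega>' else 0)\<^sup>2"
          using label_mean_sq_le[OF good(1) n] by simp
      qed
      have e0: "(\<Sum>j\<in>?J. (mu' j - mu j)\<^sup>2) \<le> G Not \<omega>'"
        unfolding G_def sum_distrib_left
      proof (rule sum_mono)
        fix j
        have "mu' j - mu j = label_mean n (\<lambda>i. \<not> Y i \<omega>') (\<lambda>i. noise i j \<omega>')"
          unfolding mu'_def hm_restrict using pos(2)
          by (subst label_mean_shift[where x="\<lambda>i. noise i j \<omega>'"]) (auto simp: zz_def V_def noise_path)
        then show "(mu' j - mu j)\<^sup>2 \<le> 16 / (real n)\<^sup>2 * (\<Sum>i=1..n. if \<not> Y i \<omega>' then noise i j \<omega>' else 0)\<^sup>2"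
          using label_mean_sq_le[OF good(2) n] by simp
      qed
      have "100 * ((\<rho>\<^sup>2 + 2 * ((\<Sum>j\<in>?J. (th' j - th j)\<^sup>2) + (\<Sum>j\<in>?J. (mu' j - mu j)\<^sup>2))) / mxx) \<le> 100 * ((\<rho>\<^sup>2 + 2 * (G (\<lambda>b. b) \<omega>' + G Not \<omega>')) / mxx)"
        using e1 e0 m0 by (intro mult_left_mono divide_right_mono add_left_mono) auto
      then show ?thesis unfolding B_def mxx_def[symmetric] using False by simp
    qed
    finally show ?thesis .
  qed
  have Bint: "integrable M B"
    unfolding B_def using Gint bad_events by (intro Bochner_Integration.integrable_add integrable_mult_right integrable_divide integrable_const) (auto simp: emeasure_eq_measure)
  have B0: "0 \<le> B \<omega>" for \<omega>
    unfolding B_def using G0 m0 normal_tail_bounds(1)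
    by (intro add_nonneg_nonneg mult_nonneg_nonneg divide_nonneg_pos) auto
  have "ennreal (prob {\<omega> \<in> space M. P (\<lambda>i\<in>{1..n}. V i \<omega>) (V 0 \<omega>)}) =
    (\<integral>\<^sup>+\<omega>'. ennreal (prob {\<omega> \<in> space M. P (\<lambda>i\<in>{1..n}. V i \<omega>') (V 0 \<omega>)}) \<partial>M)"
    by (rule indep_vars_split[OF ind Pm])
  also have "\<dots> \<le> (\<integral>\<^sup>+\<omega>'. ennreal (B \<omega>') \<partial>M)" by (intro nn_integral_mono ennreal_leI sec)
  also have "\<dots> = ennreal (expectation B)" using Bint B0 by (intro nn_integral_eq_integral) auto
  finally have "prob {\<omega> \<in> space M. P (\<lambda>i\<in>{1..n}. V i \<omega>) (V 0 \<omega>)} \<le> expectation B"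
    using B0 by (subst (asm) ennreal_le_iff) (auto intro!: Bochner_Integration.integral_nonneg)
  also have "expectation B = normal_tail (\<delta> / 2) + prob bad + 100 * ((\<rho>\<^sup>2 + 2 * (expectation (G (\<lambda>b. b)) + expectation (G Not))) / mxx)"
    unfolding B_def using Gint bad_events by (simp add: prob_space emeasure_eq_measure)
  also have "\<dots> \<le> normal_tail (\<delta> / 2) + 8 * (\<rho>\<^sup>2 / mxx) + 100 * ((\<rho>\<^sup>2 + 2 * (16 * \<rho>\<^sup>2 + 16 * \<rho>\<^sup>2)) / mxx)"
  proof (intro add_mono order_refl mult_left_mono divide_right_mono GE)
    have "prob bad \<le> 4 / real n" by (rule prob_bad[OF n])
    also have "\<dots> \<le> 8 * (\<rho>\<^sup>2 / mxx)" using mx n m0 by (simp add: mxx_def[symmetric] field_simps)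
    finally show "prob bad \<le> 8 * (\<rho>\<^sup>2 / mxx)" .
  qed (use m0 in auto)
  also have "\<dots> = normal_tail (\<delta> / 2) + 6508 * (\<rho>\<^sup>2 / max \<delta> \<rho>)" by (simp add: mxx_def)
  finally have main: "prob {\<omega> \<in> space M. P (\<lambda>i\<in>{1..n}. V i \<omega>) (V 0 \<omega>)} \<le> normal_tail (\<delta> / 2) + 6508 * (\<rho>\<^sup>2 / max \<delta> \<rho>)" .
  \<comment> \<open>So far the classifier was computed from coefficients built with
    \<open>wiener_int\<close>. Those given by \<open>stoch_int\<close> agree with them outside one
    null set, simultaneously for the finitely many i and j in use.\<close>
  let ?Z = "\<lambda>i j. stoch_int M (\<phi> j) (obs_path f g (W i) (Y i))"
  have Zm: "?Z i j \<in> borel_measurable M" and Zae: "AE \<omega> in M. ?Z i j \<omega> = zz (V i \<omega>) j" if "i \<le> n" "j \<ge> 1" for i j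
    using brownian.stoch_int_obs_path[OF brownian_W[OF that(1)] phi_sq[OF that(2)] f g Y_measurable[OF that(1)]]
    by (auto simp: zz_def V_def th_def mu_def path_def wiener_int_restrict)
  have "AE \<omega> in M. \<forall>i\<in>{..n}. \<forall>j\<in>?J. ?Z i j \<omega> = zz (V i \<omega>) j"
    using Zae by (intro AE_finite_allI) auto
  then have ae: "AE \<omega> in M. \<omega> \<in> {\<omega> \<in> space M. hat_Phi d n Y ?Z \<omega> \<noteq> Y 0 \<omega>} \<longleftrightarrow> \<omega> \<in> {\<omega> \<in> space M. P (\<lambda>i\<in>{1..n}. V i \<omega>) (V 0 \<omega>)}"
  proof eventually_elim
    fix \<omega> assume eq: "\<forall>i\<in>{..n}. \<forall>j\<in>?J. ?Z i j \<omega> = zz (V i \<omega>) j"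
    have lm: "label_mean n b (\<lambda>i. ?Z i j \<omega>) = label_mean n b (\<lambda>i. zz (V i \<omega>) j)" if "j \<in> ?J" for b j
      unfolding label_mean_def using eq that by (intro arg_cong2[where f="(/)"] sum.cong) auto
    have "hat_Phi d n Y ?Z \<omega> \<longleftrightarrow> L2_set (\<lambda>j. zz (V 0 \<omega>) j - hm True (\<lambda>i\<in>{1..n}. V i \<omega>) j) ?J \<le> L2_set (\<lambda>j. zz (V 0 \<omega>) j - hm False (\<lambda>i\<in>{1..n}. V i \<omega>) j) ?J"
      unfolding hat_Phi_iff hm_restrict
      using eq lm by (intro arg_cong2[where f="(\<le>)"] L2_set_cong) auto
    then show "\<omega> \<in> {\<omega> \<in> space M. hat_Phi d n Y ?Z \<omega> \<noteq> Y 0 \<omega>} \<longleftrightarrow> \<omega> \<in> {\<omega> \<in> space M. P (\<lambda>i\<in>{1..n}. V i \<omega>) (V 0 \<omega>)}"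
      unfolding P_def by (simp add: V_def)
  qed
  have Vm: "V i \<in> measurable M T" if "i \<le> n" for i
    unfolding V_def[abs_def] using path_measurable[OF that] Y_measurable[OF that] by measurable
  have e1: "{\<omega> \<in> space M. P (\<lambda>i\<in>{1..n}. V i \<omega>) (V 0 \<omega>)} \<in> events"
  proof -
    have jm: "(\<lambda>\<omega>. ((\<lambda>i\<in>{1..n}. V i \<omega>), V 0 \<omega>)) \<in> measurable M ((\<Pi>\<^sub>M i\<in>{1..n}. T) \<Otimes>\<^sub>M T)"
      by (intro measurable_Pair measurable_restrict Vm) auto
    have "(\<lambda>\<omega>. ((\<lambda>i\<in>{1..n}. V i \<omega>), V 0 \<omega>)) -` {x \<in> space ((\<Pi>\<^sub>M i\<in>{1..n}. T) \<Otimes>\<^sub>M T). P (fst x) (snd x)} \<inter> space M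
      = {\<omega> \<in> space M. P (\<lambda>i\<in>{1..n}. V i \<omega>) (V 0 \<omega>)}"
      using measurable_space[OF jm] by auto
    then show ?thesis using measurable_sets[OF jm Pm] by simp
  qed
  have e2: "{\<omega> \<in> space M. hat_Phi d n Y ?Z \<omega> \<noteq> Y 0 \<omega>} \<in> events"
  proof -
    have [measurable]: "?Z i j \<in> borel_measurable M" if "i \<in> {0..n}" "j \<in> ?J" for i j using Zm[of i j] that by simp
    have y[measurable]: "Measurable.pred M (Y i)" if "i \<in> {0..n}" for i using Y_measurable[of i] that by simp
    have [measurable]: "(\<lambda>\<omega>. label_mean n (\<lambda>i. Y i \<omega>) (\<lambda>i. ?Z i j \<omega>)) \<in> borel_measurable M"
      "(\<lambda>\<omega>. label_mean n (\<lambda>i. \<not> Y i \<omega>) (\<lambda>i. ?Z i j \<omega>)) \<in> borel_measurable M" if "j \<in> ?J" for j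
      unfolding label_mean_def using that by measurable
    have [measurable]: "Measurable.pred M (Y 0)" by (rule y) simp
    have z0[measurable]: "?Z 0 j \<in> borel_measurable M" if "j \<in> ?J" for j using Zm[of 0 j] that by simp
    have "Measurable.pred M (hat_Phi d n Y ?Z)" unfolding hat_Phi_iff[abs_def] L2_set_def by measurable
    then show ?thesis by measurable
  qed
  show ?thesis using finite_measure_eq_AE[OF ae e2 e1] main by simp
qed

end

section \<open>The choice of dimension and the final rate\<close>

theorem theorem1:
  shows "\<exists>c::real. c > 0 \<and> (\<exists>N :: real \<Rightarrow> real \<Rightarrow> nat. \<forall>s::real. \<forall>R::real. s > 0 \<and> R > 0 \<longrightarrow>
    N s R \<ge> 86 \<and>
    (\<forall>n::nat. \<forall>\<Delta>::real. n \<ge> N s R \<and> \<Delta> \<ge> 0 \<longrightarrow>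
      (\<forall>(M::'a measure) W Y \<phi> f g.
        orthonormal_basis_L2 \<phi> \<and> bm_model M n W Y \<and>
        f \<in> sobolev_class \<phi> s R \<and> g \<in> sobolev_class \<phi> s R \<and>
        l2_norm (\<lambda>t. f t - g t) \<ge> \<Delta> \<longrightarrow>
        (let X = (\<lambda>i. obs_path f g (W i) (Y i));
             Z = (\<lambda>i j. stoch_int M (\<phi> j) (X i));
             d = nat (floor ((R^2 * real n) powr (1 / (2 * s + 1))));
             r = R powr (1 / (2 * s + 1)) * real n powr (- s / (2 * s + 1)) * ln (real n)
         in measure M {\<omega> \<in> space M. hat_Phi d n Y Z \<omega> \<noteq> Y 0 \<omega>} - opt_risk M n X Y
            \<le> (if \<Delta> < r then c * r
                else c / \<Delta> * R powr (2 / (2 * s + 1)) * real n powr (- (2 * s) / (2 * s + 1)) * (ln (real n))^2)))))"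
\<comment> \<open>The choice of \<open>N\<close> makes \<open>(R\<^sup>2 n) powr (1 / (2 s + 1)) = n \<rho>\<^sup>2\<close> at least \<open>max 1 R\<close>; this absorbs the probability
  \<open>4/n\<close> of unbalanced labels, since \<open>\<delta> \<le> 2 R\<close>.\<close>
proof (intro exI[of _ "6508::real"] conjI exI[of _ "\<lambda>s R. max 86 (nat \<lceil>max 1 (R powr (2 * s + 1)) / R^2\<rceil>)"] allI impI; (elim conjE)?)
  fix s R \<Delta> :: real and n :: nat and M :: "'a measure" and W Y \<phi> f g
  assume s: "s > 0" and R: "R > 0" and nN: "n \<ge> max 86 (nat \<lceil>max 1 (R powr (2 * s + 1)) / R^2\<rceil>)" and \<Delta>: "\<Delta> \<ge> 0"
    and basis: "orthonormal_basis_L2 \<phi>" and model: "bm_model M n W Y"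
    and fS: "f \<in> sobolev_class \<phi> s R" and gS: "g \<in> sobolev_class \<phi> s R" and sep: "l2_norm (\<lambda>t. f t - g t) \<ge> \<Delta>"
  have fs: "sq_integrable unit_leb f" and gs: "sq_integrable unit_leb g" using fS gS by (auto simp: sobolev_class_def L2_01_iff)
  interpret prob_space M using model by (simp add: bm_model_def)
  interpret bm_experiment M \<phi> n W Y f g by unfold_locales fact+
  define q where "q = 2 * s + 1"
  have q: "q > 1" using s by (simp add: q_def)
  have n86: "n \<ge> 86" using nN by simp
  then have n0: "n > 0" "real n > 0" by auto
  \<comment> \<open>The dimension before rounding. It equals n \<rho>^2 (\<open>B\<rho>\<close>), so
    the variance level d / n and the squared bias are both of order \<rho>^2.\<close>
  define Bd where "Bd = (R^2 * real n) powr (1 / q)"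
  define \<rho> where "\<rho> = R powr (1 / q) * real n powr (- s / q)"
  define d where "d = nat \<lfloor>Bd\<rfloor>"
  define \<delta> where "\<delta> = l2_norm (\<lambda>t. f t - g t)"
  have \<rho>0: "\<rho> > 0" using R n0 by (simp add: \<rho>_def)
  have \<rho>2: "\<rho>\<^sup>2 = R powr (2 / q) * real n powr (- (2 * s) / q)"
    unfolding \<rho>_def power_mult_distrib using R n0 by (simp add: powr_powr mult.commute flip: powr_realpow)
  have big: "max 1 (R powr q) \<le> R^2 * real n"
  proof -
    have "max 1 (R powr q) / R^2 \<le> real n" using nN unfolding q_def by linarith
    then show ?thesis using R by (simp add: field_simps)
  qed
  have B1: "1 \<le> Bd" unfolding Bd_def using big q by (intro ge_one_powr_ge_zero) auto
  have BR: "R \<le> Bd"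
  proof -
    have "R = (R powr q) powr (1 / q)" using R q by (simp add: powr_powr)
    also have "\<dots> \<le> Bd" unfolding Bd_def using big q by (intro powr_mono2) auto
    finally show ?thesis .
  qed
  have B\<rho>: "real n * \<rho>\<^sup>2 = Bd"
  proof -
    have "R\<^sup>2 = R powr 2" using R by simp
    then have "(R\<^sup>2) powr (1 / q) = R powr (2 * (1 / q))" by (simp only: powr_powr)
    then have "Bd = R powr (2 / q) * real n powr (1 / q)"
      unfolding Bd_def by (subst powr_mult) simp_all
    also have "real n powr (1 / q) = real n powr (1 + - (2 * s) / q)"
      using q by (intro arg_cong2[where f="(powr)"] refl) (simp add: q_def field_simps)
    also have "\<dots> = real n * real n powr (- (2 * s) / q)" unfolding powr_add using n0 by simp
    finally show ?thesis unfolding \<rho>2 by simp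
  qed
  have dB: "real d \<le> Bd" "Bd < real (Suc d)" unfolding d_def using B1 by linarith+
  \<comment> \<open>As Bd powr q = R^2 n, the quantity R^2 Bd powr (-2 s) = R^2 Bd / Bd powr q
    equals Bd / n; the inequality Bd < d + 1 takes care of the rounding.\<close>
  have tail: "R\<^sup>2 * real (Suc d) powr (- 2 * s) \<le> \<rho>\<^sup>2"
  proof -
    have "real (Suc d) powr (- 2 * s) \<le> Bd powr (- 2 * s)"
      using dB B1 s by (intro powr_mono2') auto
    then have "R\<^sup>2 * real (Suc d) powr (- 2 * s) \<le> R\<^sup>2 * Bd powr (- 2 * s)" by (intro mult_left_mono) auto
    also have "Bd powr (- 2 * s) = Bd powr (1 - q)" by (simp add: q_def)
    also have "\<dots> = Bd / Bd powr q" using B1 by (simp add: powr_diff)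
    also have "Bd powr q = R\<^sup>2 * real n" unfolding Bd_def using R n0 q by (simp add: powr_powr)
    also have "R\<^sup>2 * (Bd / (R\<^sup>2 * real n)) = \<rho>\<^sup>2" unfolding B\<rho>[symmetric] using R n0 by simp
    finally show ?thesis .
  qed
  have hs: "sq_integrable unit_leb (\<lambda>t. f t - g t)" by (intro sq_integrable_diff fs gs)
  have \<delta>_eq: "\<delta> = sqrt (\<integral>x. (f x - g x)\<^sup>2 \<partial>unit_leb)"
    unfolding \<delta>_def l2_norm_def l2_inner_eq[OF hs hs] by (simp add: power2_eq_square)
  have \<delta>2: "\<delta>\<^sup>2 = (\<integral>x. (f x - g x)\<^sup>2 \<partial>unit_leb)" unfolding \<delta>_eq by simp
  have \<delta>0: "0 \<le> \<delta>" unfolding \<delta>_eq by simp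
  have "\<delta>\<^sup>2 \<le> (2 * R)\<^sup>2" using sobolev_bias(1)[OF fS gS s, of 0] unfolding \<delta>2 by (simp add: power_mult_distrib)
  \<comment> \<open>The bound on the square is \<open>sobolev_bias\<close> at d = 0, where the sum
    is empty and the weight is 1.\<close>
  then have \<delta>R: "\<delta> \<le> 2 * R" using R by (intro power2_le_imp_le[of \<delta>]) auto
  have "prob {\<omega> \<in> space M. hat_Phi d n Y (\<lambda>i j. stoch_int M (\<phi> j) (obs_path f g (W i) (Y i))) \<omega> \<noteq> Y 0 \<omega>}
    \<le> normal_tail (\<delta> / 2) + 6508 * (\<rho>\<^sup>2 / max \<delta> \<rho>)"
  proof (rule plugin_risk_le[OF n0(1) \<rho>0 \<delta>0])
    show "\<delta>\<^sup>2 - (\<Sum>j=1..d. (l2_inner (\<phi> j) f - l2_inner (\<phi> j) g)\<^sup>2) \<le> 4 * \<rho>\<^sup>2"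
      using sobolev_bias(1)[OF fS gS s, of d] tail unfolding \<delta>2 by linarith
    show "(\<Sum>j=1..d. (l2_inner (\<phi> j) f - l2_inner (\<phi> j) g)\<^sup>2) \<le> \<delta>\<^sup>2"
      using sobolev_bias(2)[OF fS gS s, of d] unfolding \<delta>2 .
    show "real d / real n \<le> \<rho>\<^sup>2" using dB(1) n0 unfolding B\<rho>[symmetric] by (simp add: field_simps)
    \<comment> \<open>If \<rho> > 1 then \<rho> \<le> \<rho>^2 \<le> n \<rho>^2 = Bd.\<close>
    have "\<rho> \<le> 2 * Bd"
    proof (cases "\<rho> \<le> 1")
      case True then show ?thesis using B1 by linarith
    next
      case False
      then have "\<rho> * 1 \<le> \<rho> * \<rho>" using \<rho>0 by (intro mult_left_mono) auto
      moreover have "1 * \<rho>\<^sup>2 \<le> real n * \<rho>\<^sup>2" using n86 by (intro mult_right_mono) auto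
      ultimately show ?thesis unfolding B\<rho> using B1 by (simp add: power2_eq_square)
    qed
    then show "max \<delta> \<rho> \<le> 2 * (real n * \<rho>\<^sup>2)" unfolding B\<rho> using \<delta>R BR by simp
  qed
  then have main: "prob {\<omega> \<in> space M. hat_Phi d n Y (\<lambda>i j. stoch_int M (\<phi> j) (obs_path f g (W i) (Y i))) \<omega> \<noteq> Y 0 \<omega>}
    - opt_risk M n (\<lambda>i. obs_path f g (W i) (Y i)) Y \<le> 6508 * (\<rho>\<^sup>2 / max \<delta> \<rho>)"
    using opt_risk_ge unfolding \<delta>_eq[symmetric] by linarith
  \<comment> \<open>The logarithmic factors of the claim can only enlarge its right-hand side, since
    n \<ge> 86 exceeds e.\<close>
  have ln1: "1 \<le> ln (real n)"
  proof -
    have "exp 1 \<le> real n" using exp_le n86 by linarith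
    then show ?thesis using n0 by (subst ln_ge_iff) auto
  qed
  define r where "r = \<rho> * ln (real n)"
  have fin: "6508 * (\<rho>\<^sup>2 / max \<delta> \<rho>) \<le> (if \<Delta> < r then 6508 * r else 6508 / \<Delta> * \<rho>\<^sup>2 * (ln (real n))^2)"
  proof (cases "\<Delta> < r")
    case True
    have "\<rho>\<^sup>2 / max \<delta> \<rho> \<le> \<rho>\<^sup>2 / \<rho>" using \<rho>0 by (intro divide_left_mono) auto
    also have "\<dots> = \<rho> * 1" using \<rho>0 by (simp add: power2_eq_square)
    also have "\<dots> \<le> r" unfolding r_def using \<rho>0 ln1 by (intro mult_left_mono) auto
    finally show ?thesis using True by simp
  next
    case False
    \<comment> \<open>Positivity of r makes \<Delta> positive, so that it may divide; the bound then
      follows from max \<delta> \<rho> \<ge> \<delta> \<ge> \<Delta>.\<close>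
    have "0 < r" unfolding r_def using \<rho>0 ln1 by simp
    then have D0: "\<Delta> > 0" using False by simp
    have "\<rho>\<^sup>2 / max \<delta> \<rho> \<le> \<rho>\<^sup>2 / \<Delta>" using D0 sep \<rho>0 unfolding \<delta>_def[symmetric] by (intro divide_left_mono mult_pos_pos) auto
    also have "\<dots> = \<rho>\<^sup>2 / \<Delta> * 1\<^sup>2" by simp
    also have "\<dots> \<le> \<rho>\<^sup>2 / \<Delta> * (ln (real n))^2" using D0 ln1 by (intro mult_left_mono power_mono) auto
    finally show ?thesis using False by simp
  qed
  show "let X = (\<lambda>i. obs_path f g (W i) (Y i));
             Z = (\<lambda>i j. stoch_int M (\<phi> j) (X i));
             d = nat (floor ((R^2 * real n) powr (1 / (2 * s + 1))));
             r = R powr (1 / (2 * s + 1)) * real n powr (- s / (2 * s + 1)) * ln (real n)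
         in measure M {\<omega> \<in> space M. hat_Phi d n Y Z \<omega> \<noteq> Y 0 \<omega>} - opt_risk M n X Y
            \<le> (if \<Delta> < r then 6508 * r
                else 6508 / \<Delta> * R powr (2 / (2 * s + 1)) * real n powr (- (2 * s) / (2 * s + 1)) * (ln (real n))^2)"
    using order_trans[OF main fin]
    unfolding Let_def r_def \<rho>2 d_def Bd_def unfolding \<rho>_def q_def by (simp only: mult.assoc)
qed auto

end
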